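(* Let $F$, $\mathbf{K}_1$, $\mathbf{K}$, $\mathbf{D}(\mathbf{w})$, $\mathbf{H}(\mathbf{w})$, $\mathbf{Z}$, $\widehat{\mathbf{H}}(\mathbf{w})$ be as in the context. Assume that $F$ is twice differentiable, $\gamma$-strongly convex and $L$-smooth, with $\gamma\mathbf{I}\preceq\mathbf{H}(\mathbf{w})\preceq L\mathbf{I}$ for all $\mathbf{w}\in\mathbb{R}^n$, and that $\|\mathbf{D}(\mathbf{w})\|\le\lambda_1<\infty$ for all $\mathbf{w}\in\mathbb{R}^n$. Define $$\zeta = \lambda+\lambda_1\left\|\frac{\mathbf{Z}\mathbf{Z}^\top+\mu\mathbf{I}}{n}\right\|+\lambda_1\left\|\frac{\mathbf{K}_1+\mu\mathbf{I}}{n}\right\| .$$ Let $\epsilon>0$. For $0<\delta<1$, if $$m=\Omega\left(\frac{\zeta^2 n\|\mathbf{K}_1\|}{\epsilon^2\gamma^2}\log\frac{\mathrm{Tr}(\mathbf{K}_1)}{\|\mathbf{K}_1\|\,\delta}\right)$$ random features are sampled from $p(\boldsymbol{\omega})$, then $$\Pr\left(\big\|\widehat{\mathbf{H}}(\mathbf{w})-\mathbf{H}(\mathbf{w})\big\|\le\epsilon\gamma\right)\ge 1-\delta .$$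
   Context: $\|\cdot\|$ is the spectral norm of a matrix (Euclidean norm of a vector); $\mathbf{A}\preceq\mathbf{B}$ means $\mathbf{B}-\mathbf{A}$ is positive semi-definite; $\Omega(\cdot)$ is the Big Omega notation of complexity theory ($m=\Omega(q)$ means that $m$ is at least a suitable constant multiple of $q$). Data: points $\mathbf{x}_1,\dots,\mathbf{x}_n\in\mathbb{R}^d$, outputs $y_1,\dots,y_n$, parameters $\lambda,\mu>0$, and a loss $\ell(y,u)$ twice differentiable in its second argument $u$ ($\ell''$ is the second derivative in $u$). Kernel: $p$ is a probability density with support in $\mathbb{R}^d$, $\phi(\mathbf{x},\boldsymbol{\omega})$ is a real-valued feature map with $|\phi(\mathbf{x},\boldsymbol{\omega})|\le 1$ everywhere, $k_1(\mathbf{x},\mathbf{x}')=\int\phi(\mathbf{x},\boldsymbol{\omega})\phi(\mathbf{x}',\boldsymbol{\omega})p(\boldsymbol{\omega})d\boldsymbol{\omega}$, and $\mathbf{K}_1=[k_1(\mathbf{x}_i,\mathbf{x}_j)]_{i,j=1}^n$. The gram matrix is $\mathbf{K}=\mathbf{K}_1+\mu\mathbf{I}$. Objective: $F(\mathbf{w})=\frac1n\sum_{i=1}^n\ell\big(y_i,[\mathbf{K}\mathbf{w}]_i\big)+\frac{\lambda}{2}\mathbf{w}^\top\mathbf{K}\mathbf{w}$ for $\mathbf{w}\in\mathbb{R}^n$. $\mathbf{D}(\mathbf{w})$ is the $n\times n$ diagonal matrix with $[\mathbf{D}(\mathbf{w})]_{ii}=\ell''\big(y_i,[\mathbf{K}\mathbf{w}]_i\big)$,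 and the Hessian of $F$ is $\mathbf{H}(\mathbf{w})=\frac1n\mathbf{K}\mathbf{D}(\mathbf{w})\mathbf{K}+\lambda\mathbf{K}$. Random features: for $\boldsymbol{\omega}\in\mathbb{R}^d$, $\mathbf{z}(\boldsymbol{\omega})=[\phi(\mathbf{x}_1,\boldsymbol{\omega}),\dots,\phi(\mathbf{x}_n,\boldsymbol{\omega})]^\top$; for independent samples (random features) $\boldsymbol{\omega}_1,\dots,\boldsymbol{\omega}_m$ from $p$, $\mathbf{Z}=\frac{1}{\sqrt m}[\mathbf{z}(\boldsymbol{\omega}_1),\dots,\mathbf{z}(\boldsymbol{\omega}_m)]\in\mathbb{R}^{n\times m}$ and $$\widehat{\mathbf{H}}(\mathbf{w})=\frac1n(\mathbf{Z}\mathbf{Z}^\top+\mu\mathbf{I})\mathbf{D}(\mathbf{w})(\mathbf{Z}\mathbf{Z}^\top+\mu\mathbf{I})+\lambda(\mathbf{Z}\mathbf{Z}^\top+\mu\mathbf{I}).$$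
   Formalization: The constant in Ω may depend on an upper bound δ0<1 for δ and an upper bound κ for ε‖K‖/‖K_1‖ (so K_1≠0), but on nothing else; with one absolute constant the claim fails, e.g. n=1, φ∈{0,1} with P(φ=1)=q small, λ=μ=1, ε=1/2, m=1, δ=q/2. *)

theory Defs
  imports "HOL-Probability.Probability" "Jordan_Normal_Form.Matrix"
begin

(* The constant behind the Omega has to be chosen before the dimensions n and d, so vectors and
   matrices have their dimensions as values (Jordan_Normal_Form) and not as types. *)

hide_const (open) Finite_Cartesian_Product.vec Finite_Cartesian_Product.mat
  Finite_Cartesian_Product.row Finite_Cartesian_Product.column
  Finite_Cartesian_Product.vec_nth Finite_Cartesian_Product.vec_lambda
hide_type (open) Finite_Cartesian_Product.vec
unbundle no vec_syntax


definition vnorm :: "real vec \<Rightarrow> real" where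
  "vnorm v = sqrt (v \<bullet> v)"

definition spectral_norm :: "real mat \<Rightarrow> real" where
  "spectral_norm A =
     Sup {vnorm (A *\<^sub>v v) | v. v \<in> carrier_vec (dim_col A) \<and> vnorm v \<le> 1}"

definition mtrace :: "real mat \<Rightarrow> real" where
  "mtrace A = (\<Sum>i<dim_row A. A $$ (i, i))"

definition psd :: "nat \<Rightarrow> real mat \<Rightarrow> bool" where
  "psd n A \<longleftrightarrow> A \<in> carrier_mat n n \<and> A\<^sup>T = A \<and>
     (\<forall>v \<in> carrier_vec n. 0 \<le> v \<bullet> (A *\<^sub>v v))"

definition loewner_le :: "nat \<Rightarrow> real mat \<Rightarrow> real mat \<Rightarrow> bool" where
  "loewner_le n A B \<longleftrightarrow> psd n (B - A)"


(* Frechet derivatives on R^n = carrier_vec n: gradient of a scalar function, Jacobian of a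
   vector field. *)

definition has_gradient :: "nat \<Rightarrow> (real vec \<Rightarrow> real) \<Rightarrow> real vec \<Rightarrow> real vec \<Rightarrow> bool" where
  "has_gradient n F g w \<longleftrightarrow> g \<in> carrier_vec n \<and>
     (\<forall>e>0. \<exists>r>0. \<forall>h \<in> carrier_vec n. vnorm h < r \<longrightarrow>
        \<bar>F (w + h) - F w - g \<bullet> h\<bar> \<le> e * vnorm h)"

definition has_jacobian ::
    "nat \<Rightarrow> (real vec \<Rightarrow> real vec) \<Rightarrow> real mat \<Rightarrow> real vec \<Rightarrow> bool" where
  "has_jacobian n G J w \<longleftrightarrow> J \<in> carrier_mat n n \<and>
     (\<forall>e>0. \<exists>r>0. \<forall>h \<in> carrier_vec n. vnorm h < r \<longrightarrow>
        vnorm (G (w + h) - G w - J *\<^sub>v h) \<le> e * vnorm h)"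

definition twice_differentiable :: "nat \<Rightarrow> (real vec \<Rightarrow> real) \<Rightarrow> bool" where
  "twice_differentiable n F \<longleftrightarrow>
     (\<exists>G J. \<forall>w \<in> carrier_vec n. has_gradient n F (G w) w \<and> has_jacobian n G (J w) w)"

definition strongly_convex :: "nat \<Rightarrow> real \<Rightarrow> (real vec \<Rightarrow> real) \<Rightarrow> bool" where
  "strongly_convex n \<gamma> F \<longleftrightarrow>
     (\<forall>u \<in> carrier_vec n. \<forall>v \<in> carrier_vec n. \<forall>t \<in> {0..1}.
        F (t \<cdot>\<^sub>v u + (1 - t) \<cdot>\<^sub>v v)
          \<le> t * F u + (1 - t) * F v - \<gamma> / 2 * t * (1 - t) * (vnorm (u - v))\<^sup>2)"

definition smooth :: "nat \<Rightarrow> real \<Rightarrow> (real vec \<Rightarrow> real) \<Rightarrow> bool" where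
  "smooth n L F \<longleftrightarrow>
     (\<exists>G. (\<forall>w \<in> carrier_vec n. has_gradient n F (G w) w) \<and>
          (\<forall>u \<in> carrier_vec n. \<forall>v \<in> carrier_vec n.
             vnorm (G u - G v) \<le> L * vnorm (u - v)))"


(* Points of R^d are the elements of the product space over {..<d}, whose product of Lebesgue
   measures is d-dimensional Lebesgue measure. *)

type_synonym point = "nat \<Rightarrow> real"

definition lebesgue_d :: "nat \<Rightarrow> point measure" where
  "lebesgue_d d = (\<Pi>\<^sub>M i\<in>{..<d}. lborel)"

record problem =
  num :: nat
  dim :: nat
  pts :: "nat \<Rightarrow> point"
  outs :: "nat \<Rightarrow> real"
  loss :: "real \<Rightarrow> real \<Rightarrow> real"
  feat :: "point \<Rightarrow> point \<Rightarrow> real"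
  dens :: "point \<Rightarrow> real"
  lam :: real
  mu :: real

definition valid_problem :: "problem \<Rightarrow> bool" where
  "valid_problem P \<longleftrightarrow>
     0 < num P \<and> 0 < dim P \<and> 0 < lam P \<and> 0 < mu P \<and>
     (\<forall>i < num P. pts P i \<in> space (lebesgue_d (dim P))) \<and>
     (\<forall>y u. loss P y field_differentiable at u) \<and>
     (\<forall>y u. deriv (loss P y) field_differentiable at u) \<and>
     dens P \<in> borel_measurable (lebesgue_d (dim P)) \<and>
     (\<forall>\<omega> \<in> space (lebesgue_d (dim P)). 0 \<le> dens P \<omega>) \<and>
     (\<integral>\<^sup>+ \<omega>. ennreal (dens P \<omega>) \<partial>lebesgue_d (dim P)) = 1 \<and>
     (\<forall>x \<in> space (lebesgue_d (dim P)). feat P x \<in> borel_measurable (lebesgue_d (dim P))) \<and>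
     (\<forall>x \<in> space (lebesgue_d (dim P)). \<forall>\<omega> \<in> space (lebesgue_d (dim P)). \<bar>feat P x \<omega>\<bar> \<le> 1)"

definition kernel :: "problem \<Rightarrow> point \<Rightarrow> point \<Rightarrow> real" where
  "kernel P x x' = (\<integral>\<omega>. feat P x \<omega> * feat P x' \<omega> * dens P \<omega> \<partial>lebesgue_d (dim P))"

definition K1 :: "problem \<Rightarrow> real mat" where
  "K1 P = mat (num P) (num P) (\<lambda>(i, j). kernel P (pts P i) (pts P j))"

definition gram :: "problem \<Rightarrow> real mat" where
  "gram P = K1 P + mu P \<cdot>\<^sub>m 1\<^sub>m (num P)"

definition objective :: "problem \<Rightarrow> real vec \<Rightarrow> real" where
  "objective P w =
     1 / real (num P) * (\<Sum>i<num P. loss P (outs P i) ((gram P *\<^sub>v w) $ i))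
       + lam P / 2 * (w \<bullet> (gram P *\<^sub>v w))"

definition loss_curvature :: "problem \<Rightarrow> real vec \<Rightarrow> real mat" where
  "loss_curvature P w = mat (num P) (num P)
     (\<lambda>(i, j). if i = j then deriv (deriv (loss P (outs P i))) ((gram P *\<^sub>v w) $ i) else 0)"

definition hessian :: "problem \<Rightarrow> real vec \<Rightarrow> real mat" where
  "hessian P w = (1 / real (num P)) \<cdot>\<^sub>m (gram P * loss_curvature P w * gram P) + lam P \<cdot>\<^sub>m gram P"


definition feature_law :: "problem \<Rightarrow> point measure" where
  "feature_law P = density (lebesgue_d (dim P)) (\<lambda>\<omega>. ennreal (dens P \<omega>))"

definition sample_law :: "problem \<Rightarrow> nat \<Rightarrow> (nat \<Rightarrow> point) measure" where
  "sample_law P m = (\<Pi>\<^sub>M j\<in>{..<m}. feature_law P)"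

definition Zmat :: "problem \<Rightarrow> nat \<Rightarrow> (nat \<Rightarrow> point) \<Rightarrow> real mat" where
  "Zmat P m \<Omega> = mat (num P) m (\<lambda>(i, j). 1 / sqrt (real m) * feat P (pts P i) (\<Omega> j))"

definition gram_hat :: "problem \<Rightarrow> nat \<Rightarrow> (nat \<Rightarrow> point) \<Rightarrow> real mat" where
  "gram_hat P m \<Omega> = Zmat P m \<Omega> * (Zmat P m \<Omega>)\<^sup>T + mu P \<cdot>\<^sub>m 1\<^sub>m (num P)"

(* The curvature matrix is evaluated with the exact gram matrix also here. *)
definition hessian_hat :: "problem \<Rightarrow> nat \<Rightarrow> (nat \<Rightarrow> point) \<Rightarrow> real vec \<Rightarrow> real mat" where
  "hessian_hat P m \<Omega> w =
     (1 / real (num P)) \<cdot>\<^sub>m (gram_hat P m \<Omega> * loss_curvature P w * gram_hat P m \<Omega>)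
       + lam P \<cdot>\<^sub>m gram_hat P m \<Omega>"

(* A random variable, as it depends on the sampled features. *)
definition zeta :: "problem \<Rightarrow> real \<Rightarrow> nat \<Rightarrow> (nat \<Rightarrow> point) \<Rightarrow> real" where
  "zeta P lam1 m \<Omega> = lam P
     + lam1 * spectral_norm ((1 / real (num P)) \<cdot>\<^sub>m gram_hat P m \<Omega>)
     + lam1 * spectral_norm ((1 / real (num P)) \<cdot>\<^sub>m gram P)"

(* The requirement m = Omega(sample_size ...) is read as C * sample_size ... <= m, for a constant
   C > 0 that is independent of n, d and all data.  No single C serves every delta < 1 and every
   epsilon: for n = 1, feature values in {0, 1} and m = 1 it fails for delta close to 1, and for
   small K1 with epsilon * gamma / zeta much larger than norm K1 it fails as well.  So C may depend
   on an upper bound delta0 < 1 of delta and on an upper bound kappa of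
   epsilon * norm (gram P) / norm (K1 P); every instance with K1 P nonzero is covered by some such
   pair.  As zeta is random, so is the threshold. *)
definition sample_size ::
    "problem \<Rightarrow> real \<Rightarrow> real \<Rightarrow> real \<Rightarrow> real \<Rightarrow> nat \<Rightarrow> (nat \<Rightarrow> point) \<Rightarrow> real" where
  "sample_size P \<gamma> lam1 \<epsilon> \<delta> m \<Omega> =
     (zeta P lam1 m \<Omega>)\<^sup>2 * real (num P) * spectral_norm (K1 P) / (\<epsilon>\<^sup>2 * \<gamma>\<^sup>2)
       * ln (mtrace (K1 P) / (spectral_norm (K1 P) * \<delta>))"

end

theory Submission
  imports Defs
begin

text \<open>
  On the event \<open>C * sample_size \<le> m\<close> the random factor \<open>\<zeta>\<close> is at most \<open>\<epsilon> \<gamma> / t\<close> with the deterministic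
  \<open>t = sqrt (C n k l / m)\<close>, where \<open>k\<close> is the norm of \<open>K\<^sub>1\<close> and \<open>l = ln (tr K\<^sub>1 / (k \<delta>))\<close>. The difference of the Hessians
  is at most \<open>\<zeta>\<close> times the norm of \<open>Z Z\<^sup>T - K\<^sub>1\<close>, so it suffices to show that this norm exceeds \<open>t\<close> with
  probability at most \<open>\<delta>\<close>. Moreover \<open>t \<le> \<kappa> k\<close>, because \<open>\<gamma>\<close> is at most the norm of the Hessian.

  The tail bound is Markov's inequality for \<open>tr S\<^bsup>2p\<^esup>\<close>, where \<open>S = \<Sum>\<^sub>j (z\<^sub>j z\<^sub>j\<^sup>T - K\<^sub>1)\<close> and \<open>p\<close> is about \<open>l\<close>. Replacing one
  sample by an independent copy and a mean value inequality for traces give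
  \<open>E tr S\<^bsup>2r+2\<^esup> \<le> (2r+1) n (E tr S\<^bsup>2r+1\<^esup> + 2 m E tr (K\<^sub>1 S\<^bsup>2r\<^esup>))\<close>. Young-type inequalities absorb the right-hand side;
  what remains is bounded by \<open>E tr S\<^sup>2\<close> and \<open>tr K\<^sub>1\<^sup>p \<le> k\<^bsup>p-1\<^esup> tr K\<^sub>1\<close>, both proportional to \<open>tr K\<^sub>1\<close> and not to the
  dimension. The trace inequalities say that sequences such as \<open>i \<mapsto> tr (H\<^sup>T K\<^sup>i H B\<^bsup>2(N-i)\<^esup>)\<close> are convex, since
  their second differences are traces of squares; no spectral theorem is needed.
\<close>

section \<open>A ring containing all square matrices\<close>

text \<open>The two terms of the moment recursion are the two regimes of a Bernstein bound. The term
  with \<open>K\<close> is the variance and asks for \<open>m t\<^sup>2\<close> of order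
  \<open>n k l\<close>. The odd moment reflects the size of single summands, up to \<open>n\<close>,
  and asks for \<open>m t\<close> of order \<open>n l\<close>. The second demand follows from the
  first once \<open>t\<close> is at most a multiple of \<open>k\<close>; this is how
  \<open>\<kappa>\<close> enters the constant. The bound \<open>\<delta>0\<close> keeps
  \<open>l\<close> away from 0, so that rounding \<open>l\<close> up to an integer costs only a
  factor. Moments are used instead of exponentials because the inequalities for them reduce to the
  nonnegativity of \<open>tr n (star M * M)\<close>. The recurring obstacle is parity:
  \<open>S\<close> is indefinite, so its odd powers have no sign, and they have to be compared with
  even ones. Interpolation must also never reach \<open>S ^ 0\<close>, whose trace is the
  dimension.\<close>

text \<open>Infinite matrices with finite rows and columns form a unital ring, so that matrices whose size is a
  value and not a type can be handled by the type-class algebra. An \<open>n\<close>-by-\<open>n\<close> matrix is extended by zero;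
  \<open>blk n\<close> also admits scalar matrices, and it suffices for cyclicity of the truncated trace \<open>tr n\<close>.\<close>

typedef rcmat = "{f :: nat \<Rightarrow> nat \<Rightarrow> real. (\<forall>i. finite {j. f i j \<noteq> 0}) \<and> (\<forall>j. finite {i. f i j \<noteq> 0})}"
  morphisms entry Rcmat
  by (rule exI[of _ "\<lambda>i j. 0"]) auto

setup_lifting type_definition_rcmat

lemma finite_row: "finite {j. entry A i j \<noteq> 0}" and finite_col: "finite {i. entry A i j \<noteq> 0}"
  using entry[of A] by auto

lemma rcmat_eqI: "(\<And>i j. entry A i j = entry B i j) \<Longrightarrow> A = B"
  by (metis entry_inject ext)

lemma finite_sum_support:
  assumes "finite {j. f j \<noteq> (0::real)}" "finite {j. g j \<noteq> (0::real)}"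
  shows "finite {j. f j + g j \<noteq> 0}" "finite {j. f j - g j \<noteq> 0}"
  by (rule finite_subset[OF _ finite_UnI[OF assms]], force)+

lemma sum_row_cong:
  assumes "finite F" "finite G" "\<And>l. f l \<noteq> (0::real) \<Longrightarrow> l \<in> F \<and> l \<in> G"
  shows "sum f F = sum f G"
  using assms by (intro sum.mono_neutral_cong) auto

definition times_entry :: "(nat \<Rightarrow> nat \<Rightarrow> real) \<Rightarrow> (nat \<Rightarrow> nat \<Rightarrow> real) \<Rightarrow> nat \<Rightarrow> nat \<Rightarrow> real" where
  "times_entry f g i j = (\<Sum>l | f i l \<noteq> 0. f i l * g l j)"

text \<open>A nonzero entry of a product needs an intermediate index, so a row of the product is
  supported in finitely many finite row supports, and likewise for columns. Column finiteness is
  kept beside row finiteness so that transposes stay in the type.\<close>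

lemma times_entry_finite:
  assumes f: "\<And>i. finite {j. f i j \<noteq> 0}" "\<And>j. finite {i. f i j \<noteq> 0}"
    and g: "\<And>i. finite {j. g i j \<noteq> 0}" "\<And>j. finite {i. g i j \<noteq> 0}"
  shows "finite {j. times_entry f g i j \<noteq> 0}" "finite {i. times_entry f g i j \<noteq> 0}"
proof -
  have nz: "\<exists>l. f i l \<noteq> 0 \<and> g l j \<noteq> 0" if "times_entry f g i j \<noteq> 0" for i j
  proof (rule ccontr)
    assume "\<not> ?thesis"
    then have "times_entry f g i j = 0" unfolding times_entry_def by (intro sum.neutral) auto
    then show False using that by simp
  qed
  show "finite {j. times_entry f g i j \<noteq> 0}"
    by (rule finite_subset[of _ "\<Union>l\<in>{l. f i l \<noteq> 0}. {j. g l j \<noteq> 0}"])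
      (use nz in blast, rule finite_UN_I[OF f(1) g(1)])
  show "finite {i. times_entry f g i j \<noteq> 0}"
    by (rule finite_subset[of _ "\<Union>l\<in>{l. g l j \<noteq> 0}. {i. f i l \<noteq> 0}"])
      (use nz in blast, rule finite_UN_I[OF g(2) f(2)])
qed

instantiation rcmat :: real_algebra_1
begin
lift_definition zero_rcmat :: rcmat is "\<lambda>i j. 0" by simp
lift_definition one_rcmat :: rcmat is "\<lambda>i j. if i = j then 1 else 0" by simp
lift_definition plus_rcmat :: "rcmat \<Rightarrow> rcmat \<Rightarrow> rcmat" is "\<lambda>f g i j. f i j + g i j"
  by (auto intro!: finite_sum_support)
lift_definition minus_rcmat :: "rcmat \<Rightarrow> rcmat \<Rightarrow> rcmat" is "\<lambda>f g i j. f i j - g i j"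
  by (intro conjI allI finite_sum_support) blast+
lift_definition uminus_rcmat :: "rcmat \<Rightarrow> rcmat" is "\<lambda>f i j. - f i j" by simp
lift_definition scaleR_rcmat :: "real \<Rightarrow> rcmat \<Rightarrow> rcmat" is "\<lambda>c f i j. c * f i j" by simp
lift_definition times_rcmat :: "rcmat \<Rightarrow> rcmat \<Rightarrow> rcmat" is times_entry
  by (intro conjI allI times_entry_finite) blast+

text \<open>The row support in the product formula may be enlarged to any finite set;
  \<open>entry_mult_col\<close> starts from a column of \<open>B\<close> instead. Having both gives
  associativity: the outer indices fix two finite sets, and two finite sums are swapped.\<close>

lemma entry_mult_row:
  "finite F \<Longrightarrow> (\<And>l. entry A i l \<noteq> 0 \<Longrightarrow> l \<in> F) \<Longrightarrow> entry (A * B) i j = (\<Sum>l\<in>F. entry A i l * entry B l j)"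
  unfolding times_rcmat.rep_eq times_entry_def
  by (rule sum_row_cong) (auto simp: finite_row)

lemma entry_mult_col:
  "finite F \<Longrightarrow> (\<And>l. entry B l j \<noteq> 0 \<Longrightarrow> l \<in> F) \<Longrightarrow> entry (A * B) i j = (\<Sum>l\<in>F. entry A i l * entry B l j)"
  unfolding times_rcmat.rep_eq times_entry_def
  by (rule sum_row_cong) (auto simp: finite_row)

instance
proof
  fix A B C :: rcmat and a b :: real
  show "A * B * C = A * (B * C)"
  proof (rule rcmat_eqI)
    fix i j
    let ?F = "{l. entry C l j \<noteq> 0}" and ?G = "{k. entry A i k \<noteq> 0}"
    have "entry (A * B * C) i j = (\<Sum>l\<in>?F. \<Sum>k\<in>?G. entry A i k * entry B k l * entry C l j)"
      by (simp add: entry_mult_col[of ?F] entry_mult_row[of ?G] finite_row finite_col sum_distrib_right)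
    also have "\<dots> = (\<Sum>k\<in>?G. \<Sum>l\<in>?F. entry A i k * entry B k l * entry C l j)"
      by (rule sum.swap)
    also have "\<dots> = entry (A * (B * C)) i j"
      by (simp add: entry_mult_col[of ?F] entry_mult_row[of ?G] finite_row finite_col sum_distrib_left mult.assoc)
    finally show "entry (A * B * C) i j = entry (A * (B * C)) i j" .
  qed
  show "1 * A = A"
  proof (rule rcmat_eqI)
    fix i j show "entry (1 * A) i j = entry A i j"
      by (subst entry_mult_row[of "{i}"]) (auto simp: one_rcmat.rep_eq split: if_splits)
  qed
  show "A * 1 = A"
  proof (rule rcmat_eqI)
    fix i j show "entry (A * 1) i j = entry A i j"
      by (subst entry_mult_col[of "{j}"]) (auto simp: one_rcmat.rep_eq split: if_splits)
  qed
  show "(A + B) * C = A * C + B * C"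
  proof (rule rcmat_eqI)
    fix i j show "entry ((A + B) * C) i j = entry (A * C + B * C) i j"
      by (simp add: plus_rcmat.rep_eq entry_mult_col[of "{l. entry C l j \<noteq> 0}"] finite_col
          sum.distrib[symmetric] algebra_simps)
  qed
  show "A * (B + C) = A * B + A * C"
  proof (rule rcmat_eqI)
    fix i j show "entry (A * (B + C)) i j = entry (A * B + A * C) i j"
      by (simp add: plus_rcmat.rep_eq entry_mult_row[of "{l. entry A i l \<noteq> 0}"] finite_row
          sum.distrib[symmetric] algebra_simps)
  qed
  show "a *\<^sub>R A * B = a *\<^sub>R (A * B)"
  proof (rule rcmat_eqI)
    fix i j show "entry (a *\<^sub>R A * B) i j = entry (a *\<^sub>R (A * B)) i j"
      by (simp add: scaleR_rcmat.rep_eq entry_mult_col[of "{l. entry B l j \<noteq> 0}"] finite_col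
          sum_distrib_left mult.assoc)
  qed
  show "A * a *\<^sub>R B = a *\<^sub>R (A * B)"
  proof (rule rcmat_eqI)
    fix i j show "entry (A * a *\<^sub>R B) i j = entry (a *\<^sub>R (A * B)) i j"
      by (simp add: scaleR_rcmat.rep_eq entry_mult_row[of "{l. entry A i l \<noteq> 0}"] finite_row
          sum_distrib_left mult.left_commute)
  qed
  have "entry 0 0 0 \<noteq> entry 1 0 0" by (simp add: zero_rcmat.rep_eq one_rcmat.rep_eq)
  then show "(0::rcmat) \<noteq> 1" by metis
qed (rule rcmat_eqI, simp add: zero_rcmat.rep_eq plus_rcmat.rep_eq minus_rcmat.rep_eq
      uminus_rcmat.rep_eq scaleR_rcmat.rep_eq algebra_simps)+
end

lemmas entry_simps = zero_rcmat.rep_eq one_rcmat.rep_eq plus_rcmat.rep_eq minus_rcmat.rep_eq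
  uminus_rcmat.rep_eq scaleR_rcmat.rep_eq

lemma entry_sum: "entry (sum f F) i j = (\<Sum>x\<in>F. entry (f x) i j)"
  by (induction F rule: infinite_finite_induct) (simp_all add: entry_simps)

section \<open>Transposes, block matrices and the truncated trace\<close>

lift_definition star :: "rcmat \<Rightarrow> rcmat" is "\<lambda>f i j. f j i" by auto

lemma star_star [simp]: "star (star A) = A"
  and star_add [simp]: "star (A + B) = star A + star B"
  and star_diff [simp]: "star (A - B) = star A - star B"
  and star_scaleR [simp]: "star (c *\<^sub>R A) = c *\<^sub>R star A"
  and star_one [simp]: "star 1 = 1"
  by (rule rcmat_eqI, simp add: star.rep_eq entry_simps)+

lemma star_sum: "star (sum f F) = (\<Sum>x\<in>F. star (f x))"
  by (rule rcmat_eqI) (simp add: star.rep_eq entry_sum)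

lemma star_mult [simp]: "star (A * B) = star B * star A"
proof (rule rcmat_eqI)
  fix i j
  have F: "finite {l. entry B l i \<noteq> 0}" by (rule finite_col)
  show "entry (star (A * B)) i j = entry (star B * star A) i j"
    by (subst entry_mult_row[OF F]) (simp_all add: star.rep_eq entry_mult_col[OF F] mult.commute)
qed

lemma star_power [simp]: "star (A ^ k) = star A ^ k"
  by (induction k) (simp_all add: power_commutes)

text \<open>Block diagonal for the cut of the indices at \<open>n\<close>: a subring with unit on
  which the corner below \<open>n\<close> is multiplicative.\<close>

definition blk :: "nat \<Rightarrow> rcmat \<Rightarrow> bool" where
  "blk n A \<longleftrightarrow> (\<forall>i j. entry A i j \<noteq> 0 \<longrightarrow> (i < n \<longleftrightarrow> j < n))"

definition tr :: "nat \<Rightarrow> rcmat \<Rightarrow> real" where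
  "tr n A = (\<Sum>i<n. entry A i i)"

lemma blk_zero: "blk n 0" and blk_one: "blk n 1"
  by (simp_all add: blk_def entry_simps)

lemma blk_add: "blk n A \<Longrightarrow> blk n B \<Longrightarrow> blk n (A + B)"
  and blk_diff: "blk n A \<Longrightarrow> blk n B \<Longrightarrow> blk n (A - B)"
  and blk_scaleR: "blk n A \<Longrightarrow> blk n (c *\<^sub>R A)"
  and blk_star: "blk n A \<Longrightarrow> blk n (star A)"
  unfolding blk_def by (simp_all add: entry_simps star.rep_eq) (smt (verit, ccfv_threshold))+

lemma blk_sum: "(\<And>x. x \<in> F \<Longrightarrow> blk n (f x)) \<Longrightarrow> blk n (sum f F)"
  by (induction F rule: infinite_finite_induct) (auto simp: blk_zero blk_add)

lemma entry_mult_blk: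
  assumes "blk n A \<and> i < n \<or> blk n B \<and> j < n"
  shows "entry (A * B) i j = (\<Sum>l<n. entry A i l * entry B l j)"
  using assms
proof
  assume "blk n A \<and> i < n"
  then show ?thesis by (intro entry_mult_row) (auto simp: blk_def)
next
  assume "blk n B \<and> j < n"
  then show ?thesis by (intro entry_mult_col) (auto simp: blk_def)
qed

lemma blk_mult:
  assumes "blk n A" "blk n B" shows "blk n (A * B)"
  unfolding blk_def
proof (intro allI impI)
  fix i j assume nz: "entry (A * B) i j \<noteq> 0"
  have "\<exists>l. entry A i l * entry B l j \<noteq> 0"
  proof (rule ccontr)
    assume "\<not> ?thesis"
    then have "(\<Sum>l | entry A i l \<noteq> 0. entry A i l * entry B l j) = 0"
      by (intro sum.neutral) blast
    then have "entry (A * B) i j = 0"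
      by (subst entry_mult_row[OF finite_row[of A i]]) simp_all
    then show False using nz by simp
  qed
  then obtain l where "entry A i l \<noteq> 0" "entry B l j \<noteq> 0" by auto
  then show "i < n \<longleftrightarrow> j < n" using assms unfolding blk_def by blast
qed

lemma blk_power: "blk n A \<Longrightarrow> blk n (A ^ k)"
  by (induction k) (simp_all add: blk_one blk_mult)

lemmas blk_intros = blk_zero blk_one blk_add blk_diff blk_scaleR blk_star blk_sum blk_mult blk_power

lemma tr_add: "tr n (A + B) = tr n A + tr n B"
  and tr_diff: "tr n (A - B) = tr n A - tr n B"
  and tr_scaleR: "tr n (c *\<^sub>R A) = c * tr n A"
  and tr_minus: "tr n (- A) = - tr n A"
  and tr_zero: "tr n 0 = 0"
  by (simp_all add: tr_def entry_simps sum.distrib sum_subtractf sum_negf sum_distrib_left)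

lemma tr_sum: "tr n (sum f F) = (\<Sum>x\<in>F. tr n (f x))"
  by (induction F rule: infinite_finite_induct) (simp_all add: tr_add tr_zero)

lemma tr_mult_blk:
  assumes "blk n A \<or> blk n B" shows "tr n (A * B) = (\<Sum>i<n. \<Sum>l<n. entry A i l * entry B l i)"
  unfolding tr_def using assms by (intro sum.cong refl entry_mult_blk) auto

text \<open>One block factor is enough: it confines the intermediate index to the indices below
  \<open>n\<close>, and the double sum is then symmetric. Words can thus be rotated even when the
  other factor is arbitrary.\<close>

lemma tr_mult_commute:
  assumes "blk n A \<or> blk n B" shows "tr n (A * B) = tr n (B * A)"
proof -
  have "tr n (A * B) = (\<Sum>l<n. \<Sum>i<n. entry B l i * entry A i l)"
    unfolding tr_mult_blk[OF assms] by (subst sum.swap) (simp add: mult.commute)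
  also have "\<dots> = tr n (B * A)"
    by (rule tr_mult_blk[symmetric]) (use assms in auto)
  finally show ?thesis .
qed

text \<open>Without a block assumption the inner sum runs over the whole column support of
  \<open>M\<close>, also beyond \<open>n\<close>. Nonnegativity therefore holds for every
  \<open>M\<close>, which lets \<open>pos\<close> quantify over the whole ring.\<close>

lemma tr_star_mult: "tr n (star M * M) = (\<Sum>j<n. \<Sum>i | entry M i j \<noteq> 0. (entry M i j)\<^sup>2)"
  by (simp add: tr_def entry_mult_col[OF finite_col[of M]] star.rep_eq power2_eq_square)

lemma tr_star_mult_blk:
  assumes "blk n M" shows "tr n (star M * M) = (\<Sum>j<n. \<Sum>i<n. (entry M i j)\<^sup>2)"
  using assms by (simp add: tr_mult_blk star.rep_eq power2_eq_square)

lemma tr_star_nonneg: "0 \<le> tr n (star M * M)"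
  unfolding tr_star_mult by (intro sum_nonneg) simp

definition pos :: "nat \<Rightarrow> rcmat \<Rightarrow> bool" where
  "pos n A \<longleftrightarrow> (\<forall>M. 0 \<le> tr n (star M * A * M))"

lemma pos_nonneg: "pos n A \<Longrightarrow> 0 \<le> tr n (star M * A * M)"
  by (simp add: pos_def)

lemma pos_conj: "pos n A \<Longrightarrow> pos n (star B * A * B)"
  unfolding pos_def
proof
  fix M assume "\<forall>M. 0 \<le> tr n (star M * A * M)"
  then have "0 \<le> tr n (star (B * M) * A * (B * M))" by blast
  then show "0 \<le> tr n (star M * (star B * A * B) * M)" by (simp add: mult.assoc)
qed

lemma pos_one: "pos n 1"
  by (simp add: pos_def tr_star_nonneg)

lemma pos_add: "pos n A \<Longrightarrow> pos n B \<Longrightarrow> pos n (A + B)"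
  by (simp add: pos_def algebra_simps tr_add)

lemma pos_scaleR: "pos n A \<Longrightarrow> 0 \<le> c \<Longrightarrow> pos n (c *\<^sub>R A)"
  by (simp add: pos_def tr_scaleR)

text \<open>No square root is needed: an even power is \<open>star M * M\<close> with
  \<open>M\<close> half of the word, and an odd power is \<open>A\<close> conjugated by
  \<open>A ^ l\<close>.\<close>

lemma pos_power:
  assumes "pos n A" "star A = A" shows "pos n (A ^ k)"
proof (cases "even k")
  case True
  then obtain l where "k = l + l" by (metis mult_2 evenE)
  then show ?thesis using pos_conj[OF pos_one, of n "A ^ l"] assms by (simp add: power_add)
next
  case False
  then obtain l where "k = Suc (l + l)" by (metis mult_2 oddE Suc_eq_plus1)
  moreover have "A ^ l * A * A ^ l = A ^ Suc (l + l)"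
    by (simp add: power_add power_commutes mult.assoc)
  ultimately show ?thesis using pos_conj[OF assms(1), of "A ^ l"] assms by simp
qed

lemma pos_square: "star A = A \<Longrightarrow> pos n (A ^ 2)"
  using pos_conj[OF pos_one, of n A] by (simp add: power2_eq_square)

section \<open>Trace inequalities\<close>

lemma convex_seq_step:
  fixes g :: "nat \<Rightarrow> real"
  assumes conv: "\<And>i. Suc i < N \<Longrightarrow> 2 * g (Suc i) \<le> g i + g (Suc (Suc i))"
  shows "i < N \<Longrightarrow> (real i + 1) * g i \<le> g 0 + real i * g (Suc i)"
proof (induction i)
  case (Suc i)
  have "(real i + 1) * (2 * g (Suc i)) \<le> (real i + 1) * (g i + g (Suc (Suc i)))"
    using conv[OF Suc.prems] by (intro mult_left_mono) auto
  then show ?case using Suc by (simp add: algebra_simps)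
qed simp

text \<open>A convex sequence lies below its chord. The chord up to \<open>N\<close> is traded for
  the chord up to \<open>Suc N\<close> by bounding \<open>g N\<close> with
  \<open>convex_seq_step\<close>.\<close>

lemma convex_seq:
  fixes g :: "nat \<Rightarrow> real"
  assumes "\<And>i. Suc i < N \<Longrightarrow> 2 * g (Suc i) \<le> g i + g (Suc (Suc i))" "i \<le> N"
  shows "real N * g i \<le> (real N - real i) * g 0 + real i * g N"
  using assms
proof (induction N)
  case (Suc N)
  show ?case
  proof (cases "i = Suc N \<or> N = 0")
    case True
    then have "i = Suc N \<or> i = 0 \<and> N = 0" using Suc.prems(2) by auto
    then show ?thesis by auto
  next
    case False
    then have le: "i \<le> N" and N: "0 < real N" using Suc.prems(2) by auto
    have 1: "real N * g i \<le> (real N - real i) * g 0 + real i * g N"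
      by (rule Suc.IH) (use Suc.prems(1) le in auto)
    have 2: "(real N + 1) * g N \<le> g 0 + real N * g (Suc N)"
      by (rule convex_seq_step[of "Suc N"]) (use Suc.prems(1) in auto)
    have "real N * ((real N + 1) * g i) \<le> (real N + 1) * ((real N - real i) * g 0 + real i * g N)"
      using mult_left_mono[OF 1, of "real N + 1"] by (simp add: mult.left_commute)
    also have "\<dots> = (real N + 1) * (real N - real i) * g 0 + real i * ((real N + 1) * g N)"
      by (simp add: algebra_simps)
    also have "\<dots> \<le> (real N + 1) * (real N - real i) * g 0 + real i * (g 0 + real N * g (Suc N))"
      using mult_left_mono[OF 2, of "real i"] by simp
    also have "\<dots> = real N * ((real N + 1 - real i) * g 0 + real i * g (Suc N))"
      by (simp add: algebra_simps)
    finally show ?thesis using N by (simp add: add.commute)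
  qed
qed simp

text \<open>The discrete Hermite-Hadamard inequality, obtained by summing the chord bound.\<close>

lemma convex_seq_sum:
  fixes g :: "nat \<Rightarrow> real"
  assumes "\<And>i. Suc i < N \<Longrightarrow> 2 * g (Suc i) \<le> g i + g (Suc (Suc i))"
  shows "2 * (\<Sum>i\<le>N. g i) \<le> (real N + 1) * (g 0 + g N)"
proof (cases "N = 0")
  case False
  have "real N * (\<Sum>i\<le>N. g i) \<le> (\<Sum>i\<le>N. (real N - real i) * g 0 + real i * g N)"
    unfolding sum_distrib_left by (intro sum_mono convex_seq assms) auto
  also have "\<dots> = (\<Sum>i\<le>N. real N * g 0) + (\<Sum>i\<le>N. real i) * (g N - g 0)"
    unfolding sum_distrib_right sum.distrib[symmetric] by (intro sum.cong) (auto simp: algebra_simps)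
  also have "(\<Sum>i\<le>N. real i) = real N * (real N + 1) / 2"
    by (induction N) (simp_all add: field_simps)
  finally have "real N * (2 * (\<Sum>i\<le>N. g i)) \<le> real N * ((real N + 1) * (g 0 + g N))"
    by (simp add: field_simps)
  then show ?thesis using False by simp
qed simp

text \<open>The second difference is \<open>tr n (star Y * K ^ i * Y)\<close> for \<open>Y = (K * H - H * B\<^sup>2) * B ^ j\<close>.\<close>

lemma tr_word_convex:
  assumes K: "pos n K" "star K = K" and B: "star B = B" and blk: "blk n K" "blk n B" "blk n H"
  shows "2 * tr n (star H * K ^ Suc i * H * B ^ (2 * Suc j))
    \<le> tr n (star H * K ^ i * H * B ^ (2 * Suc (Suc j))) + tr n (star H * K ^ Suc (Suc i) * H * B ^ (2 * j))"
proof -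
  define X where "X = K * H - H * B\<^sup>2"
  define U where "U = star H * K ^ i * H"
  define V where "V = star H * K ^ Suc i * H"
  define W where "W = star H * K ^ Suc (Suc i) * H"
  have [intro]: "blk n U" "blk n V" "blk n W" "blk n X"
    unfolding U_def V_def W_def X_def by (intro blk_intros blk)+
  have bb: "B ^ j * B ^ j = B ^ (2 * j)" by (simp add: power_add[symmetric] mult_2)
  have sX: "star X * K ^ i * X = W - V * B\<^sup>2 - B\<^sup>2 * V + B\<^sup>2 * U * B\<^sup>2"
    unfolding X_def U_def V_def W_def
    by (simp add: K B algebra_simps power_commutes) (simp add: mult.assoc[symmetric] power_commutes)
  have "0 \<le> tr n (star (X * B ^ j) * K ^ i * (X * B ^ j))"
    using pos_power[OF K] by (rule pos_nonneg)
  also have "star (X * B ^ j) * K ^ i * (X * B ^ j) = B ^ j * (star X * K ^ i * X * B ^ j)"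
    by (simp add: B mult.assoc)
  also have "tr n \<dots> = tr n (star X * K ^ i * X * B ^ (2 * j))"
    by (subst tr_mult_commute) (auto simp: mult.assoc bb intro!: blk_intros blk)
  also have "\<dots> = tr n (W * B ^ (2 * j)) - tr n (V * B\<^sup>2 * B ^ (2 * j)) - tr n (B\<^sup>2 * V * B ^ (2 * j))
      + tr n (B\<^sup>2 * U * B\<^sup>2 * B ^ (2 * j))"
    unfolding sX by (simp add: distrib_right left_diff_distrib tr_add tr_diff)
  \<comment> \<open>Cyclicity identifies the two mixed terms, which produces the factor 2 of a
    second difference.\<close>
  also have "tr n (B\<^sup>2 * V * B ^ (2 * j)) = tr n (V * B ^ (2 * j) * B\<^sup>2)"
    by (subst mult.assoc, rule tr_mult_commute) (intro disjI1 blk_intros blk)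
  also have "V * B ^ (2 * j) * B\<^sup>2 = V * B ^ (2 * Suc j)"
    by (simp add: mult.assoc power_add[symmetric])
  also have "V * B\<^sup>2 * B ^ (2 * j) = V * B ^ (2 * Suc j)"
    by (simp add: mult.assoc power_add[symmetric] del: power_Suc)
  also have "tr n (B\<^sup>2 * U * B\<^sup>2 * B ^ (2 * j)) = tr n (U * B\<^sup>2 * B ^ (2 * j) * B\<^sup>2)"
    unfolding mult.assoc by (subst tr_mult_commute) (auto intro!: blk_intros blk simp: mult.assoc)
  also have "U * B\<^sup>2 * B ^ (2 * j) * B\<^sup>2 = U * B ^ (2 * Suc (Suc j))"
    by (simp add: mult.assoc power_add[symmetric] del: power_Suc)
  finally show ?thesis unfolding U_def V_def W_def by simp
qed

text \<open>The form in which convexity is used later: the index moves exponents from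
  \<open>B\<^sup>2\<close> to \<open>K\<close>. The instances take for \<open>K\<close> a square or
  a multiple of the kernel matrix; when \<open>B\<close> is a scalar matrix, it contributes powers
  of a number.\<close>

lemma tr_word_convex_seq:
  assumes K: "pos n K" "star K = K" and B: "star B = B" and blk: "blk n K" "blk n B" "blk n H"
    and "Suc i < N"
  shows "2 * tr n (star H * K ^ Suc i * H * B ^ (2 * (N - Suc i)))
    \<le> tr n (star H * K ^ i * H * B ^ (2 * (N - i)))
      + tr n (star H * K ^ Suc (Suc i) * H * B ^ (2 * (N - Suc (Suc i))))"
proof -
  have "N - Suc i = Suc (N - Suc (Suc i))" "N - i = Suc (Suc (N - Suc (Suc i)))"
    using \<open>Suc i < N\<close> by auto
  then show ?thesis using tr_word_convex[OF K B blk, of i "N - Suc (Suc i)"] by simp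
qed

text \<open>\<open>A\<close> may be indefinite, so an odd power of \<open>A\<close> cannot serve as
  the positive middle factor of a second difference. An odd word is instead compared with its two
  even neighbours, through the square of \<open>A ^ i * (A * H - H * B) * B ^ j\<close>.\<close>

lemma tr_word_odd:
  assumes A: "star A = A" and B: "star B = B" and H: "star H = H" and blk: "blk n A" "blk n B" "blk n H"
  shows "2 * tr n (H * A ^ Suc (2 * i) * H * B ^ Suc (2 * j))
    \<le> tr n (H * A ^ (2 * i) * H * B ^ (2 * Suc j)) + tr n (H * A ^ (2 * Suc i) * H * B ^ (2 * j))"
proof -
  define X where "X = A * H - H * B"
  define U where "U = H * A ^ (2 * i) * H"
  define V where "V = H * A ^ Suc (2 * i) * H"
  define W where "W = H * A ^ (2 * Suc i) * H"
  have [intro]: "blk n U" "blk n V" "blk n W" "blk n X"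
    unfolding U_def V_def W_def X_def by (intro blk_intros blk)+
  have bb: "B ^ j * B ^ j = B ^ (2 * j)" and aa: "A ^ i * A ^ i = A ^ (2 * i)"
    by (simp_all add: power_add[symmetric] mult_2)
  have sX: "star X * A ^ (2 * i) * X = W - V * B - B * V + B * U * B"
    unfolding X_def U_def V_def W_def
    by (simp add: A B H algebra_simps power_commutes) (simp add: mult.assoc[symmetric] power_commutes)
  have "0 \<le> tr n (star (A ^ i * X * B ^ j) * (A ^ i * X * B ^ j))"
    by (rule tr_star_nonneg)
  also have "star (A ^ i * X * B ^ j) * (A ^ i * X * B ^ j) = B ^ j * (star X * A ^ (2 * i) * X * B ^ j)"
    by (simp add: A B aa[symmetric] mult.assoc)
  also have "tr n \<dots> = tr n (star X * A ^ (2 * i) * X * B ^ (2 * j))"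
    by (subst tr_mult_commute) (auto simp: mult.assoc bb intro!: blk_intros blk)
  also have "\<dots> = tr n (W * B ^ (2 * j)) - tr n (V * B * B ^ (2 * j)) - tr n (B * V * B ^ (2 * j))
      + tr n (B * U * B * B ^ (2 * j))"
    unfolding sX by (simp add: distrib_right left_diff_distrib tr_add tr_diff)
  also have "tr n (B * V * B ^ (2 * j)) = tr n (V * B ^ (2 * j) * B)"
    by (subst mult.assoc, rule tr_mult_commute) (intro disjI1 blk_intros blk)
  also have "V * B ^ (2 * j) * B = V * B ^ Suc (2 * j)"
    by (simp add: mult.assoc power_commutes)
  also have "V * B * B ^ (2 * j) = V * B ^ Suc (2 * j)"
    by (simp add: mult.assoc)
  also have "tr n (B * U * B * B ^ (2 * j)) = tr n (U * B * B ^ (2 * j) * B)"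
    unfolding mult.assoc by (subst tr_mult_commute) (auto intro!: blk_intros blk simp: mult.assoc)
  also have "U * B * B ^ (2 * j) * B = U * B ^ (2 * Suc j)"
    by (simp add: mult.assoc power_commutes)
  finally show ?thesis unfolding U_def V_def W_def by simp
qed

lemma sum_even_odd:
  fixes f :: "nat \<Rightarrow> real"
  shows "(\<Sum>k\<le>2 * r. f k) = (\<Sum>i\<le>r. f (2 * i)) + (\<Sum>i<r. f (Suc (2 * i)))"
  by (induction r) simp_all

lemma sum_adjacent:
  fixes g :: "nat \<Rightarrow> real"
  shows "(\<Sum>i<r. g i + g (Suc i)) = 2 * (\<Sum>i\<le>r. g i) - g 0 - g r"
  by (induction r) simp_all

text \<open>Along the even indices the words form a convex sequence, with \<open>A\<^sup>2\<close>
  as the positive matrix, and each odd word is at most the mean of its neighbours. The two estimates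
  combine to \<open>2 * (r + 1) - 1 = 2 * r + 1\<close>, the constant of a sequence convex at all
  indices.\<close>

lemma tr_word_sum_le:
  assumes A: "star A = A" and B: "star B = B" and H: "star H = H" and blk: "blk n A" "blk n B" "blk n H"
  shows "2 * (\<Sum>k\<le>2 * r. tr n (H * A ^ k * H * B ^ (2 * r - k)))
    \<le> (2 * real r + 1) * (tr n (H * H * B ^ (2 * r)) + tr n (H * H * A ^ (2 * r)))"
proof -
  define f where "f k = tr n (H * A ^ k * H * B ^ (2 * r - k))" for k
  have conv: "2 * f (2 * Suc i) \<le> f (2 * i) + f (2 * Suc (Suc i))" if "Suc i < r" for i
    using tr_word_convex_seq[of n "A\<^sup>2" B H, OF pos_square _ B _ _ _ that] A B H blk
    unfolding f_def power_mult[symmetric]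
    by (simp add: blk_power diff_mult_distrib2 del: power_Suc mult_Suc_right)
  have odd: "2 * f (Suc (2 * i)) \<le> f (2 * i) + f (2 * Suc i)" if "i < r" for i
  proof -
    have e: "2 * r - Suc (2 * i) = Suc (2 * (r - Suc i))" "2 * r - 2 * i = 2 * Suc (r - Suc i)"
      "2 * r - 2 * Suc i = 2 * (r - Suc i)" using that by auto
    show ?thesis unfolding f_def e by (rule tr_word_odd[OF A B H blk])
  qed
  let ?s = "\<Sum>i\<le>r. f (2 * i)"
  have s: "2 * ?s \<le> (real r + 1) * (f 0 + f (2 * r))"
    using convex_seq_sum[of r "\<lambda>i. f (2 * i)"] conv by simp
  have "2 * (\<Sum>i<r. f (Suc (2 * i))) \<le> (\<Sum>i<r. f (2 * i) + f (2 * Suc i))"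
    unfolding sum_distrib_left by (intro sum_mono odd) simp
  also have "\<dots> = 2 * ?s - f 0 - f (2 * r)"
    using sum_adjacent[of "\<lambda>i. f (2 * i)" r] by simp
  finally have "2 * (\<Sum>k\<le>2 * r. f k) \<le> 4 * ?s - f 0 - f (2 * r)"
    by (simp add: sum_even_odd)
  also have "\<dots> \<le> (2 * real r + 1) * (f 0 + f (2 * r))"
    using s by (simp add: algebra_simps)
  also have "f (2 * r) = tr n (H * H * A ^ (2 * r))"
    unfolding f_def by (simp add: mult.assoc) (subst tr_mult_commute, auto intro!: blk_intros blk simp: mult.assoc tr_mult_commute)
  finally show ?thesis unfolding f_def by simp
qed

lemma power_diff_sum:
  fixes A B :: "'a::ring_1"
  shows "A ^ q - B ^ q = (\<Sum>k<q. A ^ k * (A - B) * B ^ (q - Suc k))"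
proof (induction q)
  case (Suc q)
  have "A ^ Suc q - B ^ Suc q = (A ^ q - B ^ q) * B + A ^ q * (A - B)"
    by (simp add: algebra_simps power_commutes)
  also have "(A ^ q - B ^ q) * B = (\<Sum>k<q. A ^ k * (A - B) * B ^ (Suc q - Suc k))"
    unfolding Suc.IH sum_distrib_right
  proof (rule sum.cong)
    fix k assume "k \<in> {..<q}"
    then have "Suc q - Suc k = Suc (q - Suc k)" by auto
    then show "A ^ k * (A - B) * B ^ (q - Suc k) * B = A ^ k * (A - B) * B ^ (Suc q - Suc k)"
      by (simp add: mult.assoc power_commutes)
  qed simp
  finally show ?case by simp
qed simp

text \<open>A mean value inequality for \<open>x ^ (2 * r + 1)\<close>: the derivative
  \<open>(2 * r + 1) * x ^ (2 * r)\<close> appears averaged over both end points. The difference of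
  powers telescopes into words with \<open>A - B\<close> between powers of \<open>A\<close> and
  \<open>B\<close>, and \<open>tr_word_sum_le\<close> pushes these to the two extreme words.\<close>

lemma tr_power_diff_le:
  assumes A: "star A = A" and B: "star B = B" and blk: "blk n A" "blk n B"
  shows "2 * tr n ((A - B) * (A ^ Suc (2 * r) - B ^ Suc (2 * r)))
    \<le> (2 * real r + 1) * (tr n ((A - B)\<^sup>2 * B ^ (2 * r)) + tr n ((A - B)\<^sup>2 * A ^ (2 * r)))"
proof -
  have "tr n ((A - B) * (A ^ Suc (2 * r) - B ^ Suc (2 * r)))
      = (\<Sum>k\<le>2 * r. tr n ((A - B) * A ^ k * (A - B) * B ^ (2 * r - k)))"
    unfolding power_diff_sum[of A "Suc (2 * r)"] sum_distrib_left tr_sum lessThan_Suc_atMost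
    by (simp add: mult.assoc)
  then show ?thesis
    using tr_word_sum_le[OF A B _ blk, of "A - B" r] A B blk
    by (simp add: blk_diff power2_eq_square)
qed

section \<open>Young-type inequalities and bounds for powers\<close>

lemma tr_even_nonneg: "star S = S \<Longrightarrow> 0 \<le> tr n (S ^ (2 * k))"
  using tr_star_nonneg[of n "S ^ k"] by (simp add: power_add[symmetric] mult_2)

lemma power_scaleR: "(c *\<^sub>R x) ^ k = c ^ k *\<^sub>R x ^ k" for x :: "'a::real_algebra_1"
  by (induction k) simp_all

text \<open>Young's inequality with exponents \<open>(s + 1) / s\<close> and \<open>s + 1\<close>,
  read off from the chord of a convex sequence at index 1. The weight \<open>\<theta>\<close> sits
  on \<open>K\<close>, so that a large multiple of the mixed trace costs only one copy of the top
  power.\<close>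

lemma tr_young:
  assumes K: "pos n K" "star K = K" and S: "star S = S" and blk: "blk n K" "blk n S" and \<theta>: "0 \<le> \<theta>"
  shows "real (Suc s) * (\<theta> * tr n (K * S ^ (2 * s)))
    \<le> real s * tr n (S ^ (2 * Suc s)) + \<theta> ^ Suc s * tr n (K ^ Suc s)"
proof -
  define g where "g i = tr n (star 1 * (\<theta> *\<^sub>R K) ^ i * 1 * S ^ (2 * (Suc s - i)))" for i
  have "real (Suc s) * g 1 \<le> (real (Suc s) - real 1) * g 0 + real 1 * g (Suc s)"
    unfolding g_def
    by (rule convex_seq, rule tr_word_convex_seq) (use K S \<theta> blk in \<open>auto intro: pos_scaleR blk_intros\<close>)
  then show ?thesis
    by (simp add: g_def tr_scaleR power_scaleR del: power_Suc mult_Suc_right)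
qed

text \<open>The nonnegative trace of \<open>(S - a)\<^sup>2 * S ^ (2 * s)\<close> trades the odd
  power for \<open>S ^ (2 * s)\<close>, and convexity interpolates the latter between
  \<open>S\<^sup>2\<close> and the top power.\<close>

lemma tr_odd_power_le:
  assumes S: "star S = S" and blk: "blk n S" and "0 < s"
  shows "2 * a * tr n (S ^ Suc (2 * s)) \<le> a ^ (2 * s) * tr n (S\<^sup>2) + 2 * tr n (S ^ (2 * Suc s))"
proof -
  \<comment> \<open>The outer factors \<open>S\<close> shift the exponents by 2, so that the
    sequence begins with the trace of \<open>S\<^sup>2\<close> and not with the dimension.\<close>
  define g where "g i = tr n (star S * (S\<^sup>2) ^ i * S * (a *\<^sub>R 1) ^ (2 * (s - i)))" for i
  have g: "g i = a ^ (2 * (s - i)) * tr n (S ^ (2 * Suc i))" for i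
    by (simp add: g_def S tr_scaleR power_scaleR power_mult[symmetric] power_commutes mult.assoc
        flip: power_Suc)
  have "real s * g (s - 1) \<le> (real s - real (s - 1)) * g 0 + real (s - 1) * g s"
    unfolding g_def
    by (rule convex_seq, rule tr_word_convex_seq) (use S blk in \<open>auto intro: pos_square blk_intros\<close>)
  \<comment> \<open>Both chord weights are enlarged to \<open>s\<close>, since \<open>g\<close> is
    nonnegative; the factor \<open>s\<close> then cancels.\<close>
  also have "\<dots> \<le> real s * (g 0 + g s)"
  proof -
    have "0 \<le> g i" for i unfolding g by (intro mult_nonneg_nonneg tr_even_nonneg[OF S] zero_le_even_power) simp
    then have "1 * g 0 \<le> real s * g 0" "real (s - 1) * g s \<le> real s * g s"
      using mult_right_mono[of 1 "real s" "g 0"] mult_right_mono[of "real (s - 1)" "real s" "g s"] \<open>0 < s\<close>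
      by simp_all
    then show ?thesis using \<open>0 < s\<close> by (simp add: algebra_simps of_nat_diff)
  qed
  finally have le: "g (s - 1) \<le> g 0 + g s" using \<open>0 < s\<close> by simp
  have "0 \<le> tr n (star ((S - a *\<^sub>R 1) * S ^ s) * ((S - a *\<^sub>R 1) * S ^ s))"
    by (rule tr_star_nonneg)
  also have "star ((S - a *\<^sub>R 1) * S ^ s) * ((S - a *\<^sub>R 1) * S ^ s)
      = S ^ (2 * Suc s) - (2 * a) *\<^sub>R S ^ Suc (2 * s) + a\<^sup>2 *\<^sub>R S ^ (2 * s)"
  proof -
    have "S ^ s * (S * (S * S ^ s)) = S ^ (2 * Suc s)" "S ^ s * (S * S ^ s) = S ^ Suc (2 * s)"
      "S ^ s * S ^ s = S ^ (2 * s)"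
      by (simp_all add: mult_2 flip: power_add power_Suc)
    moreover have "(2 * a) *\<^sub>R Y = a *\<^sub>R Y + a *\<^sub>R Y" for Y :: rcmat
      by (metis mult_2 scaleR_add_left)
    ultimately show ?thesis
      by (simp only: mult_Suc_right power_Suc) (simp add: S algebra_simps power2_eq_square)
  qed
  finally have "2 * a * tr n (S ^ Suc (2 * s)) \<le> tr n (S ^ (2 * Suc s)) + a\<^sup>2 * tr n (S ^ (2 * s))"
    by (simp add: tr_add tr_diff tr_scaleR)
  also have "a\<^sup>2 * tr n (S ^ (2 * s)) = g (s - 1)" using \<open>0 < s\<close> by (simp add: g)
  finally show ?thesis using le by (simp add: g)
qed

text \<open>The Frobenius norm is submultiplicative, by Cauchy-Schwarz in each entry of the
  product.\<close>

lemma tr_star_mult_le: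
  assumes "blk n A" "blk n H"
  shows "tr n (star (A * H) * (A * H)) \<le> tr n (star A * A) * tr n (star H * H)"
proof -
  have "tr n (star (A * H) * (A * H)) = (\<Sum>j<n. \<Sum>i<n. (\<Sum>l<n. entry A i l * entry H l j)\<^sup>2)"
    unfolding tr_star_mult_blk[OF blk_mult[OF assms]] using assms by (simp add: entry_mult_blk[of n A])
  also have "\<dots> \<le> (\<Sum>j<n. \<Sum>i<n. (\<Sum>l<n. (entry A i l)\<^sup>2) * (\<Sum>l<n. (entry H l j)\<^sup>2))"
    by (intro sum_mono Cauchy_Schwarz_ineq_sum)
  also have "\<dots> = (\<Sum>j<n. \<Sum>i<n. (\<Sum>l<n. (entry H l j)\<^sup>2) * (\<Sum>l<n. (entry A i l)\<^sup>2))"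
    by (simp only: mult.commute)
  also have "\<dots> = (\<Sum>j<n. \<Sum>l<n. (entry H l j)\<^sup>2) * (\<Sum>i<n. \<Sum>l<n. (entry A i l)\<^sup>2)"
    by (simp only: sum_product)
  also have "(\<Sum>i<n. \<Sum>l<n. (entry A i l)\<^sup>2) = tr n (star A * A)"
    unfolding tr_star_mult_blk[OF assms(1)] by (rule sum.swap)
  finally show ?thesis unfolding tr_star_mult_blk[OF assms(2)] by (simp only: mult.commute)
qed

text \<open>Stands in for the bound of the largest eigenvalue by the trace of a high power.
  \<open>H\<close> is a direction that \<open>S\<close> stretches by more than \<open>c\<close>. The
  convex sequence of the squared Frobenius norms of \<open>S ^ i * H\<close>, weighted by
  \<open>c ^ (2 * (p - i))\<close>, does not decrease in its first step, hence ends no lower than it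
  starts; submultiplicativity then removes \<open>H\<close>.\<close>

lemma tr_power_ge:
  assumes S: "star S = S" and blk: "blk n S" "blk n H" and p: "0 < p"
    and big: "c\<^sup>2 * tr n (star H * H) < tr n (star (S * H) * (S * H))"
  shows "c ^ (2 * p) \<le> tr n (S ^ (2 * p))"
proof -
  define x where "x = tr n (star H * H)"
  define g where "g i = tr n (star H * (S\<^sup>2) ^ i * H * (c *\<^sub>R 1) ^ (2 * (p - i)))" for i
  have g: "g i = c ^ (2 * (p - i)) * tr n (star (S ^ i * H) * (S ^ i * H))" for i
    by (simp add: g_def S tr_scaleR power_scaleR mult.assoc mult_2 power_add power_mult[symmetric])
  have "real p * g 1 \<le> (real p - real 1) * g 0 + real 1 * g p"
    unfolding g_def
    by (rule convex_seq, rule tr_word_convex_seq) (use S blk p in \<open>auto intro: pos_square blk_intros\<close>)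
  moreover have "real p * (c ^ (2 * p) * x) \<le> real p * g 1"
  proof -
    have "c ^ (2 * p) * x = c ^ (2 * (p - 1)) * (c\<^sup>2 * x)"
    proof -
      have "2 * p = 2 * (p - 1) + 2" using p by simp
      then show ?thesis by (metis mult.assoc power_add)
    qed
    also have "\<dots> \<le> g 1"
      unfolding g x_def using big by (intro mult_left_mono) (auto simp: zero_le_even_power)
    finally show ?thesis by (intro mult_left_mono) auto
  qed
  moreover have "g 0 = c ^ (2 * p) * x" by (simp add: g x_def)
  ultimately have 1: "c ^ (2 * p) * x \<le> g p" by (simp add: algebra_simps)
  also have "g p \<le> tr n (star (S ^ p) * S ^ p) * x"
    unfolding g x_def using tr_star_mult_le[OF blk_power[OF blk(1)] blk(2), of p] by simp
  also have "star (S ^ p) * S ^ p = S ^ (2 * p)" by (simp add: S mult_2 power_add)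
  finally have "c ^ (2 * p) * x \<le> tr n (S ^ (2 * p)) * x" .
  moreover have "0 < x"
  proof -
    have "x \<noteq> 0"
    proof
      assume "x = 0"
      then have "tr n (star (S * H) * (S * H)) \<le> 0"
        using tr_star_mult_le[OF blk] by (simp add: x_def)
      then show False using big \<open>x = 0\<close> by (simp add: x_def)
    qed
    then show ?thesis using tr_star_nonneg[of n H] by (simp add: x_def)
  qed
  ultimately show ?thesis by simp
qed

text \<open>\<open>k (k K - K\<^sup>2) = K (k - K) K + (k - K) K (k - K)\<close>.\<close>

lemma pos_diff_square:
  assumes K: "pos n K" "star K = K" and k: "0 < k" "pos n (k *\<^sub>R 1 - K)"
  shows "pos n (k *\<^sub>R K - K\<^sup>2)"
proof -
  let ?D = "k *\<^sub>R 1 - K"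
  have "pos n (K * ?D * K + ?D * K * ?D)"
    using pos_add[OF pos_conj[OF k(2), of K] pos_conj[OF K(1), of ?D]] K(2) by simp
  also have "K * ?D * K + ?D * K * ?D = k *\<^sub>R (k *\<^sub>R K - K\<^sup>2)"
    by (simp add: algebra_simps power2_eq_square)
  finally have "pos n (k *\<^sub>R (k *\<^sub>R K - K\<^sup>2))" .
  then have "pos n ((1 / k) *\<^sub>R (k *\<^sub>R (k *\<^sub>R K - K\<^sup>2)))"
    by (rule pos_scaleR) (use k(1) in simp)
  moreover have "(1 / k) *\<^sub>R (k *\<^sub>R Y) = Y" for Y :: rcmat using k(1) by simp
  ultimately show ?thesis by metis
qed

lemma power_commute_left:
  fixes a b :: "'a::monoid_mult"
  shows "a ^ l * (a * b) = a * (a ^ l * b)"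
  by (simp add: mult.assoc[symmetric] power_commutes)

text \<open>Each further power costs a factor \<open>k\<close>. According to parity,
  \<open>k *\<^sub>R K ^ Suc q - K ^ Suc (Suc q)\<close> is a conjugate, by a power of
  \<open>K\<close>, of \<open>k *\<^sub>R 1 - K\<close> or of
  \<open>k *\<^sub>R K - K\<^sup>2\<close>.\<close>

lemma tr_power_le:
  assumes K: "pos n K" "star K = K" and k: "0 < k" "pos n (k *\<^sub>R 1 - K)"
  shows "tr n (K ^ Suc q) \<le> k ^ q * tr n K"
proof (induction q)
  case (Suc q)
  have "0 \<le> tr n (k *\<^sub>R K ^ Suc q - K ^ Suc (Suc q))"
  proof (cases "even (Suc q)")
    case True
    then obtain l where l: "Suc q = l + l" by (metis mult_2 evenE)
    have "0 \<le> tr n (star (K ^ l) * (k *\<^sub>R 1 - K) * K ^ l)" by (rule pos_nonneg[OF k(2)])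
    also have "star (K ^ l) * (k *\<^sub>R 1 - K) * K ^ l = k *\<^sub>R K ^ Suc q - K ^ Suc (Suc q)"
      unfolding l by (simp add: K algebra_simps power_add power_commutes)
    finally show ?thesis .
  next
    case False
    then obtain l where l: "Suc q = Suc (l + l)" by (metis mult_2 oddE Suc_eq_plus1)
    have "0 \<le> tr n (star (K ^ l) * (k *\<^sub>R K - K\<^sup>2) * K ^ l)"
      by (rule pos_nonneg[OF pos_diff_square[OF K k]])
    also have "star (K ^ l) * (k *\<^sub>R K - K\<^sup>2) * K ^ l = k *\<^sub>R K ^ Suc q - K ^ Suc (Suc q)"
      unfolding l by (simp add: K algebra_simps power2_eq_square power_add power_commutes power_commute_left)
    finally show ?thesis .
  qed
  then have "tr n (K ^ Suc (Suc q)) \<le> k * tr n (K ^ Suc q)" by (simp add: tr_diff tr_scaleR)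
  also have "\<dots> \<le> k * (k ^ q * tr n K)" using Suc k(1) by (intro mult_left_mono) auto
  finally show ?case by simp
qed simp

section \<open>Random matrices\<close>

lift_definition mk :: "nat \<Rightarrow> (nat \<Rightarrow> nat \<Rightarrow> real) \<Rightarrow> rcmat" is
  "\<lambda>n f i j. if i < n \<and> j < n then f i j else 0"
  by auto

lemma entry_mk: "entry (mk n f) i j = (if i < n \<and> j < n then f i j else 0)"
  by (simp add: mk.rep_eq)

lemma blk_mk: "blk n (mk n f)"
  by (simp add: blk_def entry_mk)

lemma star_mk: "star (mk n f) = mk n (\<lambda>i j. f j i)"
  by (rule rcmat_eqI) (simp add: star.rep_eq entry_mk)

lemma mk_cong: "(\<And>i j. i < n \<Longrightarrow> j < n \<Longrightarrow> f i j = g i j) \<Longrightarrow> mk n f = mk n g"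
  by (rule rcmat_eqI) (simp add: entry_mk)

lemma mk_mult: "mk n f * mk n g = mk n (\<lambda>i j. \<Sum>l<n. f i l * g l j)"
proof (rule rcmat_eqI)
  fix i j
  have "entry (mk n f * mk n g) i j = (\<Sum>l<n. entry (mk n f) i l * entry (mk n g) l j)"
    by (rule entry_mult_row) (auto simp: entry_mk split: if_splits)
  then show "entry (mk n f * mk n g) i j = entry (mk n (\<lambda>i j. \<Sum>l<n. f i l * g l j)) i j"
    by (auto simp: entry_mk)
qed

lemma tr_mk: "tr n (mk n f) = (\<Sum>i<n. f i i)"
  by (simp add: tr_def entry_mk)

definition outer :: "nat \<Rightarrow> (nat \<Rightarrow> real) \<Rightarrow> rcmat" where
  "outer n v = mk n (\<lambda>i j. v i * v j)"

lemma star_outer: "star (outer n v) = outer n v"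
  by (simp add: outer_def star_mk mult.commute)

lemma blk_outer: "blk n (outer n v)"
  by (simp add: outer_def blk_mk)

lemma outer_square: "outer n v * outer n v = (\<Sum>l<n. (v l)\<^sup>2) *\<^sub>R outer n v"
  unfolding outer_def mk_mult
  by (rule rcmat_eqI) (auto simp: entry_simps entry_mk sum_distrib_right power2_eq_square algebra_simps)

text \<open>A vector stored as the first column of a matrix. It writes \<open>outer n v\<close> as a
  product \<open>column * star column\<close>, hence positive, and later turns a vector into a test
  direction for \<open>tr_power_ge\<close>.\<close>

definition column :: "nat \<Rightarrow> (nat \<Rightarrow> real) \<Rightarrow> rcmat" where
  "column n v = mk n (\<lambda>i j. if j = 0 then v i else 0)"

lemma outer_column: "outer n v = column n v * star (column n v)"
  unfolding outer_def column_def star_mk mk_mult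
proof (rule mk_cong)
  fix i j assume "i < n" "j < n"
  have "(\<Sum>l<n. (if l = 0 then v i else 0) * (if l = 0 then v j else 0)) = (\<Sum>l<n. if l = 0 then v i * v j else 0)"
    by (intro sum.cong) auto
  then show "v i * v j = (\<Sum>l<n. (if l = 0 then v i else 0) * (if l = 0 then v j else 0))"
    using \<open>i < n\<close> by simp
qed

lemma pos_outer: "pos n (outer n v)"
  using pos_conj[OF pos_one, of n "star (column n v)"] by (simp add: outer_column)

text \<open>The square of a rank-one matrix is the matrix times the squared length of
  \<open>v\<close>, which is at most \<open>n\<close> for bounded features. This is the origin of
  the factor \<open>n\<close> in the sample size.\<close>

lemma tr_outer_square_le:
  assumes v: "\<And>i. i < n \<Longrightarrow> \<bar>v i\<bar> \<le> 1" and S: "star S = S" and blk: "blk n S"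
  shows "tr n ((outer n v)\<^sup>2 * S ^ (2 * r)) \<le> real n * tr n (outer n v * S ^ (2 * r))"
proof -
  have "tr n (outer n v * S ^ (2 * r)) = tr n (star (S ^ r) * outer n v * S ^ r)"
    using tr_mult_commute[of n "S ^ r" "outer n v * S ^ r"] blk_power[OF blk, of r]
    by (simp add: S mult_2 power_add mult.assoc)
  then have nn: "0 \<le> tr n (outer n v * S ^ (2 * r))"
    using pos_nonneg[OF pos_outer] by metis
  have "(\<Sum>l<n. (v l)\<^sup>2) \<le> (\<Sum>l<n. 1)"
    using v by (intro sum_mono) (simp add: abs_square_le_1)
  then have "(\<Sum>l<n. (v l)\<^sup>2) * tr n (outer n v * S ^ (2 * r)) \<le> real n * tr n (outer n v * S ^ (2 * r))"
    using nn by (intro mult_right_mono) auto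
  then show ?thesis by (simp add: power2_eq_square outer_square tr_scaleR)
qed

section \<open>Bounded measurable functions and matrices\<close>

definition bdd_measurable :: "'a measure \<Rightarrow> ('a \<Rightarrow> real) \<Rightarrow> bool" where
  "bdd_measurable N f \<longleftrightarrow> f \<in> borel_measurable N \<and> (\<exists>B. \<forall>x\<in>space N. \<bar>f x\<bar> \<le> B)"

lemma bdd_measurableI:
  "f \<in> borel_measurable N \<Longrightarrow> (\<And>x. x \<in> space N \<Longrightarrow> \<bar>f x\<bar> \<le> B) \<Longrightarrow> bdd_measurable N f"
  unfolding bdd_measurable_def by blast

lemma bdd_measurable_const: "bdd_measurable N (\<lambda>_. c)"
  by (rule bdd_measurableI[of _ _ "\<bar>c\<bar>"]) auto

lemma bdd_measurable_add_mult:
  assumes "bdd_measurable N f" "bdd_measurable N g"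
  shows "bdd_measurable N (\<lambda>x. f x + g x)" "bdd_measurable N (\<lambda>x. f x * g x)"
proof -
  have [measurable]: "f \<in> borel_measurable N" "g \<in> borel_measurable N"
    using assms by (auto simp: bdd_measurable_def)
  obtain B C where BC: "\<And>x. x \<in> space N \<Longrightarrow> \<bar>f x\<bar> \<le> B" "\<And>x. x \<in> space N \<Longrightarrow> \<bar>g x\<bar> \<le> C"
    using assms unfolding bdd_measurable_def by blast
  show "bdd_measurable N (\<lambda>x. f x + g x)"
    by (rule bdd_measurableI[of _ _ "B + C"])
      (auto intro: order_trans[OF abs_triangle_ineq] add_mono BC)
  show "bdd_measurable N (\<lambda>x. f x * g x)"
  proof (rule bdd_measurableI[of _ _ "B * C"])
    fix x assume "x \<in> space N"
    then show "\<bar>f x * g x\<bar> \<le> B * C"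
      using BC[of x] unfolding abs_mult by (intro mult_mono) auto
  qed simp
qed

lemma bdd_measurable_sum:
  "(\<And>i. i \<in> I \<Longrightarrow> bdd_measurable N (f i)) \<Longrightarrow> bdd_measurable N (\<lambda>x. \<Sum>i\<in>I. f i x)"
  by (induction I rule: infinite_finite_induct)
    (auto intro: bdd_measurable_const bdd_measurable_add_mult)

text \<open>A bound at every point, not merely almost everywhere, passes to compositions with any
  measurable map, in particular with the replacement of a coordinate.\<close>

lemma bdd_measurable_comp:
  assumes "bdd_measurable M f" and h: "h \<in> measurable N M"
  shows "bdd_measurable N (\<lambda>x. f (h x))"
proof -
  obtain B where B: "\<And>x. x \<in> space M \<Longrightarrow> \<bar>f x\<bar> \<le> B" and f: "f \<in> borel_measurable M"
    using assms unfolding bdd_measurable_def by blast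
  show ?thesis
    by (rule bdd_measurableI[of _ _ B, OF measurable_compose[OF h f] B[OF measurable_space[OF h]]])
qed

lemma (in finite_measure) integrable_bdd: "bdd_measurable M f \<Longrightarrow> integrable M f"
  unfolding bdd_measurable_def
proof (elim conjE exE)
  fix B assume "f \<in> borel_measurable M" "\<forall>x\<in>space M. \<bar>f x\<bar> \<le> B"
  then show "integrable M f" by (intro integrable_const_bound[of f B] AE_I2) auto
qed

text \<open>The block property is required at all points, also outside the space, so that traces can
  be rewritten under an integral without a side condition.\<close>

definition regular :: "'a measure \<Rightarrow> nat \<Rightarrow> ('a \<Rightarrow> rcmat) \<Rightarrow> bool" where
  "regular N n A \<longleftrightarrow> (\<forall>x. blk n (A x)) \<and> (\<forall>i<n. \<forall>j<n. bdd_measurable N (\<lambda>x. entry (A x) i j))"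

lemma regularI:
  assumes "\<And>x. blk n (A x)" "\<And>i j. i < n \<Longrightarrow> j < n \<Longrightarrow> bdd_measurable N (\<lambda>x. entry (A x) i j)"
  shows "regular N n A"
  using assms unfolding regular_def by blast

lemma regularD:
  assumes "regular N n A"
  shows "blk n (A x)" "i < n \<Longrightarrow> j < n \<Longrightarrow> bdd_measurable N (\<lambda>x. entry (A x) i j)"
  using assms unfolding regular_def by blast+

lemma regular_const: "blk n A \<Longrightarrow> regular N n (\<lambda>_. A)"
  by (intro regularI bdd_measurable_const)

lemma regular_add: "regular N n A \<Longrightarrow> regular N n B \<Longrightarrow> regular N n (\<lambda>x. A x + B x)"
  unfolding regular_def by (simp add: entry_simps blk_add bdd_measurable_add_mult)

lemma regular_scaleR: "regular N n A \<Longrightarrow> regular N n (\<lambda>x. c *\<^sub>R A x)"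
  unfolding regular_def by (simp add: entry_simps blk_scaleR bdd_measurable_add_mult bdd_measurable_const)

lemma regular_diff: "regular N n A \<Longrightarrow> regular N n B \<Longrightarrow> regular N n (\<lambda>x. A x - B x)"
  using regular_add[of N n A "\<lambda>x. -1 *\<^sub>R B x"] regular_scaleR[of N n B "-1"] by simp

lemma regular_minus: "regular N n A \<Longrightarrow> regular N n (\<lambda>x. - A x)"
  using regular_scaleR[of N n A "-1"] by simp

lemma regular_mult:
  assumes A: "regular N n A" and B: "regular N n B"
  shows "regular N n (\<lambda>x. A x * B x)"
proof (rule regularI)
  fix i j assume ij: "i < n" "j < n"
  have "entry (A x * B x) i j = (\<Sum>l<n. entry (A x) i l * entry (B x) l j)" for x
    by (intro entry_mult_blk disjI1 conjI regularD[OF A] ij)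
  then show "bdd_measurable N (\<lambda>x. entry (A x * B x) i j)"
    using ij by (auto intro!: bdd_measurable_sum bdd_measurable_add_mult(2) regularD[OF A] regularD[OF B])
qed (intro blk_mult regularD[OF A] regularD[OF B])

lemma regular_power: "regular N n A \<Longrightarrow> regular N n (\<lambda>x. A x ^ k)"
  by (induction k) (auto intro: regular_const blk_one regular_mult)

lemma regular_sum: "(\<And>i. i \<in> I \<Longrightarrow> regular N n (A i)) \<Longrightarrow> regular N n (\<lambda>x. \<Sum>i\<in>I. A i x)"
  by (induction I rule: infinite_finite_induct) (auto intro: regular_const blk_zero regular_add)

lemma regular_comp:
  assumes "regular M n A" "f \<in> measurable N M" shows "regular N n (\<lambda>x. A (f x))"
  by (intro regularI bdd_measurable_comp[OF regularD(2)[OF assms(1)] assms(2)] regularD(1)[OF assms(1)])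

lemmas regular_intros = regular_const regular_add regular_diff regular_minus regular_scaleR regular_mult regular_power regular_sum

lemma regular_tr: "regular N n A \<Longrightarrow> bdd_measurable N (\<lambda>x. tr n (A x))"
  unfolding tr_def by (intro bdd_measurable_sum regularD) auto

lemma (in finite_measure) integrable_tr: "regular M n A \<Longrightarrow> integrable M (\<lambda>x. tr n (A x))"
  by (intro integrable_bdd regular_tr)

section \<open>Independent samples and one spare copy\<close>

context prob_space
begin

abbreviation iid :: "nat \<Rightarrow> (nat \<Rightarrow> 'a) measure" where
  "iid m \<equiv> \<Pi>\<^sub>M i\<in>{..<m}. M"

abbreviation iid1 :: "nat \<Rightarrow> ((nat \<Rightarrow> 'a) \<times> 'a) measure" where
  "iid1 m \<equiv> iid m \<Otimes>\<^sub>M M"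

lemma prob_space_iid: "prob_space (iid m)"
  by (rule prob_space_PiM) (rule prob_space_axioms)

lemma prob_space_iid1: "prob_space (iid1 m)"
  by (intro prob_space_pair prob_space_iid prob_space_axioms)

lemma pair_iid: "pair_sigma_finite (iid m) M"
  by (intro pair_sigma_finite.intro prob_space_imp_sigma_finite prob_space_iid prob_space_axioms)

lemma integral_iid1:
  fixes F :: "(nat \<Rightarrow> 'a) \<times> 'a \<Rightarrow> real"
  assumes "bdd_measurable (iid1 m) F"
  shows "(\<integral>x. F x \<partial>iid1 m) = (\<integral>\<Omega>. \<integral>\<omega>. F (\<Omega>, \<omega>) \<partial>M \<partial>iid m)"
  by (rule pair_sigma_finite.integral_fst'[OF pair_iid, symmetric])
    (rule finite_measure.integrable_bdd[OF prob_space.finite_measure[OF prob_space_iid1] assms])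

lemma measurable_upd: "j < m \<Longrightarrow> (\<lambda>x. (fst x)(j := snd x)) \<in> measurable (iid1 m) (iid m)"
  by (rule measurable_fun_upd[where J = "{..<m}"]) auto

lemma measurable_exchange:
  "j < m \<Longrightarrow> (\<lambda>x. ((fst x)(j := snd x), fst x j)) \<in> measurable (iid1 m) (iid1 m)"
  by (intro measurable_Pair measurable_upd)
    (auto intro: measurable_compose[OF measurable_fst measurable_component_singleton])

lemma integral_iid_split:
  fixes f :: "(nat \<Rightarrow> 'a) \<Rightarrow> real"
  assumes j: "j < m" and f: "integrable (iid m) f"
  shows "(\<integral>\<Omega>. f \<Omega> \<partial>iid m) = (\<integral>x. \<integral>y. f (x(j := y)) \<partial>M \<partial>(\<Pi>\<^sub>M i\<in>{..<m} - {j}. M))"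
proof -
  interpret product_sigma_finite "\<lambda>_. M"
    by (intro product_sigma_finite.intro prob_space_imp_sigma_finite prob_space_axioms)
  have "insert j ({..<m} - {j}) = {..<m}" using j by auto
  then show ?thesis
    using product_integral_insert[of "{..<m} - {j}" j f] f by simp
qed

text \<open>Sample \<open>j\<close> and the spare are exchangeable. Once coordinate \<open>j\<close>
  is split off and the rest is fixed, both remaining integrals are over \<open>M\<close>, and Fubini
  swaps them.\<close>

lemma integral_exchange:
  fixes F :: "(nat \<Rightarrow> 'a) \<times> 'a \<Rightarrow> real"
  assumes j: "j < m" and F: "bdd_measurable (iid1 m) F"
  shows "(\<integral>x. F ((fst x)(j := snd x), fst x j) \<partial>iid1 m) = (\<integral>x. F x \<partial>iid1 m)"
proof -
  let ?R = "\<Pi>\<^sub>M i\<in>{..<m} - {j}. M"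
  have iid: "(\<integral>x. G x \<partial>iid1 m) = (\<integral>x. \<integral>y. \<integral>\<omega>. G (x(j := y), \<omega>) \<partial>M \<partial>M \<partial>?R)"
    if "bdd_measurable (iid1 m) G" for G :: "(nat \<Rightarrow> 'a) \<times> 'a \<Rightarrow> real"
    unfolding integral_iid1[OF that]
    by (rule integral_iid_split[OF j], rule pair_sigma_finite.integrable_fst'[OF pair_iid],
        rule finite_measure.integrable_bdd[OF prob_space.finite_measure[OF prob_space_iid1] that])
  have "(\<integral>x. \<integral>y. \<integral>\<omega>. F (x(j := \<omega>), y) \<partial>M \<partial>M \<partial>?R) = (\<integral>x. \<integral>y. \<integral>\<omega>. F (x(j := y), \<omega>) \<partial>M \<partial>M \<partial>?R)"
  proof (rule Bochner_Integration.integral_cong[OF refl])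
    fix x assume x: "x \<in> space ?R"
    interpret MM: pair_sigma_finite M M
      by (intro pair_sigma_finite.intro prob_space_imp_sigma_finite prob_space_axioms)
    have m: "(\<lambda>p. (x(j := fst p), snd p)) \<in> measurable (M \<Otimes>\<^sub>M M) (iid1 m)"
    proof (rule measurable_Pair)
      show "(\<lambda>p. x(j := fst p)) \<in> measurable (M \<Otimes>\<^sub>M M) (iid m)"
        by (rule measurable_fun_upd[where J = "{..<m} - {j}"]) (use j x in auto)
    qed simp
    have "integrable (M \<Otimes>\<^sub>M M) (\<lambda>p. F (x(j := fst p), snd p))"
      using bdd_measurable_comp[OF F m]
      by (intro finite_measure.integrable_bdd prob_space.finite_measure prob_space_pair prob_space_axioms)
    then have "integrable (M \<Otimes>\<^sub>M M) (case_prod (\<lambda>a b. F (x(j := a), b)))"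
      by (simp add: case_prod_unfold)
    then show "(\<integral>y. \<integral>\<omega>. F (x(j := \<omega>), y) \<partial>M \<partial>M) = (\<integral>y. \<integral>\<omega>. F (x(j := y), \<omega>) \<partial>M \<partial>M)"
      by (rule MM.Fubini_integral)
  qed
  then show ?thesis unfolding iid[OF F] iid[OF bdd_measurable_comp[OF F measurable_exchange[OF j]]] by simp
qed

end

lemma tr_conj_mk:
  "tr n (star M * mk n f * M) = (\<Sum>j<n. \<Sum>i<n. \<Sum>l<n. entry M i j * f i l * entry M l j)"
proof -
  have row: "entry (mk n f * M) i j = (if i < n then \<Sum>l<n. f i l * entry M l j else 0)" for i j
    by (subst entry_mult_row[of "{..<n}"]) (auto simp: entry_mk split: if_splits)
  have "entry (star M * (mk n f * M)) j j = (\<Sum>i<n. entry M i j * (\<Sum>l<n. f i l * entry M l j))" for j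
    by (subst entry_mult_col[of "{..<n}"]) (auto simp: row star.rep_eq split: if_splits)
  then show ?thesis by (simp add: tr_def mult.assoc sum_distrib_left)
qed

text \<open>The scalar matrix \<open>k *\<^sub>R 1\<close> is not cut off at \<open>n\<close>, so
  the rows of a test element beyond \<open>n\<close> contribute as well; their contribution is
  nonnegative because \<open>0 \<le> k\<close>.\<close>

lemma pos_scaleR_one_diff_mk:
  assumes k: "0 \<le> k" and le: "\<And>v. (\<Sum>i<n. \<Sum>l<n. v i * f i l * v l) \<le> k * (\<Sum>i<n. (v i)\<^sup>2)"
  shows "pos n (k *\<^sub>R 1 - mk n f)"
  unfolding pos_def
proof
  fix M
  have "(\<Sum>i<n. (entry M i j)\<^sup>2) \<le> (\<Sum>i | entry M i j \<noteq> 0. (entry M i j)\<^sup>2)" for j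
  proof -
    have "(\<Sum>i<n. (entry M i j)\<^sup>2) = (\<Sum>i\<in>{..<n} \<inter> {i. entry M i j \<noteq> 0}. (entry M i j)\<^sup>2)"
      by (rule sum.mono_neutral_right) auto
    also have "\<dots> \<le> (\<Sum>i | entry M i j \<noteq> 0. (entry M i j)\<^sup>2)"
      by (rule sum_mono2) (auto simp: finite_col)
    finally show ?thesis .
  qed
  then have "k * (\<Sum>j<n. \<Sum>i<n. (entry M i j)\<^sup>2) \<le> k * tr n (star M * M)"
    unfolding tr_star_mult using k by (intro mult_left_mono sum_mono) auto
  moreover have "tr n (star M * mk n f * M) \<le> k * (\<Sum>j<n. \<Sum>i<n. (entry M i j)\<^sup>2)"
    unfolding tr_conj_mk sum_distrib_left[of k] by (intro sum_mono order_trans[OF le]) (simp add: sum_distrib_left)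
  ultimately show "0 \<le> tr n (star M * (k *\<^sub>R 1 - mk n f) * M)"
    by (simp add: right_diff_distrib left_diff_distrib tr_diff tr_scaleR)
qed

section \<open>Moments of the centred sum of features\<close>

locale features = prob_space M for M :: "'a measure" +
  fixes z :: "'a \<Rightarrow> nat \<Rightarrow> real" and n :: nat
  assumes z_measurable: "i < n \<Longrightarrow> (\<lambda>\<omega>. z \<omega> i) \<in> borel_measurable M"
    and z_bounded: "i < n \<Longrightarrow> \<omega> \<in> space M \<Longrightarrow> \<bar>z \<omega> i\<bar> \<le> 1"
begin

definition "K = mk n (\<lambda>i j. \<integral>\<omega>. z \<omega> i * z \<omega> j \<partial>M)"

text \<open>This is \<open>m\<close> times the deviation of \<open>Z Z\<^sup>T\<close> from
  \<open>K\<close>; leaving it unnormalised keeps the recursion free of factors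
  \<open>1 / m\<close>.\<close>

definition "S m \<Omega> = (\<Sum>j<m. outer n (z (\<Omega> j))) - real m *\<^sub>R K"

lemma z_bdd: "i < n \<Longrightarrow> j < n \<Longrightarrow> bdd_measurable M (\<lambda>\<omega>. z \<omega> i * z \<omega> j)"
  by (intro bdd_measurable_add_mult bdd_measurableI[of _ _ 1] z_measurable z_bounded)

lemma z_integrable: "i < n \<Longrightarrow> j < n \<Longrightarrow> integrable M (\<lambda>\<omega>. z \<omega> i * z \<omega> j)"
  by (intro integrable_bdd z_bdd)

lemma regular_outer: "regular M n (\<lambda>\<omega>. outer n (z \<omega>))"
  by (intro regularI blk_outer) (simp add: outer_def entry_mk z_bdd)

lemma star_K: "star K = K"
  unfolding K_def star_mk by (intro mk_cong Bochner_Integration.integral_cong) auto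

lemma blk_K: "blk n K"
  unfolding K_def by (rule blk_mk)

lemma star_S: "star (S m \<Omega>) = S m \<Omega>"
  by (simp add: S_def star_sum star_outer star_K)

lemma blk_S: "blk n (S m \<Omega>)"
  unfolding S_def by (intro blk_intros blk_K blk_outer)

lemma S_alt: "S m \<Omega> = (\<Sum>j<m. outer n (z (\<Omega> j)) - K)"
  by (simp add: S_def sum_subtractf sum_constant_scaleR del: sum_constant)

lemma tr_K_mult:
  assumes "blk n Q" shows "tr n (K * Q) = (\<integral>\<omega>. tr n (outer n (z \<omega>) * Q) \<partial>M)"
proof -
  have "(\<integral>\<omega>. tr n (outer n (z \<omega>) * Q) \<partial>M) = (\<integral>\<omega>. (\<Sum>i<n. \<Sum>l<n. z \<omega> i * z \<omega> l * entry Q l i) \<partial>M)"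
    using assms by (simp add: tr_mult_blk outer_def entry_mk)
  also have "\<dots> = (\<Sum>i<n. \<Sum>l<n. \<integral>\<omega>. z \<omega> i * z \<omega> l * entry Q l i \<partial>M)"
  proof -
    have i: "integrable M (\<lambda>\<omega>. z \<omega> i * z \<omega> l * entry Q l i)" if "i < n" "l < n" for i l
      by (intro integrable_mult_left z_integrable that)
    show ?thesis
      by (subst Bochner_Integration.integral_sum, (intro Bochner_Integration.integrable_sum i, auto)[1],
          intro sum.cong refl Bochner_Integration.integral_sum i) auto
  qed
  also have "\<dots> = tr n (K * Q)"
    using assms by (simp add: tr_mult_blk K_def entry_mk)
  finally show ?thesis by simp
qed

lemma pos_K: "pos n K"
  unfolding pos_def
proof
  fix X
  have "(\<integral>\<omega>. tr n (star X * outer n (z \<omega>) * X) \<partial>M) = tr n (star X * K * X)"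
      proof -
    have i: "integrable M (\<lambda>\<omega>. entry X i j * (z \<omega> i * z \<omega> l) * entry X l j)" if "i < n" "l < n" for i j l
      by (intro integrable_mult_left integrable_mult_right z_integrable that)
    have "(\<integral>\<omega>. (\<Sum>j<n. \<Sum>i<n. \<Sum>l<n. entry X i j * (z \<omega> i * z \<omega> l) * entry X l j) \<partial>M)
      = (\<Sum>j<n. \<Sum>i<n. \<Sum>l<n. \<integral>\<omega>. entry X i j * (z \<omega> i * z \<omega> l) * entry X l j \<partial>M)"
      by (subst Bochner_Integration.integral_sum, (intro Bochner_Integration.integrable_sum i, auto)[1],
          rule sum.cong[OF refl], subst Bochner_Integration.integral_sum,
          (intro Bochner_Integration.integrable_sum i, auto)[1],
          intro sum.cong refl Bochner_Integration.integral_sum i) auto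
    then show ?thesis unfolding outer_def K_def tr_conj_mk by simp
  qed
  moreover have "0 \<le> (\<integral>\<omega>. tr n (star X * outer n (z \<omega>) * X) \<partial>M)"
    by (intro Bochner_Integration.integral_nonneg pos_nonneg pos_outer)
  ultimately show "0 \<le> tr n (star X * K * X)" by simp
qed

lemma tr_K_nonneg: "0 \<le> tr n K"
  using pos_nonneg[OF pos_K, of 1] by simp

lemma regular_component: "j < m \<Longrightarrow> regular (iid m) n (\<lambda>\<Omega>. outer n (z (\<Omega> j)))"
  by (rule regular_comp[OF regular_outer]) simp

lemma regular_S: "regular (iid m) n (S m)"
  unfolding S_def by (intro regular_intros blk_intros blk_K regular_component) simp

lemma regular_fst: "regular (iid m) n A \<Longrightarrow> regular (iid1 m) n (\<lambda>x. A (fst x))"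
  by (rule regular_comp[OF _ measurable_fst])

lemma regular_snd: "regular (iid1 m) n (\<lambda>x. outer n (z (snd x)))"
  by (rule regular_comp[OF regular_outer measurable_snd])

lemmas integrable_iid = finite_measure.integrable_tr[OF prob_space.finite_measure[OF prob_space_iid]]
lemmas integrable_iid1 = finite_measure.integrable_tr[OF prob_space.finite_measure[OF prob_space_iid1]]

text \<open>The spare is independent of the samples in \<open>Q\<close>; integrating it out turns
  its rank-one matrix into \<open>K\<close>.\<close>

lemma integral_snd:
  assumes "regular (iid m) n Q"
  shows "(\<integral>x. tr n (outer n (z (snd x)) * Q (fst x)) \<partial>iid1 m) = (\<integral>\<Omega>. tr n (K * Q \<Omega>) \<partial>iid m)"
  by (subst integral_iid1) (auto intro!: regular_tr regular_mult regular_snd regular_fst assms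
      simp: tr_K_mult regularD[OF assms])

lemma integral_fst_only:
  assumes "bdd_measurable (iid m) f"
  shows "(\<integral>x. f (fst x) \<partial>iid1 m) = (\<integral>\<Omega>. f \<Omega> \<partial>iid m)"
  by (subst integral_iid1) (auto intro: bdd_measurable_comp[OF assms measurable_fst] simp: prob_space)

text \<open>The spare turns the centred factor into the difference \<open>H\<close>, which changes
  sign under the exchange. Hence half of \<open>H * (A ^ q - A' ^ q)\<close> can replace
  \<open>H * A ^ q\<close> under the integral. The mean value inequality lowers the power by one,
  and exchangeability merges the end points \<open>A\<close> and \<open>A'\<close>.\<close>

lemma exchangeable_pair:
  assumes j: "j < m"
  shows "(\<integral>\<Omega>. tr n ((outer n (z (\<Omega> j)) - K) * S m \<Omega> ^ Suc (2 * r)) \<partial>iid m)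
    \<le> (2 * real r + 1) * real n * (\<integral>\<Omega>. tr n ((outer n (z (\<Omega> j)) + K) * S m \<Omega> ^ (2 * r)) \<partial>iid m)"
proof -
  define Y where "Y \<omega> = outer n (z \<omega>)" for \<omega>
  define A where "A x = S m (fst x)" for x :: "(nat \<Rightarrow> 'a) \<times> 'a"
  define A' where "A' x = S m ((fst x)(j := snd x))" for x :: "(nat \<Rightarrow> 'a) \<times> 'a"
  define H where "H x = Y (fst x j) - Y (snd x)" for x :: "(nat \<Rightarrow> 'a) \<times> 'a"
  let ?q = "Suc (2 * r)"
  let ?T = "\<lambda>x. ((fst x)(j := snd x), fst x j) :: (nat \<Rightarrow> 'a) \<times> 'a"
  have regY: "regular (iid1 m) n (\<lambda>x. Y (fst x j))" "regular (iid1 m) n (\<lambda>x. Y (snd x))"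
    unfolding Y_def by (rule regular_fst[OF regular_component[OF j]], rule regular_snd)
  have regA: "regular (iid1 m) n A" and regA': "regular (iid1 m) n A'"
    unfolding A_def A'_def by (intro regular_fst regular_S regular_comp[OF regular_S] measurable_upd j)+
  have regH: "regular (iid1 m) n H"
    unfolding H_def by (intro regular_intros regY)
  note reg = regular_intros regY regA regA' regH
  note int = integrable_iid1 reg
  have diff: "A x - A' x = H x" for x
  proof -
    have "(\<Sum>i<m. outer n (z (fst x i))) - (\<Sum>i<m. outer n (z (((fst x)(j := snd x)) i)))
        = (\<Sum>i<m. if i = j then H x else 0)"
      unfolding sum_subtractf[symmetric] by (intro sum.cong) (auto simp: H_def Y_def)
    then show ?thesis using j by (simp add: A_def A'_def S_def)
  qed
  have e1: "(\<integral>\<Omega>. tr n (Y (\<Omega> j) * S m \<Omega> ^ k) \<partial>iid m) = (\<integral>x. tr n (Y (fst x j) * A x ^ k) \<partial>iid1 m)" for k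
    unfolding A_def Y_def
    by (rule integral_fst_only[symmetric, OF regular_tr])
      (intro regular_intros regular_component regular_S j)
  have e2: "(\<integral>\<Omega>. tr n (K * S m \<Omega> ^ k) \<partial>iid m) = (\<integral>x. tr n (Y (snd x) * A x ^ k) \<partial>iid1 m)" for k
    unfolding A_def Y_def by (rule integral_snd[symmetric]) (intro regular_intros regular_S)
  have "(\<integral>\<Omega>. tr n ((Y (\<Omega> j) - K) * S m \<Omega> ^ ?q) \<partial>iid m)
      = (\<integral>\<Omega>. tr n (Y (\<Omega> j) * S m \<Omega> ^ ?q) \<partial>iid m) - (\<integral>\<Omega>. tr n (K * S m \<Omega> ^ ?q) \<partial>iid m)"
    unfolding left_diff_distrib tr_diff Y_def
    by (intro Bochner_Integration.integral_diff integrable_iid regular_intros regular_component regular_S j blk_K)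
  also have "\<dots> = (\<integral>x. tr n (H x * A x ^ ?q) \<partial>iid1 m)"
    unfolding e1 e2 H_def left_diff_distrib tr_diff
    by (intro Bochner_Integration.integral_diff[symmetric] int)
  finally have 1: "(\<integral>\<Omega>. tr n ((Y (\<Omega> j) - K) * S m \<Omega> ^ ?q) \<partial>iid m) = (\<integral>x. tr n (H x * A x ^ ?q) \<partial>iid1 m)" .
  have T: "A (?T x) = A' x" "H (?T x) = - H x" for x
    by (simp_all add: A_def A'_def H_def)
  have ex1: "(\<integral>x. tr n (- H x * A' x ^ ?q) \<partial>iid1 m) = (\<integral>x. tr n (H x * A x ^ ?q) \<partial>iid1 m)"
    using integral_exchange[OF j, of "\<lambda>x. tr n (H x * A x ^ ?q)"] unfolding T by (simp add: regular_tr reg del: power_Suc)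
  have ex2: "(\<integral>x. tr n ((H x)\<^sup>2 * A' x ^ (2 * r)) \<partial>iid1 m) = (\<integral>x. tr n ((H x)\<^sup>2 * A x ^ (2 * r)) \<partial>iid1 m)"
    using integral_exchange[OF j, of "\<lambda>x. tr n ((H x)\<^sup>2 * A x ^ (2 * r))"] unfolding T by (simp add: regular_tr reg del: power_Suc)
  have "4 * (\<integral>x. tr n (H x * A x ^ ?q) \<partial>iid1 m)
      = 2 * ((\<integral>x. tr n (H x * A x ^ ?q) \<partial>iid1 m) + (\<integral>x. tr n (- H x * A' x ^ ?q) \<partial>iid1 m))"
    unfolding ex1 by simp
  also have "\<dots> = (\<integral>x. 2 * tr n (H x * (A x ^ ?q - A' x ^ ?q)) \<partial>iid1 m)"
  proof -
    have "(\<integral>x. tr n (H x * A x ^ ?q) + tr n (- H x * A' x ^ ?q) \<partial>iid1 m)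
      = (\<integral>x. tr n (H x * A x ^ ?q) \<partial>iid1 m) + (\<integral>x. tr n (- H x * A' x ^ ?q) \<partial>iid1 m)"
      by (intro Bochner_Integration.integral_add int)
    moreover have "tr n (H x * A x ^ ?q) + tr n (- H x * A' x ^ ?q) = tr n (H x * (A x ^ ?q - A' x ^ ?q))" for x
      unfolding right_diff_distrib by (simp add: tr_diff tr_minus del: power_Suc)
    ultimately show ?thesis unfolding integral_mult_right_zero by simp
  qed
  also have "\<dots> \<le> (\<integral>x. (2 * real r + 1) * (tr n ((H x)\<^sup>2 * A' x ^ (2 * r)) + tr n ((H x)\<^sup>2 * A x ^ (2 * r))) \<partial>iid1 m)"
  proof (rule integral_mono)
    show "2 * tr n (H x * (A x ^ ?q - A' x ^ ?q))
      \<le> (2 * real r + 1) * (tr n ((H x)\<^sup>2 * A' x ^ (2 * r)) + tr n ((H x)\<^sup>2 * A x ^ (2 * r)))" for x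
      using tr_power_diff_le[of "A x" "A' x" n r] unfolding diff
      by (simp add: A_def A'_def star_S blk_S del: power_Suc)
  qed (intro integrable_mult_right Bochner_Integration.integrable_add int)+
  also have "\<dots> = (2 * real r + 1) * (2 * (\<integral>x. tr n ((H x)\<^sup>2 * A x ^ (2 * r)) \<partial>iid1 m))"
  proof -
    have "(\<integral>x. tr n ((H x)\<^sup>2 * A' x ^ (2 * r)) + tr n ((H x)\<^sup>2 * A x ^ (2 * r)) \<partial>iid1 m)
      = (\<integral>x. tr n ((H x)\<^sup>2 * A' x ^ (2 * r)) \<partial>iid1 m) + (\<integral>x. tr n ((H x)\<^sup>2 * A x ^ (2 * r)) \<partial>iid1 m)"
      by (intro Bochner_Integration.integral_add int)
    then show ?thesis unfolding integral_mult_right_zero ex2 by simp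
  qed
  finally have 4: "4 * (\<integral>x. tr n (H x * A x ^ ?q) \<partial>iid1 m)
      \<le> (2 * real r + 1) * (2 * (\<integral>x. tr n ((H x)\<^sup>2 * A x ^ (2 * r)) \<partial>iid1 m))" .
  have half: "2 * a \<le> c * b" if "4 * a \<le> c * (2 * b)" for a b c :: real
    using that by (simp add: mult.commute)
  have 2: "2 * (\<integral>x. tr n (H x * A x ^ ?q) \<partial>iid1 m)
      \<le> (2 * real r + 1) * (\<integral>x. tr n ((H x)\<^sup>2 * A x ^ (2 * r)) \<partial>iid1 m)"
    by (rule half[OF 4])
  have "(\<integral>x. tr n ((H x)\<^sup>2 * A x ^ (2 * r)) \<partial>iid1 m)
      \<le> (\<integral>x. 2 * real n * tr n ((Y (fst x j) + Y (snd x)) * A x ^ (2 * r)) \<partial>iid1 m)"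
  proof (rule integral_mono)
    fix x assume x: "x \<in> space (iid1 m)"
    let ?Y = "Y (fst x j)" and ?Y' = "Y (snd x)" and ?A = "A x"
    have zb: "\<bar>z (fst x j) i\<bar> \<le> 1" "\<bar>z (snd x) i\<bar> \<le> 1" if "i < n" for i
    proof -
      have "fst x \<in> space (iid m)" "snd x \<in> space M"
        using x by (auto simp: space_pair_measure)
      moreover from this(1) have "fst x j \<in> space M"
        unfolding space_PiM by (rule PiE_mem) (use j in simp)
      ultimately show "\<bar>z (fst x j) i\<bar> \<le> 1" "\<bar>z (snd x) i\<bar> \<le> 1"
        using that by (intro z_bounded; simp)+
    qed
    have sA: "star ?A = ?A" "blk n ?A" by (simp_all add: A_def star_S blk_S)
    \<comment> \<open>The squares of the sum and of the difference add up to
      \<open>2 * (Y\<^sup>2 + Y'\<^sup>2)\<close>. Dropping the first, whose weighted trace is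
      nonnegative, bounds \<open>H\<^sup>2\<close> without mixed terms.\<close>
    have "0 \<le> tr n (star ((?Y + ?Y') * ?A ^ r) * ((?Y + ?Y') * ?A ^ r))" by (rule tr_star_nonneg)
    also have "\<dots> = tr n ((?Y + ?Y') * (?Y + ?Y') * ?A ^ r * ?A ^ r)"
      using tr_mult_commute[of n "?A ^ r" "(?Y + ?Y') * (?Y + ?Y') * ?A ^ r"] blk_power[OF sA(2)]
      by (simp add: sA Y_def star_outer mult.assoc)
    also have "\<dots> = tr n ((?Y + ?Y') * (?Y + ?Y') * ?A ^ (2 * r))"
      by (simp add: mult.assoc mult_2 power_add)
    finally have "tr n ((H x)\<^sup>2 * ?A ^ (2 * r))
        \<le> 2 * tr n (?Y\<^sup>2 * ?A ^ (2 * r)) + 2 * tr n (?Y'\<^sup>2 * ?A ^ (2 * r))"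
      unfolding H_def by (simp add: power2_eq_square algebra_simps tr_add tr_diff)
    also have "\<dots> \<le> 2 * (real n * tr n (?Y * ?A ^ (2 * r))) + 2 * (real n * tr n (?Y' * ?A ^ (2 * r)))"
      unfolding Y_def by (intro add_mono mult_left_mono tr_outer_square_le sA zb) auto
    finally show "tr n ((H x)\<^sup>2 * ?A ^ (2 * r)) \<le> 2 * real n * tr n ((?Y + ?Y') * ?A ^ (2 * r))"
      by (simp add: algebra_simps tr_add)
  qed (intro integrable_mult_right int)+
  also have "\<dots> = 2 * real n * (\<integral>\<Omega>. tr n ((Y (\<Omega> j) + K) * S m \<Omega> ^ (2 * r)) \<partial>iid m)"
  proof -
    have "(\<integral>x. tr n (Y (fst x j) * A x ^ (2 * r)) + tr n (Y (snd x) * A x ^ (2 * r)) \<partial>iid1 m)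
      = (\<integral>x. tr n (Y (fst x j) * A x ^ (2 * r)) \<partial>iid1 m) + (\<integral>x. tr n (Y (snd x) * A x ^ (2 * r)) \<partial>iid1 m)"
      by (intro Bochner_Integration.integral_add int)
    moreover have "(\<integral>\<Omega>. tr n (Y (\<Omega> j) * S m \<Omega> ^ (2 * r)) + tr n (K * S m \<Omega> ^ (2 * r)) \<partial>iid m)
      = (\<integral>\<Omega>. tr n (Y (\<Omega> j) * S m \<Omega> ^ (2 * r)) \<partial>iid m) + (\<integral>\<Omega>. tr n (K * S m \<Omega> ^ (2 * r)) \<partial>iid m)"
      unfolding Y_def
      by (intro Bochner_Integration.integral_add integrable_iid regular_intros regular_component regular_S j blk_K)
    ultimately show ?thesis unfolding integral_mult_right_zero distrib_right tr_add e1 e2 by simp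
  qed
  finally have 3: "(\<integral>x. tr n ((H x)\<^sup>2 * A x ^ (2 * r)) \<partial>iid1 m)
      \<le> 2 * real n * (\<integral>\<Omega>. tr n ((Y (\<Omega> j) + K) * S m \<Omega> ^ (2 * r)) \<partial>iid m)" .
  have "a \<le> c * d * e" if "2 * a \<le> c * b" "b \<le> 2 * d * e" "0 \<le> c" for a b c d e :: real
    using order_trans[OF that(1) mult_left_mono[OF that(2,3)]] by (simp add: algebra_simps)
  from this[OF 2 3] show ?thesis unfolding 1[symmetric] Y_def by simp
qed

text \<open>Every sample has mean \<open>K\<close>: exchange it with the spare and integrate the
  spare out.\<close>

lemma integral_tr_component: "j < m \<Longrightarrow> (\<integral>\<Omega>. tr n (outer n (z (\<Omega> j))) \<partial>iid m) = tr n K"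
proof -
  assume j: "j < m"
  have "(\<integral>\<Omega>. tr n (outer n (z (\<Omega> j))) \<partial>iid m) = (\<integral>x. tr n (outer n (z (fst x j))) \<partial>iid1 m)"
    by (rule integral_fst_only[symmetric, OF regular_tr[OF regular_component[OF j]]])
  also have "\<dots> = (\<integral>x. tr n (outer n (z (snd x))) \<partial>iid1 m)"
    using integral_exchange[OF j regular_tr[OF regular_snd]] by simp
  also have "\<dots> = (\<integral>\<Omega>. tr n K \<partial>iid m)"
    using integral_snd[of m "\<lambda>_. 1"] by (simp add: regular_const blk_one)
  also have "\<dots> = tr n K"
    using prob_space.prob_space[OF prob_space_iid] by simp
  finally show ?thesis .
qed

text \<open>One factor of the power is expanded as the sum of the centred matrices. After
  \<open>exchangeable_pair\<close> the terms recombine, because the rank-one matrices plus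
  \<open>K\<close> sum up to \<open>S\<close> plus \<open>2 m K\<close>.\<close>

lemma moment_recursion:
  "(\<integral>\<Omega>. tr n (S m \<Omega> ^ (2 * Suc r)) \<partial>iid m)
    \<le> (2 * real r + 1) * real n * ((\<integral>\<Omega>. tr n (S m \<Omega> ^ Suc (2 * r)) \<partial>iid m)
      + 2 * real m * (\<integral>\<Omega>. tr n (K * S m \<Omega> ^ (2 * r)) \<partial>iid m))"
proof -
  let ?Y = "\<lambda>\<Omega> j. outer n (z (\<Omega> j))"
  note int = integrable_iid regular_intros regular_component regular_S blk_K
  have "S m \<Omega> ^ (2 * Suc r) = (\<Sum>j<m. (?Y \<Omega> j - K) * S m \<Omega> ^ Suc (2 * r))" for \<Omega>
    unfolding sum_distrib_right[symmetric] S_alt[symmetric] by simp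
  then have "(\<integral>\<Omega>. tr n (S m \<Omega> ^ (2 * Suc r)) \<partial>iid m)
      = (\<integral>\<Omega>. (\<Sum>j<m. tr n ((?Y \<Omega> j - K) * S m \<Omega> ^ Suc (2 * r))) \<partial>iid m)"
    by (simp only: tr_sum)
  also have "\<dots> = (\<Sum>j<m. \<integral>\<Omega>. tr n ((?Y \<Omega> j - K) * S m \<Omega> ^ Suc (2 * r)) \<partial>iid m)"
    by (intro Bochner_Integration.integral_sum int) simp
  also have "\<dots> \<le> (\<Sum>j<m. (2 * real r + 1) * real n * (\<integral>\<Omega>. tr n ((?Y \<Omega> j + K) * S m \<Omega> ^ (2 * r)) \<partial>iid m))"
    by (intro sum_mono exchangeable_pair) simp
  also have "\<dots> = (2 * real r + 1) * real n * (\<Sum>j<m. \<integral>\<Omega>. tr n ((?Y \<Omega> j + K) * S m \<Omega> ^ (2 * r)) \<partial>iid m)"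
    by (rule sum_distrib_left[symmetric])
  also have "(\<Sum>j<m. \<integral>\<Omega>. tr n ((?Y \<Omega> j + K) * S m \<Omega> ^ (2 * r)) \<partial>iid m)
      = (\<integral>\<Omega>. (\<Sum>j<m. tr n ((?Y \<Omega> j + K) * S m \<Omega> ^ (2 * r))) \<partial>iid m)"
    by (intro Bochner_Integration.integral_sum[symmetric] int) simp
  also have "\<dots> = (\<integral>\<Omega>. tr n (S m \<Omega> ^ Suc (2 * r)) + 2 * real m * tr n (K * S m \<Omega> ^ (2 * r)) \<partial>iid m)"
  proof (intro Bochner_Integration.integral_cong refl)
    fix \<Omega>
    have "(\<Sum>j<m. ?Y \<Omega> j + K) = S m \<Omega> + (2 * real m) *\<^sub>R K"
    proof -
      have "(2 * real m) *\<^sub>R K = real m *\<^sub>R K + real m *\<^sub>R K" by (metis mult_2 scaleR_add_left)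
      then show ?thesis by (simp add: S_def sum.distrib sum_constant_scaleR del: sum_constant)
    qed
    then have "(\<Sum>j<m. (?Y \<Omega> j + K) * S m \<Omega> ^ (2 * r)) = S m \<Omega> ^ Suc (2 * r) + (2 * real m) *\<^sub>R (K * S m \<Omega> ^ (2 * r))"
      unfolding sum_distrib_right[symmetric] by (simp add: distrib_right)
    then show "(\<Sum>j<m. tr n ((?Y \<Omega> j + K) * S m \<Omega> ^ (2 * r)))
        = tr n (S m \<Omega> ^ Suc (2 * r)) + 2 * real m * tr n (K * S m \<Omega> ^ (2 * r))"
      unfolding tr_sum[symmetric] by (simp only: tr_add tr_scaleR)
  qed
  also have "\<dots> = (\<integral>\<Omega>. tr n (S m \<Omega> ^ Suc (2 * r)) \<partial>iid m) + (\<integral>\<Omega>. 2 * real m * tr n (K * S m \<Omega> ^ (2 * r)) \<partial>iid m)"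
    by (intro Bochner_Integration.integral_add integrable_mult_right int)
  also have "(\<integral>\<Omega>. 2 * real m * tr n (K * S m \<Omega> ^ (2 * r)) \<partial>iid m) = 2 * real m * (\<integral>\<Omega>. tr n (K * S m \<Omega> ^ (2 * r)) \<partial>iid m)"
    by (rule integral_mult_right_zero)
  finally show ?thesis .
qed

text \<open>The recursion at \<open>r = 0\<close>, where the odd moment is the mean trace of
  \<open>S\<close> and vanishes.\<close>

lemma second_moment: "(\<integral>\<Omega>. tr n ((S m \<Omega>)\<^sup>2) \<partial>iid m) \<le> 2 * real m * real n * tr n K"
proof -
  have c: "(\<integral>\<Omega>. c \<partial>iid m) = c" for c :: real
    using prob_space.prob_space[OF prob_space_iid] by simp
  have "(\<integral>\<Omega>. tr n (S m \<Omega>) \<partial>iid m) = (\<integral>\<Omega>. (\<Sum>j<m. tr n (outer n (z (\<Omega> j)))) - real m * tr n K \<partial>iid m)"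
    by (simp add: S_def tr_diff tr_scaleR tr_sum)
  also have "\<dots> = (\<integral>\<Omega>. (\<Sum>j<m. tr n (outer n (z (\<Omega> j)))) \<partial>iid m) - (\<integral>\<Omega>. real m * tr n K \<partial>iid m)"
    by (intro Bochner_Integration.integral_diff Bochner_Integration.integrable_sum integrable_iid
        regular_component finite_measure.integrable_bdd[OF prob_space.finite_measure[OF prob_space_iid]]
        bdd_measurable_const) simp
  also have "(\<integral>\<Omega>. (\<Sum>j<m. tr n (outer n (z (\<Omega> j)))) \<partial>iid m) = (\<Sum>j<m. \<integral>\<Omega>. tr n (outer n (z (\<Omega> j))) \<partial>iid m)"
    by (intro Bochner_Integration.integral_sum integrable_iid regular_component) simp
  also have "\<dots> = real m * tr n K"
    by (simp add: integral_tr_component)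
  finally have "(\<integral>\<Omega>. tr n (S m \<Omega>) \<partial>iid m) = 0" unfolding c by simp
  then show ?thesis
    using moment_recursion[of m 0] prob_space.prob_space[OF prob_space_iid, of m]
    unfolding power2_eq_square by (simp add: algebra_simps)
qed

text \<open>The constants let the recursion absorb itself: its factor \<open>(2 * s + 1) * n\<close>
  is \<open>2 * a / 8\<close> for the odd moment and, together with \<open>2 * m\<close>, it is
  \<open>\<theta> / 4\<close> for the term with \<open>K\<close>. Each Young-type bound then returns
  a quarter of the moment, and half of it stays on the left.\<close>

lemma moment_bound:
  assumes s: "0 < s" and k: "0 < k" "pos n (k *\<^sub>R 1 - K)" and n: "0 < n" and m: "0 < m"
  defines "a \<equiv> 4 * (2 * real s + 1) * real n" and "\<theta> \<equiv> 8 * (2 * real s + 1) * real n * real m"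
  shows "(\<integral>\<Omega>. tr n (S m \<Omega> ^ (2 * Suc s)) \<partial>iid m)
    \<le> tr n K * (a ^ (2 * s) * real m * real n + \<theta> ^ Suc s * k ^ s) / 2"
proof -
  note int = integrable_iid regular_intros regular_S blk_K
  define G where "G = (\<integral>\<Omega>. tr n (S m \<Omega> ^ (2 * Suc s)) \<partial>iid m)"
  define I where "I = (\<integral>\<Omega>. tr n (S m \<Omega> ^ Suc (2 * s)) \<partial>iid m)"
  define J where "J = (\<integral>\<Omega>. tr n (K * S m \<Omega> ^ (2 * s)) \<partial>iid m)"
  define T where "T = tr n K"
  have a: "0 < a" and \<theta>: "0 < \<theta>" using n m by (auto simp: a_def \<theta>_def)
  have G0: "0 \<le> G"
    unfolding G_def by (intro Bochner_Integration.integral_nonneg tr_even_nonneg star_S)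
  have "2 * a * I = (\<integral>\<Omega>. 2 * a * tr n (S m \<Omega> ^ Suc (2 * s)) \<partial>iid m)"
    unfolding I_def by (rule integral_mult_right_zero[symmetric])
  also have "\<dots> \<le> (\<integral>\<Omega>. a ^ (2 * s) * tr n ((S m \<Omega>)\<^sup>2) + 2 * tr n (S m \<Omega> ^ (2 * Suc s)) \<partial>iid m)"
    by (intro integral_mono tr_odd_power_le star_S blk_S s integrable_mult_right Bochner_Integration.integrable_add int)
  also have "\<dots> = (\<integral>\<Omega>. a ^ (2 * s) * tr n ((S m \<Omega>)\<^sup>2) \<partial>iid m) + (\<integral>\<Omega>. 2 * tr n (S m \<Omega> ^ (2 * Suc s)) \<partial>iid m)"
    by (intro Bochner_Integration.integral_add integrable_mult_right int)
  also have "\<dots> = a ^ (2 * s) * (\<integral>\<Omega>. tr n ((S m \<Omega>)\<^sup>2) \<partial>iid m) + 2 * G"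
    unfolding integral_mult_right_zero G_def by (rule refl)
  also have "\<dots> \<le> a ^ (2 * s) * (2 * real m * real n * T) + 2 * G"
    unfolding T_def using a by (intro add_right_mono mult_left_mono second_moment) simp
  finally have I: "2 * a * I \<le> a ^ (2 * s) * (2 * real m * real n * T) + 2 * G" .
  have "real (Suc s) * (\<theta> * J) = (\<integral>\<Omega>. real (Suc s) * (\<theta> * tr n (K * S m \<Omega> ^ (2 * s))) \<partial>iid m)"
    unfolding J_def integral_mult_right_zero by (rule refl)
  also have "\<dots> \<le> (\<integral>\<Omega>. real s * tr n (S m \<Omega> ^ (2 * Suc s)) + \<theta> ^ Suc s * tr n (K ^ Suc s) \<partial>iid m)"
    by (intro integral_mono tr_young pos_K star_K star_S blk_S blk_K less_imp_le[OF \<theta>]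
        integrable_mult_right Bochner_Integration.integrable_add int blk_power)
  also have "\<dots> = (\<integral>\<Omega>. real s * tr n (S m \<Omega> ^ (2 * Suc s)) \<partial>iid m) + (\<integral>\<Omega>. \<theta> ^ Suc s * tr n (K ^ Suc s) \<partial>iid m)"
    by (intro Bochner_Integration.integral_add integrable_mult_right int blk_power)
  also have "\<dots> = real s * G + \<theta> ^ Suc s * tr n (K ^ Suc s)"
    unfolding integral_mult_right_zero G_def using prob_space.prob_space[OF prob_space_iid] by simp
  also have "\<dots> \<le> real s * G + \<theta> ^ Suc s * (k ^ s * T)"
    unfolding T_def using \<theta> by (intro add_left_mono mult_left_mono tr_power_le pos_K star_K k) simp
  also have "\<dots> \<le> real (Suc s) * (G + \<theta> ^ Suc s * (k ^ s * T))"
  proof -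
    have "0 \<le> \<theta> ^ Suc s * (k ^ s * T)" using \<theta> k tr_K_nonneg by (simp add: T_def)
    then have "1 * (\<theta> ^ Suc s * (k ^ s * T)) \<le> real (Suc s) * (\<theta> ^ Suc s * (k ^ s * T))"
      by (intro mult_right_mono) auto
    then show ?thesis using G0 by (simp add: distrib_left distrib_right)
  qed
  finally have J: "\<theta> * J \<le> G + \<theta> ^ Suc s * (k ^ s * T)"
    by (simp only: mult_le_cancel_left_pos of_nat_0_less_iff zero_less_Suc)
  have "G \<le> (2 * real s + 1) * real n * (I + 2 * real m * J)"
    unfolding G_def I_def J_def by (rule moment_recursion)
  also have "\<dots> = (2 * a * I) / 8 + (\<theta> * J) / 4"
    by (simp add: a_def \<theta>_def field_simps)
  also have "\<dots> \<le> (a ^ (2 * s) * (2 * real m * real n * T) + 2 * G) / 8 + (G + \<theta> ^ Suc s * (k ^ s * T)) / 4"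
    using I J by (intro add_mono divide_right_mono) auto
  finally have le: "G \<le> (a ^ (2 * s) * (2 * real m * real n * T) + 2 * G) / 8 + (G + \<theta> ^ Suc s * (k ^ s * T)) / 4" .
  have "G \<le> (x + y) / 2" if "G \<le> (2 * x + 2 * G) / 8 + (G + y) / 4" for x y
    using that by (simp add: field_simps)
  from this[of "a ^ (2 * s) * (real m * real n * T)" "\<theta> ^ Suc s * (k ^ s * T)"] le
  have "G \<le> (a ^ (2 * s) * (real m * real n * T) + \<theta> ^ Suc s * (k ^ s * T)) / 2"
    by (simp only: mult.assoc mult.left_commute[of _ 2])
  also have "\<dots> = T * (a ^ (2 * s) * real m * real n + \<theta> ^ Suc s * k ^ s) / 2"
    by (simp only: distrib_left mult_ac)
  finally show ?thesis unfolding G_def T_def .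
qed

end

section \<open>Tail bound\<close>

text \<open>One summand for each bound in \<open>rate_const_bounds\<close>: the first pays for the
  size of single summands, the second for the variance, the third for the factor \<open>m n\<close>
  of the moment bound. The number \<open>2 + 3 / l0\<close> comes from
  \<open>2 * s + 1 \<le> 2 * l + 3 \<le> (2 + 3 / l0) * l\<close>, where \<open>s\<close> is
  \<open>l\<close> rounded up and \<open>l0 \<le> l\<close>.\<close>

definition rate_const :: "real \<Rightarrow> real \<Rightarrow> real" where
  "rate_const \<kappa> l0 = 12 * (2 + 3 / l0) * \<kappa> + 24 * (2 + 3 / l0) + 1 / l0"

lemma rate_const_pos: "0 < \<kappa> \<Longrightarrow> 0 < l0 \<Longrightarrow> 0 < rate_const \<kappa> l0"
  unfolding rate_const_def by (intro add_pos_pos mult_pos_pos) auto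

lemma rate_const_bounds:
  assumes \<kappa>: "0 < \<kappa>" and l0: "0 < l0" "l0 \<le> l" and s: "s = nat \<lceil>l\<rceil>"
  defines "C \<equiv> rate_const \<kappa> l0" and "Q \<equiv> 2 * real s + 1"
  shows "12 * Q * \<kappa> \<le> C * l" "24 * Q \<le> C * l" "1 \<le> C * l"
proof -
  define b where "b = 2 + 3 / l0"
  have l: "0 < l" using l0 by simp
  have b: "0 < b" using l0 by (simp add: b_def add_pos_pos)
  have "1 / l0 * l0 \<le> 1 / l0 * l" using l0 by (intro mult_left_mono) auto
  then have l1: "1 \<le> 1 / l0 * l" using l0 by simp
  have "real s \<le> l + 1" using l s by linarith
  then have "Q \<le> 2 * l + 3" by (simp add: Q_def)
  also have "\<dots> \<le> 2 * l + 3 * (1 / l0 * l)" using l1 by linarith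
  also have "\<dots> = b * l" by (simp add: b_def algebra_simps)
  finally have Q: "Q \<le> b * l" .
  have C: "C * l = 12 * b * \<kappa> * l + 24 * b * l + 1 / l0 * l"
    unfolding C_def rate_const_def b_def by (simp add: algebra_simps)
  have nn: "0 \<le> 12 * b * \<kappa> * l" "0 \<le> 24 * b * l" using b \<kappa> l by auto
  have "Q * \<kappa> \<le> b * l * \<kappa>" using Q \<kappa> by (intro mult_right_mono) auto
  then show "12 * Q * \<kappa> \<le> C * l" using nn(2) l1 unfolding C by (simp add: mult.assoc mult.commute[of l])
  show "24 * Q \<le> C * l" using Q nn(1) l1 unfolding C by linarith
  show "1 \<le> C * l" using nn l1 unfolding C by linarith
qed

text \<open>From \<open>exp 1 \<le> 3\<close>. The ratio 1/3 is what the factors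
  \<open>12 = 3 * 4\<close> and \<open>24 = 3 * 8\<close> of \<open>rate_const\<close> leave per
  power.\<close>

lemma third_power_le: "l \<le> real s \<Longrightarrow> (1 / 3) ^ s \<le> exp (- l)"
proof -
  assume "l \<le> real s"
  have "1 / 3 \<le> exp (- 1 :: real)"
    using exp_le by (simp add: exp_minus field_simps)
  then have "(1 / 3) ^ s \<le> exp (- 1 :: real) ^ s"
    by (intro power_mono) auto
  also have "\<dots> = exp (- real s)" by (simp flip: exp_of_nat_mult)
  also have "\<dots> \<le> exp (- l)" using \<open>l \<le> real s\<close> by simp
  finally show ?thesis .
qed

text \<open>Compares both parts of the moment bound with the Markov threshold. In each part the base
  of the power falls short of the matching power of \<open>m * t\<close> by a factor 3, which
  accumulates to \<open>exp (- l)\<close>.\<close>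

lemma moment_ratio_le:
  fixes N m k t l l0 \<kappa> :: real
  assumes \<kappa>: "0 < \<kappa>" and l0: "0 < l0" "l0 \<le> l" and s: "s = nat \<lceil>l\<rceil>"
    and N: "0 < N" and m: "0 < m" and k: "0 < k" and t: "0 < t" "t \<le> \<kappa> * k"
    and mt: "m * t\<^sup>2 = rate_const \<kappa> l0 * N * k * l"
  defines "Q \<equiv> 2 * real s + 1"
  shows "(4 * Q * N) ^ (2 * s) * m * N + (8 * Q * N * m) ^ Suc s * k ^ s
    \<le> 2 * exp (- l) / k * (m * t) ^ (2 * Suc s)"
proof -
  define C where "C = rate_const \<kappa> l0"
  note rb = rate_const_bounds[OF \<kappa> l0 s, folded C_def Q_def]
  have Q: "0 < Q" by (simp add: Q_def)
  have sl: "l \<le> real s" unfolding s by linarith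
  have tau: "(m * t)\<^sup>2 = m * N * k * (C * l)"
    using mt by (simp add: C_def power_mult_distrib power2_eq_square algebra_simps)
  have mt0: "0 < m * t" using m t by simp
  \<comment> \<open>Here \<open>t \<le> \<kappa> * k\<close> enters: combined with the value of
    \<open>m * t\<^sup>2\<close> it makes \<open>m * t\<close> at least
    \<open>C * N * l / \<kappa>\<close>.\<close>
  have a: "4 * Q * N \<le> m * t / 3"
  proof -
    have "12 * Q * \<kappa> * (N * k) \<le> C * l * (N * k)"
      using rb(1) N k by (intro mult_right_mono) auto
    also have "\<dots> = m * t * t" using mt by (simp add: C_def power2_eq_square algebra_simps)
    also have "\<dots> \<le> m * t * (\<kappa> * k)" using mt0 t by (intro mult_left_mono) auto
    finally have "12 * Q * N * (\<kappa> * k) \<le> m * t * (\<kappa> * k)" by (simp add: algebra_simps)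
    then have "12 * Q * N \<le> m * t" using \<kappa> k by (simp only: mult_le_cancel_right_pos mult_pos_pos)
    then show ?thesis by simp
  qed
  have b: "8 * Q * N * m * k \<le> (m * t)\<^sup>2 / 3"
    unfolding tau using mult_left_mono[OF rb(2), of "m * N * k"] m N k by (simp add: algebra_simps)
  have c: "m * N \<le> (m * t)\<^sup>2 / k"
    unfolding tau using mult_left_mono[OF rb(3), of "m * N"] m N k by (simp add: field_simps)
  have "(4 * Q * N) ^ (2 * s) \<le> (m * t / 3) ^ (2 * s)"
    using a Q N by (intro power_mono) auto
  also have "\<dots> = (m * t) ^ (2 * s) * ((1 / 3) ^ s * (1 / 3) ^ s)"
    by (simp add: power_divide mult_2 power_add)
  \<comment> \<open>One of the two factors \<open>(1 / 3) ^ s\<close> already gives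
    \<open>exp (- l)\<close>; the other is bounded by 1.\<close>
  also have "\<dots> \<le> (m * t) ^ (2 * s) * (exp (- l) * 1)"
    using mt0 by (intro mult_left_mono mult_mono third_power_le[OF sl] power_le_one) auto
  finally have 1: "(4 * Q * N) ^ (2 * s) * (m * N) \<le> (m * t) ^ (2 * s) * exp (- l) * ((m * t)\<^sup>2 / k)"
    using m N mt0 by (intro mult_mono c) auto
  \<comment> \<open>The estimate is made for \<open>k ^ Suc s\<close>; the surplus \<open>k\<close>
    becomes the denominator of the claim.\<close>
  have "(8 * Q * N * m * k) ^ Suc s \<le> ((m * t)\<^sup>2 / 3) ^ Suc s"
    using b Q N m k by (intro power_mono) auto
  also have "\<dots> = ((m * t)\<^sup>2) ^ Suc s * (1 / 3) ^ Suc s"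
    by (simp only: power_mult_distrib[symmetric]) simp
  also have "\<dots> \<le> ((m * t)\<^sup>2) ^ Suc s * exp (- l)"
    by (intro mult_left_mono third_power_le) (use sl in auto)
  finally have "(8 * Q * N * m) ^ Suc s * k ^ s * k \<le> ((m * t)\<^sup>2) ^ Suc s * exp (- l)"
    by (simp add: power_mult_distrib mult.assoc mult.commute[of k] mult.left_commute[of k])
  then have 2: "(8 * Q * N * m) ^ Suc s * k ^ s \<le> ((m * t)\<^sup>2) ^ Suc s * exp (- l) / k"
    using k by (simp only: pos_le_divide_eq)
  have e: "(m * t) ^ (2 * s) * exp (- l) * ((m * t)\<^sup>2 / k) = exp (- l) / k * (m * t) ^ (2 * Suc s)"
    "((m * t)\<^sup>2) ^ Suc s * exp (- l) / k = exp (- l) / k * (m * t) ^ (2 * Suc s)"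
    unfolding power_mult[symmetric] by (simp_all add: power_add power2_eq_square del: power_mult_distrib)
  show ?thesis using add_mono[OF 1[unfolded e] 2[unfolded e]] by (simp only: mult.assoc)
qed

text \<open>Markov's inequality for the moment of order \<open>2 * (s + 1)\<close>. The event is
  described by test elements \<open>H\<close>, the form that \<open>tr_power_ge\<close> consumes.
  The resulting bound \<open>tr n K * exp (- l) / k\<close> equals \<open>\<delta>\<close> by the
  choice of \<open>l\<close>.\<close>

lemma (in features) tail_bound:
  assumes n: "0 < n" and m: "0 < m" and k: "0 < k" "pos n (k *\<^sub>R 1 - K)"
    and \<delta>: "0 < \<delta>" and trK: "0 < tr n K" and l: "l = ln (tr n K / (k * \<delta>))"
    and \<kappa>: "0 < \<kappa>" and l0: "0 < l0" "l0 \<le> l"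
    and t: "0 < t" "t \<le> \<kappa> * k" and mt: "real m * t\<^sup>2 = rate_const \<kappa> l0 * real n * k * l"
    and A: "A \<in> sets (iid m)"
    and big: "\<And>\<Omega>. \<Omega> \<in> A \<Longrightarrow> \<exists>H. blk n H \<and>
      (real m * t)\<^sup>2 * tr n (star H * H) < tr n (star (S m \<Omega> * H) * (S m \<Omega> * H))"
  shows "measure (iid m) A \<le> \<delta>"
proof -
  interpret I: prob_space "iid m" by (rule prob_space_iid)
  define s where "s = nat \<lceil>l\<rceil>"
  define c where "c = (real m * t) ^ (2 * Suc s)"
  let ?f = "\<lambda>\<Omega>. tr n (S m \<Omega> ^ (2 * Suc s))"
  have s: "0 < s" using l0 unfolding s_def by simp
  have c: "0 < c" using m t by (simp add: c_def)
  have int: "integrable (iid m) ?f" by (intro integrable_iid regular_intros regular_S)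
  then have [measurable]: "?f \<in> borel_measurable (iid m)" by simp
  have "A \<subseteq> {\<Omega> \<in> space (iid m). c \<le> ?f \<Omega>}"
  proof
    fix \<Omega> assume \<Omega>: "\<Omega> \<in> A"
    then obtain H where "blk n H" "(real m * t)\<^sup>2 * tr n (star H * H) < tr n (star (S m \<Omega> * H) * (S m \<Omega> * H))"
      using big by blast
    then have "c \<le> ?f \<Omega>"
      unfolding c_def by (intro tr_power_ge[OF star_S blk_S]) simp_all
    then show "\<Omega> \<in> {\<Omega> \<in> space (iid m). c \<le> ?f \<Omega>}" using \<Omega> sets.sets_into_space[OF A] by auto
  qed
  then have "measure (iid m) A \<le> measure (iid m) {\<Omega> \<in> space (iid m). c \<le> ?f \<Omega>}"
    by (intro I.finite_measure_mono) (simp_all del: mult_Suc_right power_Suc)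
  also have "\<dots> \<le> (\<integral>\<Omega>. ?f \<Omega> \<partial>iid m) / c"
    by (rule integral_Markov_inequality_measure[OF int sets.empty_sets _ c])
      (intro AE_I2 tr_even_nonneg star_S)
  also have "\<dots> \<le> (tr n K * (2 * exp (- l) / k * c) / 2) / c"
    unfolding c_def
    by (intro divide_right_mono order_trans[OF moment_bound[OF s k n m]] mult_left_mono
        moment_ratio_le[OF \<kappa> l0 s_def _ _ k(1) t mt]) (use n m t trK in auto)
  also have "\<dots> = tr n K * exp (- l) / k" using c by simp
  also have "\<dots> = \<delta>"
    using trK k(1) \<delta> by (simp add: l exp_minus field_simps)
  finally show ?thesis .
qed

section \<open>Spectral norm\<close>

lemma vnorm_eq_L2: "vnorm v = L2_set (($) v) {..<dim_vec v}"
  by (simp add: vnorm_def L2_set_def scalar_prod_def power2_eq_square lessThan_atLeast0)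

lemma vnorm_nonneg: "0 \<le> vnorm v"
  by (simp add: vnorm_eq_L2)

lemma vnorm_square: "(vnorm v)\<^sup>2 = (\<Sum>i<dim_vec v. (v $ i)\<^sup>2)"
  by (simp add: vnorm_eq_L2 L2_set_def sum_nonneg)

lemma vnorm_sqrt: "vnorm v = sqrt (\<Sum>i<dim_vec v. (v $ i)\<^sup>2)"
  by (simp add: vnorm_eq_L2 L2_set_def)

lemma vnorm_smult: "vnorm (c \<cdot>\<^sub>v v) = \<bar>c\<bar> * vnorm v"
proof -
  have "L2_set (\<lambda>i. \<bar>c\<bar> * v $ i) {..<dim_vec v} = \<bar>c\<bar> * vnorm v"
    unfolding vnorm_eq_L2 by (rule L2_set_right_distrib[symmetric]) simp
  then show ?thesis
    unfolding vnorm_eq_L2 by (simp add: L2_set_def power_mult_distrib)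
qed

lemma vnorm_add_le:
  assumes "u \<in> carrier_vec n" "v \<in> carrier_vec n" shows "vnorm (u + v) \<le> vnorm u + vnorm v"
proof -
  have "vnorm (u + v) = L2_set (\<lambda>i. u $ i + v $ i) {..<n}"
    unfolding vnorm_eq_L2 L2_set_def using assms by (intro arg_cong[where f = sqrt] sum.cong) auto
  also have "\<dots> \<le> L2_set (($) u) {..<n} + L2_set (($) v) {..<n}"
    by (rule L2_set_triangle_ineq)
  finally show ?thesis using assms by (simp add: vnorm_eq_L2)
qed

lemma scalar_prod_le_vnorm:
  assumes "u \<in> carrier_vec n" "v \<in> carrier_vec n" shows "u \<bullet> v \<le> vnorm u * vnorm v"
proof -
  have "(u \<bullet> v)\<^sup>2 \<le> (vnorm u)\<^sup>2 * (vnorm v)\<^sup>2"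
    unfolding vnorm_square using Cauchy_Schwarz_ineq_sum[of "($) u" "($) v" "{..<n}"] assms
    by (simp add: scalar_prod_def lessThan_atLeast0)
  then have "\<bar>u \<bullet> v\<bar> \<le> \<bar>vnorm u * vnorm v\<bar>"
    unfolding power_mult_distrib[symmetric] abs_le_square_iff .
  then show ?thesis by (simp add: vnorm_nonneg)
qed

lemma vnorm_mult_mat:
  "vnorm (A *\<^sub>v v) = sqrt (\<Sum>i<dim_row A. (\<Sum>j<dim_vec v. A $$ (i, j) * v $ j)\<^sup>2)"
  if "dim_vec v = dim_col A"
  using that by (simp add: vnorm_eq_L2 L2_set_def scalar_prod_def lessThan_atLeast0)

text \<open>The Frobenius bound serves to make the supremum in \<open>spectral_norm\<close> one of a
  bounded set, and it settles vectors of norm zero.\<close>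

lemma vnorm_mult_mat_bound:
  assumes "v \<in> carrier_vec (dim_col A)"
  shows "vnorm (A *\<^sub>v v) \<le> sqrt (\<Sum>i<dim_row A. \<Sum>j<dim_col A. (A $$ (i, j))\<^sup>2) * vnorm v"
proof -
  have "(\<Sum>i<dim_row A. (\<Sum>j<dim_vec v. A $$ (i, j) * v $ j)\<^sup>2)
      \<le> (\<Sum>i<dim_row A. (\<Sum>j<dim_vec v. (A $$ (i, j))\<^sup>2) * (\<Sum>j<dim_vec v. (v $ j)\<^sup>2))"
    by (intro sum_mono Cauchy_Schwarz_ineq_sum)
  also have "\<dots> = (\<Sum>i<dim_row A. \<Sum>j<dim_vec v. (A $$ (i, j))\<^sup>2) * (\<Sum>j<dim_vec v. (v $ j)\<^sup>2)"
    by (rule sum_distrib_right[symmetric])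
  finally show ?thesis
    unfolding vnorm_mult_mat[OF carrier_vecD[OF assms]] vnorm_sqrt[of v] real_sqrt_mult[symmetric]
    using assms by simp
qed

lemma spectral_norm_bdd:
  "bdd_above {vnorm (A *\<^sub>v v) | v. v \<in> carrier_vec (dim_col A) \<and> vnorm v \<le> 1}"
proof (rule bdd_aboveI[of _ "sqrt (\<Sum>i<dim_row A. \<Sum>j<dim_col A. (A $$ (i, j))\<^sup>2)"], clarify)
  fix v assume v: "v \<in> carrier_vec (dim_col A)" "vnorm v \<le> 1"
  show "vnorm (A *\<^sub>v v) \<le> sqrt (\<Sum>i<dim_row A. \<Sum>j<dim_col A. (A $$ (i, j))\<^sup>2)"
    by (rule order_trans[OF vnorm_mult_mat_bound[OF v(1)]])
      (intro mult_left_le v real_sqrt_ge_zero sum_nonneg zero_le_power2)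
qed

lemma spectral_norm_nonneg: "0 \<le> spectral_norm A"
proof -
  have "vnorm (A *\<^sub>v 0\<^sub>v (dim_col A)) \<le> spectral_norm A"
    unfolding spectral_norm_def
    by (rule cSup_upper[OF _ spectral_norm_bdd]) (auto simp: vnorm_def intro!: exI[of _ "0\<^sub>v (dim_col A)"])
  then show ?thesis using vnorm_nonneg order_trans by blast
qed

lemma vnorm_mult_mat_le:
  assumes v: "v \<in> carrier_vec (dim_col A)"
  shows "vnorm (A *\<^sub>v v) \<le> spectral_norm A * vnorm v"
proof (cases "vnorm v = 0")
  case True
  then show ?thesis using vnorm_mult_mat_bound[OF v] by simp
next
  case False
  then have pos: "0 < vnorm v" using vnorm_nonneg[of v] by simp
  let ?u = "(1 / vnorm v) \<cdot>\<^sub>v v"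
  have "vnorm (A *\<^sub>v ?u) \<le> spectral_norm A"
    unfolding spectral_norm_def
    by (rule cSup_upper[OF _ spectral_norm_bdd]) (use v pos in \<open>auto simp: vnorm_smult intro!: exI[of _ ?u]\<close>)
  moreover have "A *\<^sub>v ?u = (1 / vnorm v) \<cdot>\<^sub>v (A *\<^sub>v v)"
    by (rule mult_mat_vec[OF _ v, of _ "dim_row A"]) simp
  ultimately show ?thesis using pos by (simp add: vnorm_smult field_simps)
qed

lemma spectral_norm_le:
  assumes c: "0 \<le> c" and le: "\<And>v. v \<in> carrier_vec (dim_col A) \<Longrightarrow> vnorm (A *\<^sub>v v) \<le> c * vnorm v"
  shows "spectral_norm A \<le> c"
  unfolding spectral_norm_def
proof (rule cSup_least)
  show "{vnorm (A *\<^sub>v v) | v. v \<in> carrier_vec (dim_col A) \<and> vnorm v \<le> 1} \<noteq> {}"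
    by (auto simp: vnorm_def intro!: exI[of _ "0\<^sub>v (dim_col A)"])
  show "x \<le> c" if "x \<in> {vnorm (A *\<^sub>v v) | v. v \<in> carrier_vec (dim_col A) \<and> vnorm v \<le> 1}" for x
    using that le c by (auto intro: order_trans[OF le] mult_left_le)
qed

lemma spectral_norm_mult_le:
  assumes "A \<in> carrier_mat n n" "B \<in> carrier_mat n n" "v \<in> carrier_vec n"
    and "vnorm (B *\<^sub>v v) \<le> b * vnorm v"
  shows "vnorm (A *\<^sub>v (B *\<^sub>v v)) \<le> spectral_norm A * b * vnorm v"
proof -
  have "vnorm (A *\<^sub>v (B *\<^sub>v v)) \<le> spectral_norm A * vnorm (B *\<^sub>v v)"
    using assms by (intro vnorm_mult_mat_le) auto
  also have "\<dots> \<le> spectral_norm A * (b * vnorm v)"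
    using assms by (intro mult_left_mono spectral_norm_nonneg) auto
  finally show ?thesis by (simp add: mult.assoc)
qed

lemma smult_mat_vec:
  fixes X :: "real mat"
  assumes "X \<in> carrier_mat n n" "y \<in> carrier_vec n"
  shows "(c \<cdot>\<^sub>m X) *\<^sub>v y = c \<cdot>\<^sub>v (X *\<^sub>v y)"
  using assms by (intro eq_vecI) (auto simp: scalar_prod_def sum_distrib_left mult.assoc)

text \<open>Rests on \<open>A D A - B D B = (A - B) D A + B D (A - B)\<close>. The scalar
  \<open>c\<close> is attached to the single \<open>A\<close> and \<open>B\<close>, so that for
  \<open>c = 1 / n\<close> the scaled norms of \<open>zeta\<close> appear.\<close>

lemma sandwich_diff:
  fixes A B D :: "real mat"
  assumes [simp]: "A \<in> carrier_mat n n" "B \<in> carrier_mat n n" "D \<in> carrier_mat n n" and v: "v \<in> carrier_vec n"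
  shows "(c \<cdot>\<^sub>m (A * D * A) + l \<cdot>\<^sub>m A - (c \<cdot>\<^sub>m (B * D * B) + l \<cdot>\<^sub>m B)) *\<^sub>v v
    = (A - B) *\<^sub>v (D *\<^sub>v ((c \<cdot>\<^sub>m A) *\<^sub>v v)) + (c \<cdot>\<^sub>m B) *\<^sub>v (D *\<^sub>v ((A - B) *\<^sub>v v)) + l \<cdot>\<^sub>v ((A - B) *\<^sub>v v)"
proof -
  have [simp]: "dim_row A = n" "dim_row B = n" "dim_row D = n" by (auto intro: carrier_matD assms)
  have [simp]: "v \<in> carrier_vec n" "A *\<^sub>v v \<in> carrier_vec n" "B *\<^sub>v v \<in> carrier_vec n"
    "D *\<^sub>v (A *\<^sub>v v) \<in> carrier_vec n" "D *\<^sub>v (B *\<^sub>v v) \<in> carrier_vec n"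
    "A *\<^sub>v (D *\<^sub>v (A *\<^sub>v v)) \<in> carrier_vec n" "B *\<^sub>v (D *\<^sub>v (A *\<^sub>v v)) \<in> carrier_vec n"
    "B *\<^sub>v (D *\<^sub>v (B *\<^sub>v v)) \<in> carrier_vec n"
    by (intro mult_mat_vec_carrier[of _ n n] assms)+
  have [simp]: "A * D * A \<in> carrier_mat n n" "B * D * B \<in> carrier_mat n n"
    by (intro mult_carrier_mat[of _ n n] assms)+
  have s: "(c \<cdot>\<^sub>m X) *\<^sub>v y = c \<cdot>\<^sub>v (X *\<^sub>v y)" if "X \<in> carrier_mat n n" "y \<in> carrier_vec n" for c :: real and X y
    using that by (intro eq_vecI) (auto simp: scalar_prod_def sum_distrib_left mult.assoc)
  have m: "X *\<^sub>v (c \<cdot>\<^sub>v y) = c \<cdot>\<^sub>v (X *\<^sub>v y)" if "X \<in> carrier_mat n n" "y \<in> carrier_vec n" for c :: real and X y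
    using that by (rule mult_mat_vec)
  have a: "(X * D * X) *\<^sub>v v = X *\<^sub>v (D *\<^sub>v (X *\<^sub>v v))" if "X \<in> carrier_mat n n" for X
    using that by (simp add: assoc_mult_mat_vec[of _ n n _ n])
  have d: "(X - Y) *\<^sub>v y = X *\<^sub>v y - Y *\<^sub>v y" if "X \<in> carrier_mat n n" "Y \<in> carrier_mat n n" "y \<in> carrier_vec n" for X Y :: "real mat" and y
    using that by (rule minus_mult_distrib_mat_vec)
  have e: "X *\<^sub>v (x - y) = X *\<^sub>v x - X *\<^sub>v y" if "X \<in> carrier_mat n n" "x \<in> carrier_vec n" "y \<in> carrier_vec n" for X :: "real mat" and x y
    using that by (rule mult_minus_distrib_mat_vec)
  have f: "(X + Y) *\<^sub>v y = X *\<^sub>v y + Y *\<^sub>v y" if "X \<in> carrier_mat n n" "Y \<in> carrier_mat n n" "y \<in> carrier_vec n" for X Y :: "real mat" and y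
    using that by (rule add_mult_distrib_mat_vec)
  show ?thesis
    by (simp add: d f s a m e)
      (rule eq_vecI, auto simp: algebra_simps carrier_vecD[where n = n] simp del: index_mult_mat_vec)
qed

section \<open>Measurability of the spectral norm\<close>

definition measurable_mat :: "'a measure \<Rightarrow> nat \<Rightarrow> ('a \<Rightarrow> real mat) \<Rightarrow> bool" where
  "measurable_mat N n A \<longleftrightarrow> (\<forall>x. A x \<in> carrier_mat n n) \<and>
     (\<forall>i<n. \<forall>j<n. (\<lambda>x. A x $$ (i, j)) \<in> borel_measurable N)"

lemma measurable_mat_const: "A \<in> carrier_mat n n \<Longrightarrow> measurable_mat N n (\<lambda>_. A)"
  by (simp add: measurable_mat_def)

lemma measurable_mat_cong_entry:
  assumes "\<And>x. A x \<in> carrier_mat n n" "\<And>x i j. i < n \<Longrightarrow> j < n \<Longrightarrow> A x $$ (i, j) = f i j x"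
    and "\<And>i j. i < n \<Longrightarrow> j < n \<Longrightarrow> f i j \<in> borel_measurable N"
  shows "measurable_mat N n A"
  using assms by (simp add: measurable_mat_def)

lemma measurable_matD:
  assumes "measurable_mat N n A"
  shows "A x \<in> carrier_mat n n" "i < n \<Longrightarrow> j < n \<Longrightarrow> (\<lambda>x. A x $$ (i, j)) \<in> borel_measurable N"
  using assms by (simp_all add: measurable_mat_def)

lemma measurable_mat_ops:
  assumes A: "measurable_mat N n A" and B: "measurable_mat N n B"
  shows "measurable_mat N n (\<lambda>x. A x + B x)" "measurable_mat N n (\<lambda>x. A x - B x)"
    "measurable_mat N n (\<lambda>x. c \<cdot>\<^sub>m A x)"
proof -
  note c = measurable_matD(1)[OF A, THEN carrier_matD(1)] measurable_matD(1)[OF A, THEN carrier_matD(2)]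
    measurable_matD(1)[OF B, THEN carrier_matD(1)] measurable_matD(1)[OF B, THEN carrier_matD(2)]
  show "measurable_mat N n (\<lambda>x. A x + B x)"
    by (rule measurable_mat_cong_entry[of _ _ "\<lambda>i j x. A x $$ (i, j) + B x $$ (i, j)"])
      (auto simp: c intro!: carrier_matI borel_measurable_add measurable_matD[OF A] measurable_matD[OF B])
  show "measurable_mat N n (\<lambda>x. A x - B x)"
    by (rule measurable_mat_cong_entry[of _ _ "\<lambda>i j x. A x $$ (i, j) - B x $$ (i, j)"])
      (auto simp: c intro!: carrier_matI borel_measurable_diff measurable_matD[OF A] measurable_matD[OF B])
  show "measurable_mat N n (\<lambda>x. c \<cdot>\<^sub>m A x)"
    by (rule measurable_mat_cong_entry[of _ _ "\<lambda>i j x. c * A x $$ (i, j)"])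
      (auto simp: c intro!: carrier_matI borel_measurable_times measurable_matD[OF A])
qed

lemma measurable_mat_mult:
  assumes "measurable_mat N n A" "measurable_mat N n B"
  shows "measurable_mat N n (\<lambda>x. A x * B x)"
proof -
  have c: "A x \<in> carrier_mat n n" "B x \<in> carrier_mat n n" for x
    using assms by (auto simp: measurable_mat_def)
  have "(\<lambda>x. (A x * B x) $$ (i, j)) = (\<lambda>x. \<Sum>l<n. A x $$ (i, l) * B x $$ (l, j))" if "i < n" "j < n" for i j
    using c[THEN carrier_matD(1)] c[THEN carrier_matD(2)] that
    by (simp add: scalar_prod_def lessThan_atLeast0)
  then show ?thesis
    using assms c by (auto simp: measurable_mat_def intro!: borel_measurable_sum borel_measurable_times mult_carrier_mat)
qed

lemma floor_approx: "(\<lambda>k. real_of_int \<lfloor>real k * x\<rfloor> / real k) \<longlonglongrightarrow> x"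
proof (rule tendsto_sandwich[of "\<lambda>k. x - 1 / real k" _ _ "\<lambda>_. x"])
  show "eventually (\<lambda>k. x - 1 / real k \<le> real_of_int \<lfloor>real k * x\<rfloor> / real k) sequentially"
    using eventually_gt_at_top[of 0]
  proof eventually_elim
    case (elim k)
    have "(real k * x - 1) / real k \<le> real_of_int \<lfloor>real k * x\<rfloor> / real k"
      by (intro divide_right_mono) linarith+
    then show ?case using elim by (simp add: diff_divide_distrib)
  qed
  show "eventually (\<lambda>k. real_of_int \<lfloor>real k * x\<rfloor> / real k \<le> x) sequentially"
    using eventually_gt_at_top[of 0]
    by eventually_elim (simp add: field_simps)
  show "(\<lambda>k. x - 1 / real k) \<longlonglongrightarrow> x"
    using tendsto_diff[OF tendsto_const lim_1_over_n] by simp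
qed simp

text \<open>Integer vectors indexed by a countable type. The length of the list is left free:
  entries past its end are still integers, and lists of length \<open>n\<close> reach every integer
  vector.\<close>

definition int_vec :: "nat \<Rightarrow> int list \<Rightarrow> real vec" where
  "int_vec n us = vec n (\<lambda>i. real_of_int (us ! i))"

text \<open>By homogeneity, integer vectors test all rational vectors, and these are dense.\<close>

lemma spectral_norm_le_int:
  assumes A: "A \<in> carrier_mat n n" and le: "\<And>us. vnorm (A *\<^sub>v int_vec n us) \<le> c * vnorm (int_vec n us)" and c: "0 \<le> c"
  shows "spectral_norm A \<le> c"
proof (rule spectral_norm_le[OF c])
  fix v :: "real vec" assume v: "v \<in> carrier_vec (dim_col A)"
  \<comment> \<open>For \<open>k = 0\<close> the factor \<open>1 / real k\<close> is 0, so the bound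
    for \<open>u 0\<close> is trivial.\<close>
  define u where "u k = (1 / real k) \<cdot>\<^sub>v int_vec n (map (\<lambda>i. \<lfloor>real k * v $ i\<rfloor>) [0..<n])" for k
  have u: "u k \<in> carrier_vec n" for k by (simp add: u_def int_vec_def)
  have le': "vnorm (A *\<^sub>v u k) \<le> c * vnorm (u k)" for k
  proof -
    have "A *\<^sub>v u k = (1 / real k) \<cdot>\<^sub>v (A *\<^sub>v int_vec n (map (\<lambda>i. \<lfloor>real k * v $ i\<rfloor>) [0..<n]))"
      unfolding u_def by (rule mult_mat_vec[OF A]) (simp add: int_vec_def)
    then show ?thesis
      unfolding u_def using mult_left_mono[OF le, of "1 / real k"] by (simp add: vnorm_smult mult.left_commute)
  qed
  have ui: "(\<lambda>k. u k $ i) \<longlonglongrightarrow> v $ i" if "i < n" for i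
    using floor_approx[of "v $ i"] that by (simp add: u_def int_vec_def)
  have "(\<lambda>k. sqrt (\<Sum>i<n. (\<Sum>j<n. A $$ (i, j) * u k $ j)\<^sup>2)) \<longlonglongrightarrow> sqrt (\<Sum>i<n. (\<Sum>j<n. A $$ (i, j) * v $ j)\<^sup>2)"
    by (intro tendsto_intros ui) auto
  moreover have "(\<lambda>k. c * sqrt (\<Sum>i<n. (u k $ i)\<^sup>2)) \<longlonglongrightarrow> c * sqrt (\<Sum>i<n. (v $ i)\<^sup>2)"
    by (intro tendsto_intros ui) auto
  moreover have "sqrt (\<Sum>i<n. (\<Sum>j<n. A $$ (i, j) * u k $ j)\<^sup>2) \<le> c * sqrt (\<Sum>i<n. (u k $ i)\<^sup>2)" for k
  proof -
    have "dim_vec (u k) = dim_col A" using u[of k] A by simp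
    from le'[of k, unfolded vnorm_mult_mat[OF this] vnorm_sqrt[of "u k"]] show ?thesis
      using u[of k] A by simp
  qed
  ultimately have "sqrt (\<Sum>i<n. (\<Sum>j<n. A $$ (i, j) * v $ j)\<^sup>2) \<le> c * sqrt (\<Sum>i<n. (v $ i)\<^sup>2)"
    by (intro LIMSEQ_le) auto
  then show "vnorm (A *\<^sub>v v) \<le> c * vnorm v"
    unfolding vnorm_mult_mat[OF carrier_vecD[OF v]] vnorm_sqrt[of v] using v A by simp
qed

text \<open>The supremum ranges over an uncountable ball, but a sublevel set at a nonnegative level
  is a countable intersection of conditions on integer vectors.\<close>

lemma borel_measurable_spectral_norm:
  assumes "measurable_mat N n A"
  shows "(\<lambda>x. spectral_norm (A x)) \<in> borel_measurable N"
proof (rule borel_measurableI_le)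
  fix c :: real
  have A: "A x \<in> carrier_mat n n" for x using assms by (simp add: measurable_mat_def)
  show "{x \<in> space N. spectral_norm (A x) \<le> c} \<in> sets N"
  proof (cases "0 \<le> c")
    case True
    have "{x \<in> space N. spectral_norm (A x) \<le> c}
        = {x \<in> space N. \<forall>us. vnorm (A x *\<^sub>v int_vec n us) \<le> c * vnorm (int_vec n us)}"
    proof (intro Collect_cong conj_cong refl iffI allI)
      fix x us assume "spectral_norm (A x) \<le> c"
      then have "spectral_norm (A x) * vnorm (int_vec n us) \<le> c * vnorm (int_vec n us)"
        by (intro mult_right_mono vnorm_nonneg)
      moreover have "vnorm (A x *\<^sub>v int_vec n us) \<le> spectral_norm (A x) * vnorm (int_vec n us)"
        using A[of x] by (intro vnorm_mult_mat_le) (auto simp: int_vec_def)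
      ultimately show "vnorm (A x *\<^sub>v int_vec n us) \<le> c * vnorm (int_vec n us)" by simp
    qed (use spectral_norm_le_int[OF A _ True] in blast)
    also have "\<dots> \<in> sets N"
    proof (rule sets.sets_Collect_countable_All)
      fix us
      have "(\<lambda>x. vnorm (A x *\<^sub>v int_vec n us))
          = (\<lambda>x. sqrt (\<Sum>i<n. (\<Sum>j<n. A x $$ (i, j) * int_vec n us $ j)\<^sup>2))"
        using A[THEN carrier_matD(1)] A[THEN carrier_matD(2)] by (simp add: vnorm_mult_mat int_vec_def)
      also have "\<dots> \<in> borel_measurable N"
        by (intro measurable_compose[OF _ borel_measurable_sqrt] borel_measurable_sum borel_measurable_power
            borel_measurable_times borel_measurable_const) (use assms in \<open>auto simp: measurable_mat_def\<close>)
      finally have [measurable]: "(\<lambda>x. vnorm (A x *\<^sub>v int_vec n us)) \<in> borel_measurable N" .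
      show "{x \<in> space N. vnorm (A x *\<^sub>v int_vec n us) \<le> c * vnorm (int_vec n us)} \<in> sets N"
        by measurable
    qed
    finally show ?thesis .
  next
    case False
    then have "{x \<in> space N. spectral_norm (A x) \<le> c} = {}"
      by (auto dest: order_trans[OF spectral_norm_nonneg])
    then show ?thesis by (simp only: sets.empty_sets)
  qed
qed

section \<open>Kernel matrices and Hessians\<close>

lemma tr_column:
  assumes "0 < n" shows "tr n (star (column n u) * column n u) = (\<Sum>i<n. (u i)\<^sup>2)"
proof -
  have "tr n (star (column n u) * column n u) = (\<Sum>j<n. \<Sum>i<n. (entry (column n u) i j)\<^sup>2)"
    unfolding column_def by (rule tr_star_mult_blk[OF blk_mk])
  also have "\<dots> = (\<Sum>j<n. if j = 0 then \<Sum>i<n. (u i)\<^sup>2 else 0)"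
    by (intro sum.cong) (auto simp: column_def entry_mk)
  finally show ?thesis using assms by simp
qed

lemma mk_mult_column: "mk n f * column n u = column n (\<lambda>i. \<Sum>l<n. f i l * u l)"
  unfolding column_def mk_mult by (rule mk_cong) auto

text \<open>The form is the mean of a product of the inner products of \<open>z\<close> with
  \<open>w\<close> and with \<open>v\<close>; Cauchy-Schwarz for both leaves the mean squared length
  of \<open>z\<close>, which is the trace. This compares spectral norm and trace without
  eigenvalues.\<close>

lemma (in features) K_bilinear_le:
  "(\<Sum>i<n. \<Sum>l<n. w i * (\<integral>\<omega>. z \<omega> i * z \<omega> l \<partial>M) * v l) \<le> L2_set w {..<n} * L2_set v {..<n} * tr n K"
proof -
  have int: "integrable M (\<lambda>\<omega>. w i * (z \<omega> i * z \<omega> l) * v l)" if "i < n" "l < n" for i l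
    by (intro integrable_mult_left integrable_mult_right z_integrable that)
  let ?c = "L2_set w {..<n} * L2_set v {..<n}"
  have "(\<Sum>i<n. \<Sum>l<n. w i * (\<integral>\<omega>. z \<omega> i * z \<omega> l \<partial>M) * v l)
      = (\<Sum>i<n. \<Sum>l<n. \<integral>\<omega>. w i * (z \<omega> i * z \<omega> l) * v l \<partial>M)"
    by simp
  also have "\<dots> = (\<integral>\<omega>. (\<Sum>i<n. \<Sum>l<n. w i * (z \<omega> i * z \<omega> l) * v l) \<partial>M)"
    by (subst Bochner_Integration.integral_sum, (intro Bochner_Integration.integrable_sum int, auto)[1],
        intro sum.cong refl Bochner_Integration.integral_sum[symmetric] int) auto
  also have "\<dots> \<le> (\<integral>\<omega>. ?c * (\<Sum>i<n. z \<omega> i * z \<omega> i) \<partial>M)"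
  proof (rule integral_mono)
    show "integrable M (\<lambda>\<omega>. \<Sum>i<n. \<Sum>l<n. w i * (z \<omega> i * z \<omega> l) * v l)"
      by (intro Bochner_Integration.integrable_sum int) auto
    show "integrable M (\<lambda>\<omega>. ?c * (\<Sum>i<n. z \<omega> i * z \<omega> i))"
      by (intro integrable_mult_right Bochner_Integration.integrable_sum z_integrable) auto
  next
    fix \<omega>
    let ?z = "L2_set (z \<omega>) {..<n}"
    have "(\<Sum>i<n. \<Sum>l<n. w i * (z \<omega> i * z \<omega> l) * v l) = (\<Sum>i<n. w i * z \<omega> i) * (\<Sum>l<n. v l * z \<omega> l)"
      unfolding sum_product by (intro sum.cong refl) simp
    also have "\<dots> \<le> \<bar>\<Sum>i<n. w i * z \<omega> i\<bar> * \<bar>\<Sum>l<n. v l * z \<omega> l\<bar>"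
      by (simp flip: abs_mult)
    also have "\<dots> \<le> (L2_set w {..<n} * ?z) * (L2_set v {..<n} * ?z)"
    proof -
      have CS: "\<bar>\<Sum>i<n. a i * b i\<bar> \<le> L2_set a {..<n} * L2_set b {..<n}" for a b :: "nat \<Rightarrow> real"
        using sum_abs[of "\<lambda>i. a i * b i" "{..<n}"] L2_set_mult_ineq[of a b "{..<n}"] by (simp add: abs_mult)
      show ?thesis by (intro mult_mono CS mult_nonneg_nonneg L2_set_nonneg abs_ge_zero)
    qed
    also have "\<dots> = ?c * ?z\<^sup>2" by (simp add: power2_eq_square mult_ac)
    also have "?z\<^sup>2 = (\<Sum>i<n. z \<omega> i * z \<omega> i)"
      by (simp add: L2_set_def sum_nonneg power2_eq_square)
    finally show "(\<Sum>i<n. \<Sum>l<n. w i * (z \<omega> i * z \<omega> l) * v l) \<le> ?c * (\<Sum>i<n. z \<omega> i * z \<omega> i)" .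
  qed
  also have "\<dots> = ?c * (\<Sum>i<n. \<integral>\<omega>. z \<omega> i * z \<omega> i \<partial>M)"
    unfolding integral_mult_right_zero
    by (subst Bochner_Integration.integral_sum) (auto intro: z_integrable)
  also have "(\<Sum>i<n. \<integral>\<omega>. z \<omega> i * z \<omega> i \<partial>M) = tr n K"
    by (simp add: K_def tr_mk)
  finally show ?thesis .
qed

section \<open>Hessians of a kernel problem\<close>

locale kernel_problem =
  fixes P :: problem
  assumes valid: "valid_problem P"
begin

lemma num_pos: "0 < num P" and lam_pos: "0 < lam P"
  using valid by (auto simp: valid_problem_def)

lemma space_feature_law: "space (feature_law P) = space (lebesgue_d (dim P))"
  by (simp add: feature_law_def)

lemma dens_measurable [measurable]: "dens P \<in> borel_measurable (lebesgue_d (dim P))"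
  using valid by (simp add: valid_problem_def)

lemma dens_nonneg: "\<omega> \<in> space (lebesgue_d (dim P)) \<Longrightarrow> 0 \<le> dens P \<omega>"
  using valid by (simp add: valid_problem_def)

lemma feat_measurable:
  "i < num P \<Longrightarrow> (\<lambda>\<omega>. feat P (pts P i) \<omega>) \<in> borel_measurable (lebesgue_d (dim P))"
  using valid by (simp add: valid_problem_def)

lemma prob_space_feature_law: "prob_space (feature_law P)"
proof (rule prob_spaceI)
  have "emeasure (feature_law P) (space (feature_law P)) = (\<integral>\<^sup>+ \<omega>. ennreal (dens P \<omega>) \<partial>lebesgue_d (dim P))"
    unfolding feature_law_def by (simp add: emeasure_density cong: nn_integral_cong)
  then show "emeasure (feature_law P) (space (feature_law P)) = 1"
    using valid by (simp add: valid_problem_def)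
qed

sublocale features "feature_law P" "\<lambda>\<omega> i. feat P (pts P i) \<omega>" "num P"
proof (intro features.intro features_axioms.intro prob_space_feature_law)
  fix i assume "i < num P"
  then show "(\<lambda>\<omega>. feat P (pts P i) \<omega>) \<in> borel_measurable (feature_law P)"
    using feat_measurable by (simp add: feature_law_def)
next
  fix i \<omega> assume "i < num P" "\<omega> \<in> space (feature_law P)"
  then show "\<bar>feat P (pts P i) \<omega>\<bar> \<le> 1"
    using valid by (simp add: valid_problem_def space_feature_law)
qed

lemma kernel_eq:
  assumes "i < num P" "j < num P"
  shows "kernel P (pts P i) (pts P j) = (\<integral>\<omega>. feat P (pts P i) \<omega> * feat P (pts P j) \<omega> \<partial>feature_law P)"
proof -
  have "(\<integral>\<omega>. feat P (pts P i) \<omega> * feat P (pts P j) \<omega> \<partial>feature_law P)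
      = (\<integral>\<omega>. dens P \<omega> *\<^sub>R (feat P (pts P i) \<omega> * feat P (pts P j) \<omega>) \<partial>lebesgue_d (dim P))"
    unfolding feature_law_def
    by (rule integral_density) (auto intro!: borel_measurable_times feat_measurable assms AE_I2 dens_nonneg)
  then show ?thesis by (simp add: kernel_def mult.commute)
qed

lemma K1_carrier: "K1 P \<in> carrier_mat (num P) (num P)"
  and gram_carrier: "gram P \<in> carrier_mat (num P) (num P)"
  and gram_hat_carrier: "gram_hat P m \<Omega> \<in> carrier_mat (num P) (num P)"
  and curvature_carrier: "loss_curvature P w \<in> carrier_mat (num P) (num P)"
  by (auto simp: K1_def gram_def gram_hat_def Zmat_def loss_curvature_def)

lemma K_eq: "K = mk (num P) (\<lambda>i j. K1 P $$ (i, j))"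
  unfolding K_def by (intro mk_cong) (simp add: K1_def kernel_eq)

lemma mtrace_eq: "mtrace (K1 P) = tr (num P) K"
  using K1_carrier by (simp add: mtrace_def K_eq tr_mk)

lemma S_eq:
  assumes m: "0 < m"
  shows "S m \<Omega> = mk (num P) (\<lambda>i j. real m * (gram_hat P m \<Omega> - gram P) $$ (i, j))"
proof (rule rcmat_eqI)
  fix i j
  \<comment> \<open>The two multiples of the identity cancel, so that only the deviation of
    \<open>Z Z\<^sup>T\<close> from \<open>K1 P\<close> remains.\<close>
  have "(gram_hat P m \<Omega> - gram P) $$ (i, j)
      = (\<Sum>l<m. feat P (pts P i) (\<Omega> l) * feat P (pts P j) (\<Omega> l)) / real m - K1 P $$ (i, j)"
    if "i < num P" "j < num P"
    using that by (simp add: gram_hat_def gram_def Zmat_def K1_def scalar_prod_def lessThan_atLeast0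
        sum_divide_distrib)
  then show "entry (S m \<Omega>) i j = entry (mk (num P) (\<lambda>i j. real m * (gram_hat P m \<Omega> - gram P) $$ (i, j))) i j"
    using m by (cases "i < num P \<and> j < num P")
      (auto simp: S_def entry_simps entry_sum outer_def K_eq entry_mk right_diff_distrib)
qed

lemma quadratic_K1_le: "v \<in> carrier_vec (num P) \<Longrightarrow> v \<bullet> (K1 P *\<^sub>v v) \<le> spectral_norm (K1 P) * (vnorm v)\<^sup>2"
proof -
  assume v: "v \<in> carrier_vec (num P)"
  have "v \<bullet> (K1 P *\<^sub>v v) \<le> vnorm v * vnorm (K1 P *\<^sub>v v)"
    using v K1_carrier by (intro scalar_prod_le_vnorm) auto
  also have "\<dots> \<le> vnorm v * (spectral_norm (K1 P) * vnorm v)"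
    using v K1_carrier by (intro mult_left_mono vnorm_mult_mat_le vnorm_nonneg) auto
  finally show ?thesis by (simp add: power2_eq_square mult_ac)
qed

lemma pos_norm_diff_K: "pos (num P) (spectral_norm (K1 P) *\<^sub>R 1 - K)"
  unfolding K_eq
proof (rule pos_scaleR_one_diff_mk[OF spectral_norm_nonneg])
  fix v :: "nat \<Rightarrow> real"
  have "(\<Sum>i<num P. \<Sum>l<num P. v i * K1 P $$ (i, l) * v l) = vec (num P) v \<bullet> (K1 P *\<^sub>v vec (num P) v)"
    using K1_carrier by (simp add: scalar_prod_def lessThan_atLeast0 sum_distrib_left mult.assoc)
  then show "(\<Sum>i<num P. \<Sum>l<num P. v i * K1 P $$ (i, l) * v l)
      \<le> spectral_norm (K1 P) * (\<Sum>i<num P. (v i)\<^sup>2)"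
    using quadratic_K1_le[of "vec (num P) v"] by (simp add: vnorm_square)
qed

text \<open>The bilinear bound is tested with \<open>w = K1 P *\<^sub>v v\<close>, after which a
  factor \<open>vnorm w\<close> cancels. The inequality makes the argument of the logarithm at least
  \<open>1 / \<delta>\<close>.\<close>

lemma spectral_norm_K1_le: "spectral_norm (K1 P) \<le> mtrace (K1 P)"
proof (rule spectral_norm_le)
  show "0 \<le> mtrace (K1 P)" using tr_K_nonneg by (simp add: mtrace_eq)
  fix v :: "real vec" assume "v \<in> carrier_vec (dim_col (K1 P))"
  then have v: "v \<in> carrier_vec (num P)" using K1_carrier by simp
  define w where "w = K1 P *\<^sub>v v"
  have w: "w \<in> carrier_vec (num P)" using v K1_carrier by (simp add: w_def)
  have "(vnorm w)\<^sup>2 = w \<bullet> (K1 P *\<^sub>v v)" unfolding w_def[symmetric] vnorm_square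
    by (simp add: scalar_prod_def lessThan_atLeast0 power2_eq_square)
  also have "\<dots> = (\<Sum>i<num P. \<Sum>l<num P. w $ i * K1 P $$ (i, l) * v $ l)"
    using v K1_carrier by (simp add: scalar_prod_def lessThan_atLeast0 sum_distrib_left mult.assoc)
  also have "\<dots> = (\<Sum>i<num P. \<Sum>l<num P. w $ i * (\<integral>\<omega>. feat P (pts P i) \<omega> * feat P (pts P l) \<omega> \<partial>feature_law P) * v $ l)"
    by (intro sum.cong refl) (simp add: K1_def kernel_eq)
  also have "\<dots> \<le> vnorm w * vnorm v * mtrace (K1 P)"
    using K_bilinear_le[of "($) w" "($) v"] v w by (simp add: vnorm_eq_L2 mtrace_eq)
  finally have "vnorm w * vnorm w \<le> vnorm w * (mtrace (K1 P) * vnorm v)"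
    by (simp add: power2_eq_square mult_ac)
  then show "vnorm (K1 P *\<^sub>v v) \<le> mtrace (K1 P) * vnorm v"
    using vnorm_nonneg[of w] vnorm_nonneg[of v] \<open>0 \<le> mtrace (K1 P)\<close>
    by (cases "vnorm w = 0") (auto simp: w_def[symmetric])
qed

text \<open>A norm above \<open>t\<close> means that some vector is stretched by more than
  \<open>t\<close>; its column matrix is the test element for \<open>tail_bound\<close>.\<close>

lemma deviation_witness:
  assumes m: "0 < m" and t: "0 \<le> t" "t < spectral_norm (gram_hat P m \<Omega> - gram P)"
  shows "\<exists>H. blk (num P) H \<and> (real m * t)\<^sup>2 * tr (num P) (star H * H)
    < tr (num P) (star (S m \<Omega> * H) * (S m \<Omega> * H))"
proof -
  define E where "E = gram_hat P m \<Omega> - gram P"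
  have E: "E \<in> carrier_mat (num P) (num P)"
    unfolding E_def using gram_carrier by (intro minus_carrier_mat)
  obtain v where v: "v \<in> carrier_vec (num P)" and big: "t * vnorm v < vnorm (E *\<^sub>v v)"
    using spectral_norm_le[OF t(1), of E] t(2) E unfolding E_def[symmetric] by fastforce
  have "(t * vnorm v)\<^sup>2 < (vnorm (E *\<^sub>v v))\<^sup>2"
    using big t(1) vnorm_nonneg[of v] by (intro power_strict_mono) auto
  then have lt: "(real m)\<^sup>2 * (t * vnorm v)\<^sup>2 < (real m)\<^sup>2 * (vnorm (E *\<^sub>v v))\<^sup>2"
    using m by simp
  have "S m \<Omega> * column (num P) (($) v) = column (num P) (\<lambda>i. real m * (E *\<^sub>v v) $ i)"
    unfolding S_eq[OF m] E_def[symmetric] mk_mult_column unfolding column_def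
    by (rule mk_cong) (use E v in \<open>auto simp: scalar_prod_def lessThan_atLeast0 sum_distrib_left mult.assoc\<close>)
  then have "tr (num P) (star (S m \<Omega> * column (num P) (($) v)) * (S m \<Omega> * column (num P) (($) v)))
      = (real m)\<^sup>2 * (vnorm (E *\<^sub>v v))\<^sup>2"
    using E by (simp only: tr_column[OF num_pos] vnorm_square power_mult_distrib sum_distrib_left) simp
  moreover have "(real m * t)\<^sup>2 * tr (num P) (star (column (num P) (($) v)) * column (num P) (($) v))
      = (real m)\<^sup>2 * (t * vnorm v)\<^sup>2"
    using v by (simp add: tr_column[OF num_pos] vnorm_square power_mult_distrib)
  ultimately show ?thesis
    using lt blk_mk by (intro exI[of _ "column (num P) (($) v)"]) (simp add: column_def)
qed

text \<open>The three summands of \<open>sandwich_diff\<close> match the three summands of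
  \<open>zeta\<close>, each times the norm of the deviation.\<close>

lemma hessian_diff_norm_le:
  assumes D: "spectral_norm (loss_curvature P w) \<le> lam1"
  shows "spectral_norm (hessian_hat P m \<Omega> w - hessian P w)
    \<le> zeta P lam1 m \<Omega> * spectral_norm (gram_hat P m \<Omega> - gram P)"
proof (rule spectral_norm_le)
  let ?A = "gram_hat P m \<Omega>" and ?B = "gram P" and ?D = "loss_curvature P w" and ?c = "1 / real (num P)"
  let ?n = "num P" and ?E = "gram_hat P m \<Omega> - gram P"
  note c = gram_hat_carrier[of m \<Omega>] gram_carrier curvature_carrier[of w]
  have E: "?E \<in> carrier_mat ?n ?n" using c by (intro minus_carrier_mat)
  have lam1: "0 \<le> lam1" using D spectral_norm_nonneg order_trans by blast
  show "0 \<le> zeta P lam1 m \<Omega> * spectral_norm ?E"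
    using lam1 lam_pos by (auto simp: zeta_def spectral_norm_nonneg intro!: mult_nonneg_nonneg add_nonneg_nonneg)
  fix v :: "real vec" assume "v \<in> carrier_vec (dim_col (hessian_hat P m \<Omega> w - hessian P w))"
  then have v: "v \<in> carrier_vec ?n" using c by (simp add: hessian_def)
  let ?a = "spectral_norm (?c \<cdot>\<^sub>m ?A)" and ?b = "spectral_norm (?c \<cdot>\<^sub>m ?B)" and ?e = "spectral_norm ?E"
  have cA: "?c \<cdot>\<^sub>m ?A \<in> carrier_mat ?n ?n" "?c \<cdot>\<^sub>m ?B \<in> carrier_mat ?n ?n" using c by auto
  have le: "vnorm (X *\<^sub>v v) \<le> spectral_norm X * vnorm v" if "X \<in> carrier_mat ?n ?n" for X
    using that v by (intro vnorm_mult_mat_le) auto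
  have D': "vnorm (?D *\<^sub>v (X *\<^sub>v v)) \<le> lam1 * spectral_norm X * vnorm v" if X: "X \<in> carrier_mat ?n ?n" for X
    using spectral_norm_mult_le[OF c(3) X v le[OF X]]
      mult_right_mono[OF D, of "spectral_norm X * vnorm v"]
    by (simp add: mult.assoc spectral_norm_nonneg vnorm_nonneg)
  have XDY: "vnorm (X *\<^sub>v (?D *\<^sub>v (Y *\<^sub>v v))) \<le> spectral_norm X * (lam1 * spectral_norm Y) * vnorm v"
    if X: "X \<in> carrier_mat ?n ?n" and Y: "Y \<in> carrier_mat ?n ?n" for X Y
  proof -
    have "?D *\<^sub>v (Y *\<^sub>v v) \<in> carrier_vec ?n" by (intro mult_mat_vec_carrier[of _ ?n ?n] c Y v)
    then have "vnorm (X *\<^sub>v (?D *\<^sub>v (Y *\<^sub>v v))) \<le> spectral_norm X * vnorm (?D *\<^sub>v (Y *\<^sub>v v))"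
      using X by (intro vnorm_mult_mat_le) auto
    also have "\<dots> \<le> spectral_norm X * (lam1 * spectral_norm Y * vnorm v)"
      by (intro mult_left_mono D' Y spectral_norm_nonneg)
    finally show ?thesis by (simp add: mult.assoc)
  qed
  have car: "X *\<^sub>v (?D *\<^sub>v (Y *\<^sub>v v)) \<in> carrier_vec ?n" "Y *\<^sub>v v \<in> carrier_vec ?n"
    if "X \<in> carrier_mat ?n ?n" "Y \<in> carrier_mat ?n ?n" for X Y
    by (intro mult_mat_vec_carrier[of _ ?n ?n] c that v)+
  have eq: "(hessian_hat P m \<Omega> w - hessian P w) *\<^sub>v v
      = ?E *\<^sub>v (?D *\<^sub>v ((?c \<cdot>\<^sub>m ?A) *\<^sub>v v)) + (?c \<cdot>\<^sub>m ?B) *\<^sub>v (?D *\<^sub>v (?E *\<^sub>v v)) + lam P \<cdot>\<^sub>v (?E *\<^sub>v v)"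
    unfolding hessian_hat_def hessian_def by (rule sandwich_diff[OF c v])
  have "vnorm ((hessian_hat P m \<Omega> w - hessian P w) *\<^sub>v v) \<le> vnorm (?E *\<^sub>v (?D *\<^sub>v ((?c \<cdot>\<^sub>m ?A) *\<^sub>v v)))
      + vnorm ((?c \<cdot>\<^sub>m ?B) *\<^sub>v (?D *\<^sub>v (?E *\<^sub>v v))) + vnorm (lam P \<cdot>\<^sub>v (?E *\<^sub>v v))"
  proof -
    have tri: "vnorm (p + q + r) \<le> vnorm p + vnorm q + vnorm r"
      if "p \<in> carrier_vec ?n" "q \<in> carrier_vec ?n" "r \<in> carrier_vec ?n" for p q r
      using vnorm_add_le[of "p + q" ?n r] vnorm_add_le[of p ?n q] that by simp
    show ?thesis
      unfolding eq by (rule tri[OF car(1)[OF E cA(1)] car(1)[OF cA(2) E] iffD2[OF smult_carrier_vec car(2)[OF E E]]])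
  qed
  also have "\<dots> \<le> ?e * (lam1 * ?a) * vnorm v + ?b * (lam1 * ?e) * vnorm v + lam P * (?e * vnorm v)"
    using lam_pos by (intro add_mono XDY E cA) (simp add: vnorm_smult le E)
  also have "\<dots> = zeta P lam1 m \<Omega> * ?e * vnorm v"
    by (simp add: zeta_def algebra_simps)
  finally show "vnorm ((hessian_hat P m \<Omega> w - hessian P w) *\<^sub>v v) \<le> zeta P lam1 m \<Omega> * ?e * vnorm v" .
qed

text \<open>\<open>\<gamma>\<close> is at most the quadratic form of the Hessian at a unit vector,
  hence at most its norm. This upper bound on \<open>\<gamma>\<close> is what later compares
  \<open>t\<close> with the norm of \<open>K1 P\<close>.\<close>

lemma hessian_lower_bound:
  assumes D: "spectral_norm (loss_curvature P w) \<le> lam1"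
    and le: "loewner_le (num P) (\<gamma> \<cdot>\<^sub>m 1\<^sub>m (num P)) (hessian P w)"
  shows "\<gamma> \<le> (lam P + lam1 * spectral_norm ((1 / real (num P)) \<cdot>\<^sub>m gram P)) * spectral_norm (gram P)"
proof -
  let ?B = "gram P" and ?D = "loss_curvature P w" and ?c = "1 / real (num P)" and ?n = "num P"
  note c = gram_carrier curvature_carrier[of w]
  define v where "v = (unit_vec ?n 0 :: real vec)"
  have v: "v \<in> carrier_vec ?n" by (simp add: v_def)
  have v1: "v \<bullet> v = 1" "vnorm v = 1"
    using num_pos by (simp_all add: v_def vnorm_def)
  let ?b = "spectral_norm (?c \<cdot>\<^sub>m ?B)"
  have cB: "?c \<cdot>\<^sub>m ?B \<in> carrier_mat ?n ?n" using c by auto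
  have Bv: "?B *\<^sub>v v \<in> carrier_vec ?n" "?D *\<^sub>v (?B *\<^sub>v v) \<in> carrier_vec ?n"
    "(?c \<cdot>\<^sub>m ?B) *\<^sub>v (?D *\<^sub>v (?B *\<^sub>v v)) \<in> carrier_vec ?n"
    by (intro mult_mat_vec_carrier[of _ ?n ?n] c cB v)+
  have H: "hessian P w \<in> carrier_mat ?n ?n"
    unfolding hessian_def by (intro add_carrier_mat smult_carrier_mat c)
  have Hv: "hessian P w *\<^sub>v v = (?c \<cdot>\<^sub>m ?B) *\<^sub>v (?D *\<^sub>v (?B *\<^sub>v v)) + lam P \<cdot>\<^sub>v (?B *\<^sub>v v)"
  proof -
    have BDB: "?B * ?D * ?B \<in> carrier_mat ?n ?n" by (intro mult_carrier_mat[of _ ?n ?n] c)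
    have "hessian P w *\<^sub>v v = (?c \<cdot>\<^sub>m (?B * ?D * ?B)) *\<^sub>v v + (lam P \<cdot>\<^sub>m ?B) *\<^sub>v v"
      unfolding hessian_def by (rule add_mult_distrib_mat_vec) (use BDB c v in auto)
    moreover have "(?B * ?D * ?B) *\<^sub>v v = ?B *\<^sub>v (?D *\<^sub>v (?B *\<^sub>v v))"
      using c v by (simp add: assoc_mult_mat_vec[of _ ?n ?n _ ?n])
    ultimately show ?thesis
      by (simp add: smult_mat_vec[OF BDB v] smult_mat_vec[OF c(1) v] smult_mat_vec[OF c(1) Bv(2)])
  qed
  have "0 \<le> v \<bullet> ((hessian P w - \<gamma> \<cdot>\<^sub>m 1\<^sub>m ?n) *\<^sub>v v)"
    using le v by (simp add: loewner_le_def psd_def)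
  also have "(hessian P w - \<gamma> \<cdot>\<^sub>m 1\<^sub>m ?n) *\<^sub>v v = hessian P w *\<^sub>v v - \<gamma> \<cdot>\<^sub>v v"
    using minus_mult_distrib_mat_vec[OF H _ v, of "\<gamma> \<cdot>\<^sub>m 1\<^sub>m ?n"] smult_mat_vec[OF one_carrier_mat v, of \<gamma>] v
    by simp
  also have "v \<bullet> \<dots> = v \<bullet> (hessian P w *\<^sub>v v) - \<gamma>"
    using scalar_prod_minus_distrib[OF v mult_mat_vec_carrier[OF H v], of "\<gamma> \<cdot>\<^sub>v v"] v v1(1) by simp
  finally have "\<gamma> \<le> v \<bullet> (hessian P w *\<^sub>v v)" by simp
  also have "\<dots> \<le> vnorm (hessian P w *\<^sub>v v)"
    using scalar_prod_le_vnorm[OF v, of "hessian P w *\<^sub>v v"] H v by (simp add: v1 mult_mat_vec_carrier)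
  also have "\<dots> \<le> vnorm ((?c \<cdot>\<^sub>m ?B) *\<^sub>v (?D *\<^sub>v (?B *\<^sub>v v))) + vnorm (lam P \<cdot>\<^sub>v (?B *\<^sub>v v))"
    unfolding Hv by (intro vnorm_add_le[of _ ?n] iffD2[OF smult_carrier_vec] Bv)
  also have "\<dots> \<le> ?b * (lam1 * spectral_norm ?B) + lam P * spectral_norm ?B"
  proof (intro add_mono)
    have B: "vnorm (?B *\<^sub>v v) \<le> spectral_norm ?B"
      using vnorm_mult_mat_le[of v ?B] c v by (simp add: v1)
    then show "vnorm (lam P \<cdot>\<^sub>v (?B *\<^sub>v v)) \<le> lam P * spectral_norm ?B"
      using lam_pos by (simp add: vnorm_smult)
    have "vnorm (?D *\<^sub>v (?B *\<^sub>v v)) \<le> spectral_norm ?D * vnorm (?B *\<^sub>v v)"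
      using c Bv by (intro vnorm_mult_mat_le) auto
    also have "\<dots> \<le> lam1 * spectral_norm ?B"
      by (intro mult_mono D B vnorm_nonneg order_trans[OF spectral_norm_nonneg D])
    finally have D': "vnorm (?D *\<^sub>v (?B *\<^sub>v v)) \<le> lam1 * spectral_norm ?B" .
    have "vnorm ((?c \<cdot>\<^sub>m ?B) *\<^sub>v (?D *\<^sub>v (?B *\<^sub>v v))) \<le> ?b * vnorm (?D *\<^sub>v (?B *\<^sub>v v))"
      using cB Bv by (intro vnorm_mult_mat_le) auto
    also have "\<dots> \<le> ?b * (lam1 * spectral_norm ?B)"
      by (intro mult_left_mono D' spectral_norm_nonneg)
    finally show "vnorm ((?c \<cdot>\<^sub>m ?B) *\<^sub>v (?D *\<^sub>v (?B *\<^sub>v v))) \<le> ?b * (lam1 * spectral_norm ?B)" .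
  qed
  also have "\<dots> = (lam P + lam1 * ?b) * spectral_norm ?B" by (simp add: algebra_simps)
  finally show ?thesis .
qed

lemma measurable_gram_hat: "measurable_mat (sample_law P m) (num P) (gram_hat P m)"
proof (rule measurable_mat_cong_entry[OF gram_hat_carrier])
  fix \<Omega> i j assume "i < num P" "j < num P"
  then show "gram_hat P m \<Omega> $$ (i, j) = (\<Sum>l<m. 1 / sqrt (real m) * feat P (pts P i) (\<Omega> l)
      * (1 / sqrt (real m) * feat P (pts P j) (\<Omega> l))) + mu P * (if i = j then 1 else 0)"
    by (simp add: gram_hat_def Zmat_def scalar_prod_def lessThan_atLeast0)
next
  fix i j assume ij: "i < num P" "j < num P"
  have "(\<lambda>\<Omega>. feat P (pts P i) (\<Omega> l)) \<in> borel_measurable (sample_law P m)" if "i < num P" "l < m" for i l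
    unfolding sample_law_def using that
    by (intro measurable_compose[OF measurable_component_singleton[of l "{..<m}" "\<lambda>_. feature_law P"]
          z_measurable[of i]]) auto
  then show "(\<lambda>\<Omega>. (\<Sum>l<m. 1 / sqrt (real m) * feat P (pts P i) (\<Omega> l)
      * (1 / sqrt (real m) * feat P (pts P j) (\<Omega> l))) + mu P * (if i = j then 1 else 0))
      \<in> borel_measurable (sample_law P m)"
    using ij by (intro borel_measurable_add borel_measurable_sum borel_measurable_times borel_measurable_const) auto
qed

lemma measurable_zeta: "zeta P lam1 m \<in> borel_measurable (sample_law P m)"
  unfolding zeta_def[abs_def]
  by (intro borel_measurable_add borel_measurable_times borel_measurable_const
      borel_measurable_spectral_norm[of _ "num P"] measurable_mat_ops(3)[OF measurable_gram_hat measurable_gram_hat])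

lemma measurable_sample_size: "sample_size P \<gamma> lam1 \<epsilon> \<delta> m \<in> borel_measurable (sample_law P m)"
  unfolding sample_size_def[abs_def]
  by (intro borel_measurable_times borel_measurable_divide borel_measurable_const borel_measurable_power measurable_zeta)

lemma measurable_hessian_diff:
  "(\<lambda>\<Omega>. spectral_norm (hessian_hat P m \<Omega> w - hessian P w)) \<in> borel_measurable (sample_law P m)"
proof (rule borel_measurable_spectral_norm)
  note g = measurable_gram_hat[of m]
  note cst = measurable_mat_const
  have H: "hessian P w \<in> carrier_mat (num P) (num P)"
    unfolding hessian_def by (intro add_carrier_mat smult_carrier_mat gram_carrier)
  have gDg: "measurable_mat (sample_law P m) (num P) (\<lambda>\<Omega>. gram_hat P m \<Omega> * loss_curvature P w * gram_hat P m \<Omega>)"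
    by (intro measurable_mat_mult g cst curvature_carrier)
  show "measurable_mat (sample_law P m) (num P) (\<lambda>\<Omega>. hessian_hat P m \<Omega> w - hessian P w)"
    unfolding hessian_hat_def
    by (intro measurable_mat_ops(2) measurable_mat_ops(1) measurable_mat_ops(3)[OF _ g] g gDg cst H)
qed

end

text \<open>\<open>zeta\<close> is random but at least \<open>\<zeta>0\<close>, its part without
  samples, and \<open>\<gamma>\<close> is at most \<open>\<zeta>0\<close> times the norm of the Gram
  matrix. The two factors \<open>\<zeta>0\<close> cancel, so \<open>t \<le> \<kappa> * k\<close>
  needs no control of the sampled part of \<open>zeta\<close>.\<close>

lemma (in kernel_problem) hessian_concentration:
  assumes \<kappa>: "0 < \<kappa>" and \<delta>0: "0 < \<delta>0" "\<delta>0 < 1"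
    and \<gamma>: "0 < \<gamma>" and \<epsilon>: "0 < \<epsilon>" and \<epsilon>\<kappa>: "\<epsilon> * spectral_norm (gram P) \<le> \<kappa> * spectral_norm (K1 P)"
    and \<delta>: "0 < \<delta>" "\<delta> \<le> \<delta>0" and m: "0 < m"
    and D: "spectral_norm (loss_curvature P w) \<le> lam1"
    and le: "loewner_le (num P) (\<gamma> \<cdot>\<^sub>m 1\<^sub>m (num P)) (hessian P w)"
  defines "C \<equiv> rate_const \<kappa> (ln (1 / \<delta>0))"
  shows "1 - \<delta> \<le> measure (sample_law P m) {\<Omega> \<in> space (sample_law P m).
      C * sample_size P \<gamma> lam1 \<epsilon> \<delta> m \<Omega> \<le> real m \<longrightarrow>
      spectral_norm (hessian_hat P m \<Omega> w - hessian P w) \<le> \<epsilon> * \<gamma>}"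
proof -
  let ?N = "sample_law P m" and ?n = "real (num P)" and ?g = "spectral_norm (gram P)"
  define k where "k = spectral_norm (K1 P)"
  define l0 where "l0 = ln (1 / \<delta>0)"
  define l where "l = ln (mtrace (K1 P) / (k * \<delta>))"
  define A where "A = {\<Omega> \<in> space ?N. C * sample_size P \<gamma> lam1 \<epsilon> \<delta> m \<Omega> \<le> real m \<and>
      \<not> spectral_norm (hessian_hat P m \<Omega> w - hessian P w) \<le> \<epsilon> * \<gamma>}"
  have iid: "?N = iid m" by (simp add: sample_law_def)
  interpret N: prob_space ?N unfolding iid by (rule prob_space_iid)
  have [measurable]: "sample_size P \<gamma> lam1 \<epsilon> \<delta> m \<in> borel_measurable ?N"
    "(\<lambda>\<Omega>. spectral_norm (hessian_hat P m \<Omega> w - hessian P w)) \<in> borel_measurable ?N"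
    by (rule measurable_sample_size measurable_hessian_diff)+
  have A: "A \<in> sets ?N" unfolding A_def by measurable
  have lam1: "0 \<le> lam1" using D spectral_norm_nonneg order_trans by blast
  define \<zeta>0 where "\<zeta>0 = lam P + lam1 * spectral_norm ((1 / ?n) \<cdot>\<^sub>m gram P)"
  have \<zeta>0: "0 < \<zeta>0"
    using lam_pos lam1 by (simp add: \<zeta>0_def add_pos_nonneg spectral_norm_nonneg)
  have \<zeta>: "\<zeta>0 \<le> zeta P lam1 m \<Omega>" for \<Omega>
    using lam1 by (simp add: \<zeta>0_def zeta_def spectral_norm_nonneg)
  have \<gamma>_le: "\<gamma> \<le> \<zeta>0 * ?g"
    unfolding \<zeta>0_def by (rule hessian_lower_bound[OF D le])
  \<comment> \<open>A positive \<open>\<gamma>\<close> excludes a zero Gram matrix, and the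
    assumption with \<open>\<kappa>\<close> then excludes \<open>k = 0\<close>, so no division by
    zero hides in \<open>l\<close>.\<close>
  then have "0 < ?g" using \<gamma> \<zeta>0 by (metis less_le_trans zero_less_mult_pos)
  then have k: "0 < k"
    using \<epsilon>\<kappa> \<epsilon> \<kappa> unfolding k_def by (metis less_le_trans mult_pos_pos zero_less_mult_pos)
  have k_le: "k \<le> mtrace (K1 P)" unfolding k_def by (rule spectral_norm_K1_le)
  have l0: "0 < l0" using \<delta>0 by (simp add: l0_def)
  have "1 / \<delta>0 \<le> 1 / \<delta>" using \<delta> by (intro divide_left_mono) auto
  also have "\<dots> \<le> mtrace (K1 P) / (k * \<delta>)"
    using k_le k \<delta>(1) by (simp add: field_simps)
  finally have l: "l0 \<le> l" unfolding l0_def l_def using \<delta>0(1) by (intro ln_mono) auto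
  have C: "0 < C" unfolding C_def l0_def[symmetric] by (rule rate_const_pos[OF \<kappa> l0])
  define t where "t = sqrt (C * ?n * k * l / real m)"
  have pos: "0 < C * ?n * k * l / real m" using C num_pos k l l0 m by simp
  then have t: "0 < t" and t2: "t\<^sup>2 = C * ?n * k * l / real m" by (simp_all add: t_def)
  have bad: "zeta P lam1 m \<Omega> * t \<le> \<epsilon> * \<gamma>" "t < spectral_norm (gram_hat P m \<Omega> - gram P)" if \<Omega>: "\<Omega> \<in> A" for \<Omega>
  proof -
    let ?z = "zeta P lam1 m \<Omega>"
    have z: "0 < ?z" using \<zeta>0 \<zeta>[of \<Omega>] by simp
    have "C * (?z\<^sup>2 * ?n * k / (\<epsilon>\<^sup>2 * \<gamma>\<^sup>2) * l) \<le> real m"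
      using \<Omega> by (simp add: A_def sample_size_def k_def l_def)
    then have "?z\<^sup>2 * (C * ?n * k * l / real m) \<le> (\<epsilon> * \<gamma>)\<^sup>2"
      using m \<epsilon> \<gamma> by (simp add: field_simps)
    then have "(?z * t)\<^sup>2 \<le> (\<epsilon> * \<gamma>)\<^sup>2" by (simp add: power_mult_distrib t2)
    then show 1: "?z * t \<le> \<epsilon> * \<gamma>" using \<epsilon> \<gamma> by (intro power2_le_imp_le[of "?z * t"]) auto
    also have "\<epsilon> * \<gamma> < spectral_norm (hessian_hat P m \<Omega> w - hessian P w)"
      using \<Omega> by (simp add: A_def)
    also have "\<dots> \<le> ?z * spectral_norm (gram_hat P m \<Omega> - gram P)"
      by (rule hessian_diff_norm_le[OF D])
    finally show "t < spectral_norm (gram_hat P m \<Omega> - gram P)" using z by simp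
  qed
  have "measure ?N A \<le> \<delta>"
  \<comment> \<open>Comparing \<open>t\<close> with \<open>k\<close> takes a sample that meets the
    random requirement. If \<open>A\<close> is empty there may be none, but then its measure is
    0.\<close>
  proof (cases "A = {}")
    case False
    then obtain \<Omega> where "\<Omega> \<in> A" by blast
    have "\<zeta>0 * t \<le> zeta P lam1 m \<Omega> * t" using \<zeta> t by (intro mult_right_mono) auto
    also have "\<dots> \<le> \<epsilon> * \<gamma>" by (rule bad[OF \<open>\<Omega> \<in> A\<close>])
    also have "\<dots> \<le> \<epsilon> * (\<zeta>0 * ?g)" using \<gamma>_le \<epsilon> by (intro mult_left_mono) auto
    also have "\<dots> = \<zeta>0 * (\<epsilon> * ?g)" by simp
    also have "\<dots> \<le> \<zeta>0 * (\<kappa> * k)" using \<epsilon>\<kappa> \<zeta>0 unfolding k_def by (intro mult_left_mono) auto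
    finally have t_le: "t \<le> \<kappa> * k" using \<zeta>0 by simp
    show ?thesis
      unfolding iid
    proof (rule tail_bound[OF num_pos m k pos_norm_diff_K[folded k_def] \<delta>(1) _ _ \<kappa> l0 l t t_le])
      show "0 < tr (num P) K" using k k_le by (simp add: mtrace_eq)
      show "l = ln (tr (num P) K / (k * \<delta>))" by (simp add: l_def mtrace_eq)
      show "real m * t\<^sup>2 = rate_const \<kappa> l0 * ?n * k * l"
        using m by (simp add: t2 C_def l0_def)
      show "A \<in> sets (iid m)" using A by (simp only: iid)
    next
      fix \<Omega> assume "\<Omega> \<in> A"
      from deviation_witness[OF m less_imp_le[OF t] bad(2)[OF this]]
      show "\<exists>H. blk (num P) H \<and> (real m * t)\<^sup>2 * tr (num P) (star H * H)
          < tr (num P) (star (S m \<Omega> * H) * (S m \<Omega> * H))" .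
    qed
  qed (use \<delta> in simp)
  then have "1 - \<delta> \<le> measure ?N (space ?N - A)"
    using N.prob_compl[OF A] by simp
  also have "space ?N - A = {\<Omega> \<in> space ?N. C * sample_size P \<gamma> lam1 \<epsilon> \<delta> m \<Omega> \<le> real m \<longrightarrow>
      spectral_norm (hessian_hat P m \<Omega> w - hessian P w) \<le> \<epsilon> * \<gamma>}"
    by (auto simp: A_def)
  finally show ?thesis .
qed

theorem lemma1:
  fixes \<kappa> \<delta>0 :: real
  assumes "0 < \<kappa>" and "0 < \<delta>0" and "\<delta>0 < 1"
  shows "\<exists>C>0. \<forall>P \<gamma> L lam1 \<epsilon> \<delta> m.
    valid_problem P \<longrightarrow>
    0 < \<gamma> \<longrightarrow>
    twice_differentiable (num P) (objective P) \<longrightarrow>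
    strongly_convex (num P) \<gamma> (objective P) \<longrightarrow>
    smooth (num P) L (objective P) \<longrightarrow>
    (\<forall>w \<in> carrier_vec (num P).
       loewner_le (num P) (\<gamma> \<cdot>\<^sub>m 1\<^sub>m (num P)) (hessian P w) \<and>
       loewner_le (num P) (hessian P w) (L \<cdot>\<^sub>m 1\<^sub>m (num P))) \<longrightarrow>
    (\<forall>w \<in> carrier_vec (num P). spectral_norm (loss_curvature P w) \<le> lam1) \<longrightarrow>
    0 < \<epsilon> \<longrightarrow> \<epsilon> * spectral_norm (gram P) \<le> \<kappa> * spectral_norm (K1 P) \<longrightarrow>
    0 < \<delta> \<longrightarrow> \<delta> \<le> \<delta>0 \<longrightarrow> 0 < m \<longrightarrow>
    (\<forall>w \<in> carrier_vec (num P).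
       ((AE \<Omega> in sample_law P m. C * sample_size P \<gamma> lam1 \<epsilon> \<delta> m \<Omega> \<le> real m) \<longrightarrow>
        measure (sample_law P m) {\<Omega> \<in> space (sample_law P m).
            spectral_norm (hessian_hat P m \<Omega> w - hessian P w) \<le> \<epsilon> * \<gamma>} \<ge> 1 - \<delta>) \<and>
       measure (sample_law P m) {\<Omega> \<in> space (sample_law P m).
            C * sample_size P \<gamma> lam1 \<epsilon> \<delta> m \<Omega> \<le> real m \<longrightarrow>
            spectral_norm (hessian_hat P m \<Omega> w - hessian P w) \<le> \<epsilon> * \<gamma>} \<ge> 1 - \<delta>)"
proof -
  \<comment> \<open>\<open>ln (1 / \<delta>0)\<close> is a lower bound of the logarithm in
    \<open>sample_size\<close> common to all admissible problems, so \<open>C\<close> depends on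
    \<open>\<kappa>\<close> and \<open>\<delta>0\<close> alone.\<close>
  define C where "C = rate_const \<kappa> (ln (1 / \<delta>0))"
  have "0 < C" unfolding C_def using assms by (intro rate_const_pos) auto
  moreover have "((AE \<Omega> in sample_law P m. C * sample_size P \<gamma> lam1 \<epsilon> \<delta> m \<Omega> \<le> real m) \<longrightarrow>
        1 - \<delta> \<le> measure (sample_law P m) {\<Omega> \<in> space (sample_law P m).
            spectral_norm (hessian_hat P m \<Omega> w - hessian P w) \<le> \<epsilon> * \<gamma>}) \<and>
       1 - \<delta> \<le> measure (sample_law P m) {\<Omega> \<in> space (sample_law P m).
            C * sample_size P \<gamma> lam1 \<epsilon> \<delta> m \<Omega> \<le> real m \<longrightarrow>
            spectral_norm (hessian_hat P m \<Omega> w - hessian P w) \<le> \<epsilon> * \<gamma>}"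
    if "valid_problem P" "0 < \<gamma>" "loewner_le (num P) (\<gamma> \<cdot>\<^sub>m 1\<^sub>m (num P)) (hessian P w)"
      "spectral_norm (loss_curvature P w) \<le> lam1" "0 < \<epsilon>"
      "\<epsilon> * spectral_norm (gram P) \<le> \<kappa> * spectral_norm (K1 P)" "0 < \<delta>" "\<delta> \<le> \<delta>0" "0 < m"
    for P \<gamma> lam1 \<epsilon> \<delta> m w
  proof -
    interpret kernel_problem P by unfold_locales (rule that)
    let ?N = "sample_law P m"
    have [measurable]: "sample_size P \<gamma> lam1 \<epsilon> \<delta> m \<in> borel_measurable ?N"
      "(\<lambda>\<Omega>. spectral_norm (hessian_hat P m \<Omega> w - hessian P w)) \<in> borel_measurable ?N"
      by (rule measurable_sample_size measurable_hessian_diff)+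
    have conc: "1 - \<delta> \<le> measure ?N {\<Omega> \<in> space ?N.
        C * sample_size P \<gamma> lam1 \<epsilon> \<delta> m \<Omega> \<le> real m \<longrightarrow>
        spectral_norm (hessian_hat P m \<Omega> w - hessian P w) \<le> \<epsilon> * \<gamma>}"
      unfolding C_def by (rule hessian_concentration) (use assms that in simp_all)
    \<comment> \<open>If the requirement holds almost surely, the conditional and the plain event
      differ by a null set, so the first claim is a case of the second.\<close>
    have eq: "measure ?N {\<Omega> \<in> space ?N. C * sample_size P \<gamma> lam1 \<epsilon> \<delta> m \<Omega> \<le> real m \<longrightarrow>
          spectral_norm (hessian_hat P m \<Omega> w - hessian P w) \<le> \<epsilon> * \<gamma>}
        = measure ?N {\<Omega> \<in> space ?N. spectral_norm (hessian_hat P m \<Omega> w - hessian P w) \<le> \<epsilon> * \<gamma>}"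
      if ae: "AE \<Omega> in ?N. C * sample_size P \<gamma> lam1 \<epsilon> \<delta> m \<Omega> \<le> real m"
    proof (rule measure_eq_AE)
      show "AE \<Omega> in ?N. (\<Omega> \<in> {\<Omega> \<in> space ?N. C * sample_size P \<gamma> lam1 \<epsilon> \<delta> m \<Omega> \<le> real m \<longrightarrow>
          spectral_norm (hessian_hat P m \<Omega> w - hessian P w) \<le> \<epsilon> * \<gamma>}) =
        (\<Omega> \<in> {\<Omega> \<in> space ?N. spectral_norm (hessian_hat P m \<Omega> w - hessian P w) \<le> \<epsilon> * \<gamma>})"
        using ae by eventually_elim simp
    qed measurable
    show ?thesis
    proof (intro conjI impI conc)
      assume ae: "AE \<Omega> in ?N. C * sample_size P \<gamma> lam1 \<epsilon> \<delta> m \<Omega> \<le> real m"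
      show "1 - \<delta> \<le> measure ?N {\<Omega> \<in> space ?N. spectral_norm (hessian_hat P m \<Omega> w - hessian P w) \<le> \<epsilon> * \<gamma>}"
        using conc unfolding eq[OF ae] .
    qed
  qed
  ultimately show ?thesis by (intro exI[of _ C]) blast
qed

end
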